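(* Let $G = (G_x)_{x \in X}$ be a Borel field of Polish groups that are all locally compact. Let $(\lambda_x)_{x \in X}$ be a choice of left Haar measures $\lambda_x$ on $G_x$ such that for every Borel function $F : G\to[0,+\infty]$, the map $X\to[0,+\infty] : x\mapsto\int_{G_x}F\,d\lambda_x$ is Borel. Let $1 \leq p < +\infty$. Then $L^p(G) = (L^p(G_x,\lambda_x))_{x \in X}$ admits a unique standard Borel structure such that $\pi : L^p(G) \to X$ is Borel and the map $$L^p(G) \times_\pi C_c(G) \to \mathbb{C} : (\xi,F) \mapsto \int_{G_{\pi(\xi)}} \xi \, F \, d\lambda_{\pi(\xi)}$$ is Borel. In this way, $L^p(G)$ is a Borel field of separable Banach spaces. Also, for $p=1$, the map $$L^1(G) \to \mathbb{C} : \xi \mapsto \int_{G_{\pi(\xi)}} \xi \, d\lambda_{\pi(\xi)}$$ is Borel.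
   Context: Conventions. A standard Borel space is a measurable space isomorphic to a Borel subset of a Polish space. Product spaces carry the product $\sigma$-algebra and subsets the restricted $\sigma$-algebra. For a family of sets $V = (V_x)_{x\in X}$, the symbol $V$ also denotes the disjoint union of the $V_x$, and $\pi : V \to X$ is the map with $\pi(v) = x$ for $v \in V_x$. For two families over $X$, $V \times_\pi W = \{(v,w) \in V \times W \mid \pi(v)=\pi(w)\}$. A section is a map $\varphi : X \to V$ with $\varphi(x)\in V_x$ for all $x$. A sequence of Borel sections $\varphi_n : X \to V$ is dense if $\{\varphi_n(x) \mid n\in\mathbb{N}\}$ is dense in $V_x$ for every $x\in X$. A Borel field of Polish spaces consists of a standard Borel space $X$, a family $V=(V_x)_{x\in X}$ of Polish spaces and a standard Borel structure on $V$ such that: (1) $\pi : V\to X$ is Borel; (2) there is a Borel map $d : V\times_\pi V\to[0,+\infty)$ whose restriction to each $V_x\times V_x$ is a separable complete metric inducing the topology of $V_x$; (3) there is a dense sequence of Borel sections $X\to V$. A Borel field of Polish groups is a family $G=(G_x)_{x\in X}$ of Polish groups over a standard Borel space $X$ with a standard Borel structure on $G$ such that $G$ is a Borel field of Polish spaces and the unit section $X\to G : x\mapsto e_x$, the inverse $G\to G$ and the multiplication $G\times_\pi G\to G$ are Borel. A Borel field of separable Banach spaces (complex scalars) consists of a standard Borel space $X$, a family $V=(V_x)_{x\in X}$ of separable Banach spaces and a standard Borel structure on $V$ such that $\pi : V\to X$, the norm $V\to[0,+\infty)$, the addition $V\times_\pi V\to V$ and the scalar multiplication $\mathbb{C}\times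 V\to V$ are Borel, and there is a (norm) dense sequence of Borel sections $X\to V$. Borel structure on $C_c(G)$: for $G$ as in the claim, it is a fact that $C_0(G)=(C_0(G_x))_{x\in X}$ (continuous functions $G_x\to\mathbb{C}$ tending to zero at infinity) has a unique standard Borel structure such that $\pi : C_0(G)\to X$ and $C_0(G)\times_\pi G\to\mathbb{C} : (F,g)\mapsto F(g)$ are Borel, and that $C_c(G)=(C_c(G_x))_{x\in X}$ (compactly supported continuous functions) is a Borel subset; $C_c(G)$ carries the restricted structure. It is also a fact that Haar measures $(\lambda_x)$ as in the claim exist. *)

theory Defs
  imports "HOL-Analysis.Analysis" "HOL-Algebra.Module"
begin

text \<open>
  A measurable space (a set together with a \<sigma>-algebra) is represented by a value of type
  \<open>'a measure\<close> of which only \<open>space\<close> and \<open>sets\<close> matter; two structures on a set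
  are the same iff their \<open>sets\<close> agree.
  The disjoint union of a family \<open>V\<close> over \<open>X\<close> is \<open>Sigma (space X) V\<close>, so \<open>\<pi>\<close> is \<open>fst\<close>.
\<close>


section \<open>Standard Borel spaces\<close>

definition polish_space :: "'a topology \<Rightarrow> bool" where
  "polish_space T \<longleftrightarrow> completely_metrizable_space T \<and> separable_space T"

definition borel_of :: "'a topology \<Rightarrow> 'a measure" where
  "borel_of T = sigma (topspace T) {U. openin T U}"

definition measurable_iso :: "'a measure \<Rightarrow> 'b measure \<Rightarrow> bool" where
  "measurable_iso M N \<longleftrightarrow>
     (\<exists>f g. f \<in> M \<rightarrow>\<^sub>M N \<and> g \<in> N \<rightarrow>\<^sub>M M \<and>
            (\<forall>x\<in>space M. g (f x) = x) \<and> (\<forall>y\<in>space N. f (g y) = y))"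

text \<open>
  The Polish space \<open>P\<close> ranges over all Polish topologies whose points belong to the type
  \<open>nat \<Rightarrow> real\<close> (the topology is arbitrary and \<open>topspace P\<close> may be any subset).
  Every Polish space has at most continuum many points, so up to homeomorphism
  these are all the Polish spaces.
\<close>
definition standard_borel :: "'a measure \<Rightarrow> bool" where
  "standard_borel M \<longleftrightarrow>
     (\<exists>(P :: (nat \<Rightarrow> real) topology) B.
        polish_space P \<and> B \<in> sets (borel_of P) \<and> measurable_iso M (restrict_space (borel_of P) B))"

definition standard_borel_structure_on :: "'a set \<Rightarrow> 'a measure \<Rightarrow> bool" where
  "standard_borel_structure_on S M \<longleftrightarrow> space M = S \<and> standard_borel M"


section \<open>Borel fields of Polish spaces and of Polish groups\<close>

definition fibre_prod ::
    "('x \<times> 'v) measure \<Rightarrow> ('x \<times> 'w) measure \<Rightarrow> (('x \<times> 'v) \<times> ('x \<times> 'w)) measure" where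
  "fibre_prod M N = restrict_space (M \<Otimes>\<^sub>M N) {(v, w). fst v = fst w}"

definition dense_sequence_of_borel_sections ::
    "'x measure \<Rightarrow> ('x \<Rightarrow> 'v topology) \<Rightarrow> ('x \<times> 'v) measure \<Rightarrow> bool" where
  "dense_sequence_of_borel_sections X T M \<longleftrightarrow>
     (\<exists>\<phi> :: nat \<Rightarrow> 'x \<Rightarrow> 'v.
        (\<forall>n. (\<lambda>x. (x, \<phi> n x)) \<in> X \<rightarrow>\<^sub>M M) \<and>
        (\<forall>x\<in>space X. (\<forall>n. \<phi> n x \<in> topspace (T x)) \<and>
                     T x closure_of range (\<lambda>n. \<phi> n x) = topspace (T x)))"

definition borel_field_of_polish_spaces ::
    "'x measure \<Rightarrow> ('x \<Rightarrow> 'v topology) \<Rightarrow> ('x \<times> 'v) measure \<Rightarrow> bool" where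
  "borel_field_of_polish_spaces X T M \<longleftrightarrow>
     standard_borel X \<and>
     (\<forall>x\<in>space X. polish_space (T x)) \<and>
     standard_borel_structure_on (Sigma (space X) (\<lambda>x. topspace (T x))) M \<and>
     fst \<in> M \<rightarrow>\<^sub>M X \<and>
     (\<exists>d :: ('x \<times> 'v) \<times> ('x \<times> 'v) \<Rightarrow> real.
        d \<in> borel_measurable (fibre_prod M M) \<and>
        (\<forall>x\<in>space X. Metric_space (topspace (T x)) (\<lambda>u v. d ((x, u), (x, v))) \<and>
           Metric_space.mcomplete (topspace (T x)) (\<lambda>u v. d ((x, u), (x, v))) \<and>
           Metric_space.mtopology (topspace (T x)) (\<lambda>u v. d ((x, u), (x, v))) = T x)) \<and>
     dense_sequence_of_borel_sections X T M"

definition topological_group :: "('g, 'm) monoid_scheme \<Rightarrow> 'g topology \<Rightarrow> bool" where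
  "topological_group G T \<longleftrightarrow>
     group G \<and> topspace T = carrier G \<and>
     continuous_map (prod_topology T T) T (\<lambda>(g, h). g \<otimes>\<^bsub>G\<^esub> h) \<and>
     continuous_map T T (m_inv G)"

definition borel_field_of_polish_groups ::
    "'x measure \<Rightarrow> ('x \<Rightarrow> ('g, 'm) monoid_scheme) \<Rightarrow> ('x \<Rightarrow> 'g topology) \<Rightarrow> ('x \<times> 'g) measure \<Rightarrow> bool"
  where
  "borel_field_of_polish_groups X G T M \<longleftrightarrow>
     borel_field_of_polish_spaces X T M \<and>
     (\<forall>x\<in>space X. topological_group (G x) (T x)) \<and>
     (\<lambda>x. (x, \<one>\<^bsub>G x\<^esub>)) \<in> X \<rightarrow>\<^sub>M M \<and>
     (\<lambda>(x, g). (x, inv\<^bsub>G x\<^esub> g)) \<in> M \<rightarrow>\<^sub>M M \<and>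
     (\<lambda>((x, g), (y, h)). (x, g \<otimes>\<^bsub>G x\<^esub> h)) \<in> fibre_prod M M \<rightarrow>\<^sub>M M"


section \<open>Borel fields of separable Banach spaces\<close>

definition complex_ring :: "complex ring" where
  "complex_ring = \<lparr>carrier = UNIV, monoid.mult = (*), one = 1, ring.zero = 0, add = (+)\<rparr>"

text \<open>The \<open>mult\<close> and \<open>one\<close> fields inherited from \<open>ring\<close> play no role in \<open>module\<close>.\<close>
record 'v normed_space = "(complex, 'v) module" +
  nrm :: "'v \<Rightarrow> real"

text \<open>The locale \<open>Metric_space\<close> requires nonnegativity and symmetry also outside the carrier.\<close>
definition norm_dist :: "('v, 'm) normed_space_scheme \<Rightarrow> 'v \<Rightarrow> 'v \<Rightarrow> real" where
  "norm_dist V u v = (if u \<in> carrier V \<and> v \<in> carrier V then nrm V (u \<ominus>\<^bsub>V\<^esub> v) else 0)"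

definition norm_topology :: "('v, 'm) normed_space_scheme \<Rightarrow> 'v topology" where
  "norm_topology V = Metric_space.mtopology (carrier V) (norm_dist V)"

definition banach_space :: "('v, 'm) normed_space_scheme \<Rightarrow> bool" where
  "banach_space V \<longleftrightarrow>
     Module.module complex_ring V \<and>
     (\<forall>v\<in>carrier V. 0 \<le> nrm V v \<and> (nrm V v = 0 \<longleftrightarrow> v = \<zero>\<^bsub>V\<^esub>)) \<and>
     (\<forall>c. \<forall>v\<in>carrier V. nrm V (c \<odot>\<^bsub>V\<^esub> v) = cmod c * nrm V v) \<and>
     (\<forall>u\<in>carrier V. \<forall>v\<in>carrier V. nrm V (u \<oplus>\<^bsub>V\<^esub> v) \<le> nrm V u + nrm V v) \<and>
     Metric_space.mcomplete (carrier V) (norm_dist V)"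

definition borel_field_of_separable_banach_spaces ::
    "'x measure \<Rightarrow> ('x \<Rightarrow> ('v, 'm) normed_space_scheme) \<Rightarrow> ('x \<times> 'v) measure \<Rightarrow> bool" where
  "borel_field_of_separable_banach_spaces X V M \<longleftrightarrow>
     standard_borel X \<and>
     (\<forall>x\<in>space X. banach_space (V x) \<and> separable_space (norm_topology (V x))) \<and>
     standard_borel_structure_on (Sigma (space X) (\<lambda>x. carrier (V x))) M \<and>
     fst \<in> M \<rightarrow>\<^sub>M X \<and>
     (\<lambda>(x, v). nrm (V x) v) \<in> borel_measurable M \<and>
     (\<lambda>((x, u), (y, v)). (x, u \<oplus>\<^bsub>V x\<^esub> v)) \<in> fibre_prod M M \<rightarrow>\<^sub>M M \<and>
     (\<lambda>(c, (x, v)). (x, c \<odot>\<^bsub>V x\<^esub> v)) \<in> (borel :: complex measure) \<Otimes>\<^sub>M M \<rightarrow>\<^sub>M M \<and>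
     dense_sequence_of_borel_sections X (\<lambda>x. norm_topology (V x)) M"


section \<open>Haar measures\<close>

definition radon_measure :: "'a topology \<Rightarrow> 'a measure \<Rightarrow> bool" where
  "radon_measure T \<mu> \<longleftrightarrow>
     sets \<mu> = sets (borel_of T) \<and>
     (\<forall>K. compactin T K \<longrightarrow> emeasure \<mu> K < \<infinity>) \<and>
     (\<forall>A\<in>sets \<mu>. emeasure \<mu> A = (INF U\<in>{U. openin T U \<and> A \<subseteq> U}. emeasure \<mu> U)) \<and>
     (\<forall>U. openin T U \<longrightarrow> emeasure \<mu> U = (SUP K\<in>{K. compactin T K \<and> K \<subseteq> U}. emeasure \<mu> K))"

definition left_haar_measure ::
    "('g, 'm) monoid_scheme \<Rightarrow> 'g topology \<Rightarrow> 'g measure \<Rightarrow> bool" where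
  "left_haar_measure G T \<mu> \<longleftrightarrow>
     radon_measure T \<mu> \<and>
     emeasure \<mu> (space \<mu>) \<noteq> 0 \<and>
     (\<forall>g\<in>carrier G. \<forall>A\<in>sets \<mu>. emeasure \<mu> ((\<lambda>h. g \<otimes>\<^bsub>G\<^esub> h) ` A) = emeasure \<mu> A)"


section \<open>Spaces of continuous functions\<close>

text \<open>Functions on \<open>topspace T\<close> are made unique outside of it by \<open>extensional\<close>.\<close>

definition C0 :: "'a topology \<Rightarrow> ('a \<Rightarrow> complex) set" where
  "C0 T = {F \<in> extensional (topspace T). continuous_map T euclidean F \<and>
     (\<forall>\<epsilon>>0. \<exists>K. compactin T K \<and> (\<forall>g\<in>topspace T - K. cmod (F g) < \<epsilon>))}"

definition Cc :: "'a topology \<Rightarrow> ('a \<Rightarrow> complex) set" where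
  "Cc T = {F \<in> extensional (topspace T). continuous_map T euclidean F \<and>
     compactin T (T closure_of {g \<in> topspace T. F g \<noteq> 0})}"

definition C0_borel_structure ::
    "'x measure \<Rightarrow> ('x \<Rightarrow> 'g topology) \<Rightarrow> ('x \<times> 'g) measure \<Rightarrow> ('x \<times> ('g \<Rightarrow> complex)) measure \<Rightarrow> bool"
  where
  "C0_borel_structure X T M N \<longleftrightarrow>
     standard_borel_structure_on (Sigma (space X) (\<lambda>x. C0 (T x))) N \<and>
     fst \<in> N \<rightarrow>\<^sub>M X \<and>
     (\<lambda>((x, F), (y, g)). F g) \<in> borel_measurable (fibre_prod N M)"

definition Cc_structure ::
    "'x measure \<Rightarrow> ('x \<Rightarrow> 'g topology) \<Rightarrow> ('x \<times> ('g \<Rightarrow> complex)) measure \<Rightarrow> ('x \<times> ('g \<Rightarrow> complex)) measure"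
  where
  "Cc_structure X T N = restrict_space N (Sigma (space X) (\<lambda>x. Cc (T x)))"


section \<open>The spaces \<open>L\<^sup>p\<close>\<close>

text \<open>
  The values of a representative outside \<open>space M\<close> are irrelevant for all notions below.
\<close>

definition lp_funs :: "real \<Rightarrow> 'a measure \<Rightarrow> ('a \<Rightarrow> complex) set" where
  "lp_funs p M = {f \<in> borel_measurable M. integrable M (\<lambda>g. cmod (f g) powr p)}"

definition lp_rel :: "real \<Rightarrow> 'a measure \<Rightarrow> (('a \<Rightarrow> complex) \<times> ('a \<Rightarrow> complex)) set" where
  "lp_rel p M = {(f, h). f \<in> lp_funs p M \<and> h \<in> lp_funs p M \<and> (AE g in M. f g = h g)}"

definition Lp :: "real \<Rightarrow> 'a measure \<Rightarrow> ('a \<Rightarrow> complex) set normed_space" where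
  "Lp p M = \<lparr>carrier = lp_funs p M // lp_rel p M,
     monoid.mult = undefined, one = undefined,
     ring.zero = lp_rel p M `` {\<lambda>_. 0},
     add = (\<lambda>\<xi> \<eta>. \<Union>f\<in>\<xi>. \<Union>h\<in>\<eta>. lp_rel p M `` {\<lambda>g. f g + h g}),
     smult = (\<lambda>c \<xi>. \<Union>f\<in>\<xi>. lp_rel p M `` {\<lambda>g. c * f g}),
     nrm = (\<lambda>\<xi>. the_elem ((\<lambda>f. (LINT g|M. cmod (f g) powr p) powr (1 / p)) ` \<xi>))\<rparr>"

text \<open>The integral of \<open>\<xi> F\<close>, for a class \<open>\<xi>\<close> and a function \<open>F\<close>.\<close>
definition class_integral :: "'a measure \<Rightarrow> ('a \<Rightarrow> complex) set \<Rightarrow> ('a \<Rightarrow> complex) \<Rightarrow> complex" where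
  "class_integral M \<xi> F = the_elem ((\<lambda>f. LINT g|M. f g * F g) ` \<xi>)"

definition Lp_borel_structure ::
    "'x measure \<Rightarrow> ('x \<Rightarrow> 'g topology) \<Rightarrow> ('x \<Rightarrow> 'g measure) \<Rightarrow> ('x \<times> ('g \<Rightarrow> complex)) measure \<Rightarrow> real
       \<Rightarrow> ('x \<times> ('g \<Rightarrow> complex) set) measure \<Rightarrow> bool" where
  "Lp_borel_structure X T \<mu> N p L \<longleftrightarrow>
     standard_borel_structure_on (Sigma (space X) (\<lambda>x. carrier (Lp p (\<mu> x)))) L \<and>
     fst \<in> L \<rightarrow>\<^sub>M X \<and>
     (\<lambda>((x, \<xi>), (y, F)). class_integral (\<mu> x) \<xi> F)
        \<in> borel_measurable (fibre_prod L (Cc_structure X T N))"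


subsection \<open>The operations on classes are computed on representatives\<close>

lemma lp_funs_measurable [measurable_dest]: "f \<in> lp_funs p M \<Longrightarrow> f \<in> borel_measurable M"
  by (simp add: lp_funs_def)

lemma lp_funs_zero: "(\<lambda>_. 0) \<in> lp_funs p M"
  by (simp add: lp_funs_def)

lemma lp_funs_scale:
  assumes "f \<in> lp_funs p M"
  shows "(\<lambda>g. c * f g) \<in> lp_funs p M"
  using assms by (auto simp: lp_funs_def norm_mult powr_mult)

lemma lp_funs_add:
  assumes p: "0 \<le> p" and f: "f \<in> lp_funs p M" and h: "h \<in> lp_funs p M"
  shows "(\<lambda>g. f g + h g) \<in> lp_funs p M"
proof -
  have [measurable]: "f \<in> borel_measurable M" "h \<in> borel_measurable M"
    using f h by (auto simp: lp_funs_def)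
  have *: "cmod (a + b) powr p \<le> 2 powr p * (cmod a powr p + cmod b powr p)" for a b :: complex
  proof -
    have "cmod (a + b) \<le> 2 * max (cmod a) (cmod b)"
      using norm_triangle_ineq[of a b] by linarith
    then have "cmod (a + b) powr p \<le> (2 * max (cmod a) (cmod b)) powr p"
      using p by (intro powr_mono2) auto
    also have "\<dots> = 2 powr p * max (cmod a) (cmod b) powr p"
      by (simp add: powr_mult)
    also have "\<dots> \<le> 2 powr p * (cmod a powr p + cmod b powr p)"
      by (intro mult_left_mono) (auto simp: max_def)
    finally show ?thesis .
  qed
  have "integrable M (\<lambda>g. cmod (f g + h g) powr p)"
  proof (rule Bochner_Integration.integrable_bound)
    show "integrable M (\<lambda>g. 2 powr p * (cmod (f g) powr p + cmod (h g) powr p))"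
      using f h by (auto simp: lp_funs_def)
    show "AE g in M. norm (cmod (f g + h g) powr p)
        \<le> norm (2 powr p * (cmod (f g) powr p + cmod (h g) powr p))"
      using * by auto
  qed simp
  then show ?thesis by (simp add: lp_funs_def)
qed

lemma equiv_lp_rel: "equiv (lp_funs p M) (lp_rel p M)"
proof (rule equivI)
  show "lp_rel p M \<subseteq> lp_funs p M \<times> lp_funs p M"
    by (auto simp: lp_rel_def)
  show "refl_on (lp_funs p M) (lp_rel p M)"
    by (auto simp: refl_on_def lp_rel_def)
  show "sym (lp_rel p M)"
    by (auto simp: sym_def lp_rel_def elim: AE_mp)
  show "trans (lp_rel p M)"
    unfolding trans_def lp_rel_def by (auto elim: AE_mp)
qed

lemma carrier_Lp: "carrier (Lp p M) = lp_funs p M // lp_rel p M"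
  by (simp add: Lp_def)

lemma lp_add_class:
  assumes "0 \<le> p" "f \<in> lp_funs p M" "h \<in> lp_funs p M"
  shows "lp_rel p M `` {f} \<oplus>\<^bsub>Lp p M\<^esub> lp_rel p M `` {h} = lp_rel p M `` {\<lambda>g. f g + h g}"
proof -
  have "(\<lambda>a b. lp_rel p M `` {\<lambda>g. a g + b g}) respects2 (lp_rel p M)"
  proof (rule congruent2I'[rule_format])
    fix a a' b b' assume "(a, a') \<in> lp_rel p M" "(b, b') \<in> lp_rel p M"
    then have "((\<lambda>g. a g + b g), (\<lambda>g. a' g + b' g)) \<in> lp_rel p M"
      using assms(1) by (auto simp: lp_rel_def intro: lp_funs_add elim: AE_mp)
    then show "lp_rel p M `` {\<lambda>g. a g + b g} = lp_rel p M `` {\<lambda>g. a' g + b' g}"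
      by (rule equiv_class_eq[OF equiv_lp_rel])
  qed
  from UN_equiv_class2[OF equiv_lp_rel equiv_lp_rel this assms(2,3)]
  show ?thesis by (simp add: Lp_def)
qed

lemma lp_smult_class:
  assumes "f \<in> lp_funs p M"
  shows "c \<odot>\<^bsub>Lp p M\<^esub> (lp_rel p M `` {f}) = lp_rel p M `` {\<lambda>g. c * f g}"
proof -
  have "(\<lambda>a. lp_rel p M `` {\<lambda>g. c * a g}) respects (lp_rel p M)"
  proof (rule congruentI)
    fix a a' assume "(a, a') \<in> lp_rel p M"
    then have "((\<lambda>g. c * a g), (\<lambda>g. c * a' g)) \<in> lp_rel p M"
      by (auto simp: lp_rel_def intro: lp_funs_scale elim: AE_mp)
    then show "lp_rel p M `` {\<lambda>g. c * a g} = lp_rel p M `` {\<lambda>g. c * a' g}"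
      by (rule equiv_class_eq[OF equiv_lp_rel])
  qed
  from UN_equiv_class[OF equiv_lp_rel this assms]
  show ?thesis by (simp add: Lp_def)
qed

lemma lp_nrm_class:
  assumes "f \<in> lp_funs p M"
  shows "nrm (Lp p M) (lp_rel p M `` {f}) = (LINT g|M. cmod (f g) powr p) powr (1 / p)"
  unfolding Lp_def normed_space.simps
proof (rule the_elem_image_unique)
  show "lp_rel p M `` {f} \<noteq> {}"
    using equiv_class_self[OF equiv_lp_rel assms] by blast
  fix h assume "h \<in> lp_rel p M `` {f}"
  then have h: "h \<in> lp_funs p M" and fh: "AE g in M. f g = h g"
    by (auto simp: lp_rel_def)
  have [measurable]: "f \<in> borel_measurable M" "h \<in> borel_measurable M"
    using assms h by (auto simp: lp_funs_def)
  have "(LINT g|M. cmod (h g) powr p) = (LINT g|M. cmod (f g) powr p)"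
    using fh by (intro integral_cong_AE) (auto elim: AE_mp)
  then show "(LINT g|M. cmod (h g) powr p) powr (1 / p) = (LINT g|M. cmod (f g) powr p) powr (1 / p)"
    by simp
qed

lemma class_integral_class:
  assumes "f \<in> lp_funs p M" and [measurable]: "F \<in> borel_measurable M"
  shows "class_integral M (lp_rel p M `` {f}) F = (LINT g|M. f g * F g)"
  unfolding class_integral_def
proof (rule the_elem_image_unique)
  show "lp_rel p M `` {f} \<noteq> {}"
    using equiv_class_self[OF equiv_lp_rel assms(1)] by blast
  fix h assume "h \<in> lp_rel p M `` {f}"
  then have h: "h \<in> lp_funs p M" and fh: "AE g in M. f g = h g"
    by (auto simp: lp_rel_def)
  have [measurable]: "f \<in> borel_measurable M" "h \<in> borel_measurable M"
    using assms h by (auto simp: lp_funs_def)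
  show "(LINT g|M. h g * F g) = (LINT g|M. f g * F g)"
    using fh by (intro integral_cong_AE) (auto elim: AE_mp)
qed

end

theory Submission
  imports Defs "HOL-Probability.Giry_Monad"
begin

text \<open>
  Uniqueness is a case of Blackwell's theorem: a standard Borel structure is generated by any
  countable family of Borel functions separating points (by Lusin's separation of the analytic images
  of a Borel set and its complement).  The family consists of the base point and of the pairings with
  countably many Borel sections of \<open>C\<^sub>c(G)\<close> that increase to the indicators of finite unions of
  relatively compact balls around the dense sections.

  For existence, embed \<open>L\<^sup>p(G)\<close> into \<open>X \<times> \<real>\<^sup>\<nat>\<close> by sending \<open>\<xi>\<close> to its distances from a sequence of
  rational step functions that is dense in every fibre.  By completeness of the fibres the image is
  cut out by countably many conditions, hence Borel.  Norm, addition, scalar multiplication and pairing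
  are continuous on fibres and Borel at the step functions, and such functions are Borel.
\<close>

section \<open>Analytic sets and Lusin separation\<close>

text \<open>Two obstacles shape the proof. The total spaces of C_0(G) and L^p(G) carry no topology,
  so a point over \<open>x\<close> is recorded by countably many reals: an injective code of
  \<open>x\<close> together with distances to, or values at, a sequence of Borel sections.
  Measurability is then tested in real sequence space, with even and odd coordinates as two factors.
  Secondly, the size of relatively compact balls is not uniform in \<open>x\<close>, and the
  measures have no common bound. Hence whether a ball is usable is decided by
  \<open>good_ball\<close>, a condition on distances between sections that is Borel in
  \<open>x\<close>; one countable list of ball codes then serves all fibres at once, and a code
  whose ball is not good contributes nothing. The hypothesis on the measures concerns integrands on
  G alone, while scalar multiplication and pairing need integrands with a further parameter. Cutting
  down to finitely many good balls and dividing by one plus their mass gives subprobability kernels,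
  for which parameter integrals are Borel; monotone limits remove the cut.\<close>

definition analytic :: "'a::metric_space set \<Rightarrow> bool" where
  "analytic A \<longleftrightarrow>
     (\<exists>(C :: (nat \<Rightarrow> real) set) f. closed C \<and> continuous_on C f \<and> A = f ` C)"

lemma analytic_vimage_closed:
  fixes q :: "(nat \<Rightarrow> real) \<Rightarrow> 'a::metric_space" and A :: "'a set"
  assumes "continuous_on UNIV q" "surj q" "closed A"
  shows "analytic A"
  unfolding analytic_def
proof (intro exI conjI)
  show "closed (q -` A)"
    using assms by (simp add: continuous_closed_vimage continuous_on_eq_continuous_at)
  show "continuous_on (q -` A) q"
    using assms(1) continuous_on_subset by blast
  show "A = q ` (q -` A)"
    using assms(2) by auto
qed

lemma analytic_image:
  assumes "analytic A" "continuous_on UNIV h"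
  shows "analytic (h ` A)"
proof -
  obtain C :: "(nat \<Rightarrow> real) set" and f where C: "closed C" "continuous_on C f" "A = f ` C"
    using assms(1) by (auto simp: analytic_def)
  have "continuous_on C (h \<circ> f)"
    using C(2) assms(2) by (intro continuous_on_compose) (auto intro: continuous_on_subset)
  then show ?thesis
    unfolding analytic_def using C by (intro exI[of _ C] exI[of _ "h \<circ> f"]) auto
qed

text \<open>Closed subsets of real sequence space are convenient parameter spaces: a tag or
  countably many parameters can be packed into one sequence, and unpacking is a reindexing of
  coordinates.\<close>

lemma continuous_on_reindex:
  fixes \<pi> :: "nat \<Rightarrow> nat"
  shows "continuous_on S (\<lambda>c :: nat \<Rightarrow> real. \<lambda>k. c (\<pi> k))"
  by (rule continuous_on_coordinatewise_then_product)
    (rule continuous_on_product_then_coordinatewise[OF continuous_on_id])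

lemma closed_vimage_reindex:
  fixes \<pi> :: "nat \<Rightarrow> nat"
  assumes "closed C"
  shows "closed {c :: nat \<Rightarrow> real. (\<lambda>k. c (\<pi> k)) \<in> C}"
  using continuous_closed_vimage[OF assms, of "\<lambda>c k. c (\<pi> k)"] continuous_on_reindex[of UNIV \<pi>]
  by (simp add: continuous_on_eq_continuous_at vimage_def)

text \<open>The disjoint union of the closed parameter sets is again a closed set of sequences:
  coordinate 0 carries the index \<open>n\<close>, the tail a parameter in
  \<open>C n\<close>.\<close>

lemma analytic_UN:
  fixes A :: "nat \<Rightarrow> 'a::metric_space set"
  assumes "\<And>n. analytic (A n)"
  shows "analytic (\<Union>n. A n)"
proof -
  have "\<forall>n. \<exists>(C :: (nat \<Rightarrow> real) set) f. closed C \<and> continuous_on C f \<and> A n = f ` C"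
    using assms by (simp add: analytic_def)
  then obtain C :: "nat \<Rightarrow> (nat \<Rightarrow> real) set" and f
    where C: "\<And>n. closed (C n)" and f: "\<And>n. continuous_on (C n) (f n)"
      and A: "\<And>n. A n = f n ` C n"
    by metis
  \<comment> \<open>Written as an intersection so that closedness is visible: the tag is a natural
    number, and for each \<open>n\<close> it differs from \<open>n\<close> or the tail lies in
    \<open>C n\<close>.\<close>
  define D where "D = {c. c 0 \<in> range real} \<inter>
    (\<Inter>n. {c. c 0 \<in> real ` (- {n})} \<union> {c. (\<lambda>k. c (Suc k)) \<in> C n})"
  define g where "g c = f (nat \<lfloor>c 0\<rfloor>) (\<lambda>k. c (Suc k))" for c
  have D_iff: "c \<in> D \<longleftrightarrow> (\<exists>n. c 0 = real n \<and> (\<lambda>k. c (Suc k)) \<in> C n)" for c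
    unfolding D_def by auto
  have cont0: "isCont (\<lambda>c :: nat \<Rightarrow> real. c 0) c" for c
  proof -
    have "continuous_on UNIV (\<lambda>c :: nat \<Rightarrow> real. c 0)"
      by (rule continuous_on_product_then_coordinatewise[OF continuous_on_id])
    then show ?thesis
      using continuous_on_eq_continuous_at[OF open_UNIV] by blast
  qed
  have clos0: "closed {c :: nat \<Rightarrow> real. c 0 \<in> real ` N}" for N
    using continuous_closed_vimage[OF closed_of_nat_image[of N, where 'a=real] cont0]
    by (simp add: vimage_def)
  have "closed D"
    unfolding D_def
    by (intro closed_Int closed_INT ballI closed_Un clos0 closed_vimage_reindex[of _ Suc] C)
  moreover have "continuous_on D g"
    unfolding continuous_on_def
  proof
    fix c assume "c \<in> D"
    then obtain n where n: "c 0 = real n" "(\<lambda>k. c (Suc k)) \<in> C n"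
      by (auto simp: D_iff)
    have "continuous_on (D \<inter> {c. c 0 = real n}) (\<lambda>c. f n (\<lambda>k. c (Suc k)))"
      by (rule continuous_on_compose2[OF f continuous_on_reindex]) (auto simp: D_iff)
    then have "((\<lambda>c. f n (\<lambda>k. c (Suc k))) \<longlongrightarrow> g c) (at c within D \<inter> {c. c 0 = real n})"
      using n \<open>c \<in> D\<close> by (auto simp: continuous_on_def g_def)
    then have "(g \<longlongrightarrow> g c) (at c within D \<inter> {c. c 0 = real n})"
      by (rule Lim_transform_eventually) (auto simp: eventually_at_filter g_def)
    \<comment> \<open>Tags are integers, so the sheet with tag \<open>n\<close> is relatively open
      in \<open>D\<close> and the limit may be taken within it.\<close>
    moreover have "open {c :: nat \<Rightarrow> real. \<bar>c 0 - real n\<bar> < 1}"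
      by (intro open_Collect_less continuous_intros
          continuous_on_product_then_coordinatewise[OF continuous_on_id])
    then have "at c within D \<inter> {c. c 0 = real n} = at c within D"
      by (intro at_within_nhd[of c "{c. \<bar>c 0 - real n\<bar> < 1}"]) (use n in \<open>auto simp: D_iff\<close>)
    ultimately show "(g \<longlongrightarrow> g c) (at c within D)"
      by simp
  qed
  moreover have "(\<Union>n. A n) = g ` D"
  proof (intro equalityI subsetI)
    fix y assume "y \<in> (\<Union>n. A n)"
    then obtain n c where c: "c \<in> C n" "y = f n c"
      using A by auto
    have "case_nat (real n) c \<in> D" "g (case_nat (real n) c) = y"
      using c by (auto simp: D_iff g_def)
    then show "y \<in> g ` D" by blast
  next
    fix y assume "y \<in> g ` D"
    then obtain c n where "(\<lambda>k. c (Suc k)) \<in> C n" "y = f n (\<lambda>k. c (Suc k))"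
      by (auto simp: D_iff g_def)
    then have "y \<in> A n"
      by (simp add: A)
    then show "y \<in> (\<Union>n. A n)"
      by blast
  qed
  ultimately show ?thesis
    unfolding analytic_def by blast
qed

text \<open>One sequence is split by \<open>prod_encode\<close> into countably many parameters.
  Those whose images all agree form a closed set, and on it the map of index 0 already parametrises
  the intersection.\<close>

lemma analytic_INT:
  fixes A :: "nat \<Rightarrow> 'a::metric_space set"
  assumes "\<And>n. analytic (A n)"
  shows "analytic (\<Inter>n. A n)"
proof -
  have "\<forall>n. \<exists>(C :: (nat \<Rightarrow> real) set) f. closed C \<and> continuous_on C f \<and> A n = f ` C"
    using assms by (simp add: analytic_def)
  then obtain C :: "nat \<Rightarrow> (nat \<Rightarrow> real) set" and f
    where C: "\<And>n. closed (C n)" and f: "\<And>n. continuous_on (C n) (f n)"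
      and A: "\<And>n. A n = f n ` C n"
    by metis
  define r where "r n c = (\<lambda>k. c (prod_encode (n, k)))" for n and c :: "nat \<Rightarrow> real"
  define D where "D = (\<Inter>n. {c. r n c \<in> C n})"
  define E where "E = (\<Inter>n. D \<inter> (\<lambda>c. dist (f n (r n c)) (f 0 (r 0 c))) -` {0})"
  have "closed D"
    unfolding D_def r_def by (intro closed_INT ballI closed_vimage_reindex C)
  have cont: "continuous_on D (\<lambda>c. f n (r n c))" for n
    by (rule continuous_on_compose2[OF f]) (auto simp: r_def D_def intro: continuous_on_reindex)
  have "closed E"
    unfolding E_def
    by (intro closed_INT ballI continuous_closed_preimage continuous_on_dist cont \<open>closed D\<close>) auto
  moreover have "continuous_on E (\<lambda>c. f 0 (r 0 c))"
    using cont by (rule continuous_on_subset) (auto simp: E_def)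
  moreover have "(\<Inter>n. A n) = (\<lambda>c. f 0 (r 0 c)) ` E"
  proof (intro equalityI subsetI)
    fix y assume "y \<in> (\<Inter>n. A n)"
    then have "\<forall>n. \<exists>c \<in> C n. y = f n c"
      using A by auto
    then obtain c where c: "\<And>n. c n \<in> C n" "\<And>n. y = f n (c n)"
      by metis
    define b where "b k = c (fst (prod_decode k)) (snd (prod_decode k))" for k
    have "r n b = c n" for n
      by (simp add: r_def b_def)
    then have "b \<in> E" "y = f 0 (r 0 b)"
      using c by (auto simp: E_def D_def simp flip: c(2))
    then show "y \<in> (\<lambda>c. f 0 (r 0 c)) ` E" by blast
  next
    fix y assume "y \<in> (\<lambda>c. f 0 (r 0 c)) ` E"
    then obtain c where c: "c \<in> E" "y = f 0 (r 0 c)" by blast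
    have r: "f n (r n c) = y" "r n c \<in> C n" for n
      using c by (auto simp: E_def D_def)
    have "y \<in> A n" for n
      unfolding A using r(1)[of n, symmetric] r(2)[of n] by (rule image_eqI)
    then show "y \<in> (\<Inter>n. A n)"
      by blast
  qed
  ultimately show ?thesis
    unfolding analytic_def by blast
qed

lemma open_eq_UN_closed:
  fixes U :: "'a::metric_space set"
  assumes "open U"
  shows "\<exists>F :: nat \<Rightarrow> 'a set. (\<forall>n. closed (F n)) \<and> U = (\<Union>n. F n)"
\<comment> \<open>For \<open>U = UNIV\<close> the complement is empty and \<open>infdist\<close> is
  0 by convention, so the description by distances would fail.\<close>
proof (cases "U = UNIV")
  case True
  then show ?thesis by (intro exI[of _ "\<lambda>_. UNIV"]) auto
next
  case False
  define F where "F n = {x. 1 / real (Suc n) \<le> infdist x (- U)}" for n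
  have "closed (F n)" for n
    unfolding F_def by (intro closed_Collect_le continuous_intros)
  moreover have "U = (\<Union>n. F n)"
  proof (intro equalityI subsetI)
    fix x assume "x \<in> U"
    have "infdist x (- U) \<noteq> 0"
      using in_closed_iff_infdist_zero[of "- U" x] assms False \<open>x \<in> U\<close> by auto
    then have "infdist x (- U) > 0"
      using infdist_nonneg[of x "- U"] by linarith
    then obtain n where "1 / real (Suc n) < infdist x (- U)"
      using nat_approx_posE by blast
    then show "x \<in> (\<Union>n. F n)" by (auto simp: F_def intro: less_imp_le)
  next
    fix x assume "x \<in> (\<Union>n. F n)"
    then obtain n where "1 / real (Suc n) \<le> infdist x (- U)" by (auto simp: F_def)
    moreover have "1 / real (Suc n) > 0" by simp
    ultimately have "infdist x (- U) > 0" by linarith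
    then show "x \<in> U"
      by (metis ComplI infdist_zero less_irrefl)
  qed
  ultimately show ?thesis by blast
qed

text \<open>Analytic sets are not stable under complements, so the induction carries a set and its
  complement together; countable unions and intersections then suffice. The surjection
  \<open>q\<close> parametrises the whole space and thereby its closed sets.\<close>

lemma borel_imp_analytic:
  fixes q :: "(nat \<Rightarrow> real) \<Rightarrow> 'a::metric_space" and A :: "'a set"
  assumes q: "continuous_on UNIV q" "surj q" and "A \<in> sets borel"
  shows "analytic A"
proof -
  have closed: "analytic F" if "closed F" for F :: "'a set"
    by (rule analytic_vimage_closed[OF q that])
  have "A \<in> sigma_sets UNIV {S :: 'a set. open S}"
    using assms(3) by (simp add: borel_def)
  then have "analytic A \<and> analytic (- A)"
  proof induction
    case (Basic U)
    then have "open U" by simp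
    from open_eq_UN_closed[OF this]
    obtain F :: "nat \<Rightarrow> 'a set" where "\<And>n. closed (F n)" "U = (\<Union>n. F n)"
      by blast
    then have "analytic U"
      using analytic_UN[of F] closed by simp
    moreover have "analytic (- U)"
      using Basic by (intro closed) auto
    ultimately show ?case ..
  next
    case Empty
    show ?case by (simp add: closed)
  next
    case (Compl a)
    then show ?case by (simp add: Compl_eq_Diff_UNIV[symmetric])
  next
    case (Union a)
    then show ?case
      using analytic_UN[of a] analytic_INT[of "\<lambda>i. - a i"] by simp
  qed
  then show ?thesis ..
qed

lemma countable_cover_small:
  fixes e :: real
  assumes "e > 0"
  obtains E :: "nat \<Rightarrow> 'a::{metric_space, second_countable_topology} set"
  where "(\<Union>i. E i) = UNIV" "\<And>i x y. x \<in> E i \<Longrightarrow> y \<in> E i \<Longrightarrow> dist x y < e"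
proof -
  obtain D :: "'a set" where D: "countable D" "\<And>U. open U \<Longrightarrow> U \<noteq> {} \<Longrightarrow> \<exists>d\<in>D. d \<in> U"
    using countable_dense_exists by auto
  have "D \<noteq> {}" using D(2)[of UNIV] by auto
  define E where "E i = ball (from_nat_into D i) (e / 2)" for i
  have "x \<in> (\<Union>i. E i)" for x
  proof -
    obtain d where "d \<in> D" "d \<in> ball x (e / 2)"
      using D(2)[of "ball x (e / 2)"] assms by auto
    moreover obtain i where "d = from_nat_into D i"
      using from_nat_into_surj[OF D(1) \<open>d \<in> D\<close>] by metis
    ultimately show ?thesis by (auto simp: E_def dist_commute)
  qed
  moreover have "dist x y < e" if "x \<in> E i" "y \<in> E i" for i x y
    using that dist_triangle_half_r[of "from_nat_into D i" x e y] by (simp add: E_def)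
  ultimately show ?thesis using that[of E] by blast
qed

text \<open>Lusin's argument by contradiction. Separability of all pairs from countably many pieces
  passes to the unions, so an inseparable pair contains inseparable pairs of arbitrarily small
  pieces. These shrink to parameters \<open>p\<close> and \<open>q\<close> with \<open>f p\<close>
  and \<open>g q\<close> distinct, whose disjoint open neighbourhoods separate some late
  pair.\<close>

theorem analytic_separation:
  fixes A B :: "'a::metric_space set"
  assumes "analytic A" "analytic B" "A \<inter> B = {}"
  obtains S where "S \<in> sets borel" "A \<subseteq> S" "S \<inter> B = {}"
proof -
  obtain C :: "(nat \<Rightarrow> real) set" and f where C: "closed C" "continuous_on C f" "A = f ` C"
    using assms(1) by (auto simp: analytic_def)
  obtain D :: "(nat \<Rightarrow> real) set" and g where D: "closed D" "continuous_on D g" "B = g ` D"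
    using assms(2) by (auto simp: analytic_def)
  define sep where "sep P Q \<longleftrightarrow> (\<exists>S\<in>sets borel. f ` P \<subseteq> S \<and> S \<inter> g ` Q = {})" for P Q
  have sep_UN: "sep (\<Union>i. P i) (\<Union>j. Q j)" if "\<And>i j. sep (P i) (Q j)"
    for P Q :: "nat \<Rightarrow> (nat \<Rightarrow> real) set"
  proof -
    obtain S where S: "\<And>i j. S i j \<in> sets borel" "\<And>i j. f ` P i \<subseteq> S i j" "\<And>i j. S i j \<inter> g ` Q j = {}"
      using \<open>\<And>i j. sep (P i) (Q j)\<close> unfolding sep_def by metis
    \<comment> \<open>Row \<open>i\<close>, intersected over \<open>j\<close>, still contains the
      image of \<open>P i\<close> and misses the images of all \<open>Q j\<close>.\<close>
    have "(\<Union>i. \<Inter>j. S i j) \<in> sets borel"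
      using S(1) by (intro sets.countable_UN sets.countable_INT) auto
    moreover have "f ` P i \<subseteq> (\<Inter>j. S i j)" for i
      using S(2) by (simp add: INT_greatest)
    then have "f ` (\<Union>i. P i) \<subseteq> (\<Union>i. \<Inter>j. S i j)"
      by (simp add: image_UN UN_mono)
    moreover have "(\<Union>i. \<Inter>j. S i j) \<inter> g ` (\<Union>j. Q j) = {}"
    proof (rule equals0I)
      fix z assume "z \<in> (\<Union>i. \<Inter>j. S i j) \<inter> g ` (\<Union>j. Q j)"
      then obtain i j where "z \<in> (\<Inter>j. S i j)" "z \<in> g ` Q j" by blast
      then show False using S(3)[of i j] by auto
    qed
    ultimately show ?thesis unfolding sep_def by blast
  qed
  have split: "\<exists>P' Q'. \<not> sep P' Q' \<and> P' \<subseteq> P \<and> Q' \<subseteq> Q \<and>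
      (\<forall>x\<in>P'. \<forall>y\<in>P'. dist x y < e) \<and> (\<forall>x\<in>Q'. \<forall>y\<in>Q'. dist x y < e)"
    if "\<not> sep P Q" "e > 0" for P Q :: "(nat \<Rightarrow> real) set" and e :: real
  proof -
    obtain E :: "nat \<Rightarrow> (nat \<Rightarrow> real) set"
      where E: "(\<Union>i. E i) = UNIV" "\<And>i x y. x \<in> E i \<Longrightarrow> y \<in> E i \<Longrightarrow> dist x y < e"
      using countable_cover_small[OF \<open>e > 0\<close>] by metis
    have eq: "P = (\<Union>i. P \<inter> E i)" "Q = (\<Union>i. Q \<inter> E i)"
      using E(1) by blast+
    have "\<exists>i j. \<not> sep (P \<inter> E i) (Q \<inter> E j)"
      using sep_UN[of "\<lambda>i. P \<inter> E i" "\<lambda>i. Q \<inter> E i", folded eq] that(1) by blast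
    then obtain i j where "\<not> sep (P \<inter> E i) (Q \<inter> E j)"
      by blast
    then show ?thesis
      using E(2) by (intro exI[of _ "P \<inter> E i"] exI[of _ "Q \<inter> E j"]) auto
  qed
  have "sep C D"
  proof (rule ccontr)
    assume nsep: "\<not> sep C D"
    define ok where "ok R \<longleftrightarrow> \<not> sep (fst R) (snd R) \<and> fst R \<subseteq> C \<and> snd R \<subseteq> D" for R
    define small where "small n R \<longleftrightarrow> (\<forall>x\<in>fst R. \<forall>y\<in>fst R. dist x y < 1 / real (Suc n)) \<and>
        (\<forall>x\<in>snd R. \<forall>y\<in>snd R. dist x y < 1 / real (Suc n))"
      for n and R :: "(nat \<Rightarrow> real) set \<times> (nat \<Rightarrow> real) set"
    have "\<exists>R. \<forall>n. ok (R n) \<and> (fst (R (Suc n)) \<subseteq> fst (R n) \<and> snd (R (Suc n)) \<subseteq> snd (R n)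
        \<and> small n (R (Suc n)))"
    proof (rule dependent_nat_choice)
      show "\<exists>R. ok R"
        using nsep by (intro exI[of _ "(C, D)"]) (simp add: ok_def)
      fix R n assume R: "ok R"
      have "0 < 1 / real (Suc n)" by simp
      with R obtain P' Q' where "\<not> sep P' Q'" "P' \<subseteq> fst R" "Q' \<subseteq> snd R"
        "\<forall>x\<in>P'. \<forall>y\<in>P'. dist x y < 1 / real (Suc n)"
        "\<forall>x\<in>Q'. \<forall>y\<in>Q'. dist x y < 1 / real (Suc n)"
        using split[of "fst R" "snd R"] unfolding ok_def by blast
      then show "\<exists>R'. ok R' \<and> (fst R' \<subseteq> fst R \<and> snd R' \<subseteq> snd R \<and> small n R')"
        using R unfolding ok_def small_def
        by (intro exI[of _ "(P', Q')"]) (simp only: fst_conv snd_conv, blast)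
    qed
    then obtain R where R: "\<And>n. ok (R n)" "\<And>n. fst (R (Suc n)) \<subseteq> fst (R n)"
      "\<And>n. snd (R (Suc n)) \<subseteq> snd (R n)" "\<And>n. small n (R (Suc n))"
      by blast
    have dec: "fst (R n) \<subseteq> fst (R m)" "snd (R n) \<subseteq> snd (R m)" if "m \<le> n" for m n
      using lift_Suc_antimono_le[of "\<lambda>n. fst (R n)" m n] lift_Suc_antimono_le[of "\<lambda>n. snd (R n)" m n]
        R(2,3) that by auto
    \<comment> \<open>The pieces need not be closed, so \<open>z\<close> need not belong to them: it
      is a limit of chosen points, lies in the closed set \<open>K\<close>, and the diameters force
      whole pieces close to it.\<close>
    have limit: "\<exists>z\<in>K. \<forall>e>0. \<exists>n. \<forall>x\<in>W n. dist x z < e"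
      if K: "closed K" and W: "\<And>n. W n \<noteq> {}" "\<And>n. W n \<subseteq> K" "\<And>m n. m \<le> n \<Longrightarrow> W n \<subseteq> W m"
        "\<And>n x y. x \<in> W (Suc n) \<Longrightarrow> y \<in> W (Suc n) \<Longrightarrow> dist x y < 1 / real (Suc n)"
      for K and W :: "nat \<Rightarrow> (nat \<Rightarrow> real) set"
    proof -
      define w where "w n = (SOME x. x \<in> W n)" for n
      have w: "w n \<in> W n" for n
        by (simp add: w_def some_in_eq W(1))
      have "Cauchy w"
      proof (rule metric_CauchyI)
        fix e :: real assume "e > 0"
        then obtain N where N: "1 / real (Suc N) < e" using nat_approx_posE by blast
        show "\<exists>M. \<forall>m\<ge>M. \<forall>n\<ge>M. dist (w m) (w n) < e"
        proof (intro exI allI impI)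
          fix m n assume "Suc N \<le> m" "Suc N \<le> n"
          then have "w m \<in> W (Suc N)" "w n \<in> W (Suc N)"
            using W(3) w by blast+
          then show "dist (w m) (w n) < e"
            using W(4) N less_trans by blast
        qed
      qed
      then obtain z where z: "w \<longlonglongrightarrow> z" using Cauchy_convergent convergent_def by blast
      have "z \<in> K"
        using closed_sequentially[OF K] z w W(2) by blast
      moreover have "\<exists>n. \<forall>x\<in>W n. dist x z < e" if e: "e > 0" for e
      proof -
        obtain N where N: "1 / real (Suc N) < e / 2"
          using e nat_approx_posE[of "e / 2"] by auto
        obtain N' where N': "\<And>n. n \<ge> N' \<Longrightarrow> dist (w n) z < e / 2"
          using z half_gt_zero[OF e] unfolding lim_sequentially by blast
        define n where "n = max (Suc N) N'"
        have "dist x z < e" if "x \<in> W n" for x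
        proof -
          have "dist x (w n) < 1 / real (Suc N)"
            using W(3)[of "Suc N" n] W(4)[of x N "w n"] w[of n] that by (auto simp: n_def)
          moreover have "dist (w n) z < e / 2" using N' by (simp add: n_def)
          ultimately show ?thesis using N dist_triangle[of x z "w n"] by linarith
        qed
        then show ?thesis by blast
      qed
      ultimately show ?thesis by blast
    qed
    \<comment> \<open>A pair with an empty piece is separated trivially, so points can be chosen in
      inseparable pieces.\<close>
    have "\<not> sep P Q \<Longrightarrow> P \<noteq> {} \<and> Q \<noteq> {}" for P Q
      unfolding sep_def by force
    then have ne: "fst (R n) \<noteq> {}" "snd (R n) \<noteq> {}" for n
      using R(1) by (auto simp: ok_def)
    obtain p where p: "p \<in> C" "\<And>e. e > 0 \<Longrightarrow> \<exists>n. \<forall>x\<in>fst (R n). dist x p < e"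
      using limit[of C "\<lambda>n. fst (R n)"] C(1) ne R(1,4) dec by (auto simp: ok_def small_def)
    obtain q where q: "q \<in> D" "\<And>e. e > 0 \<Longrightarrow> \<exists>n. \<forall>x\<in>snd (R n). dist x q < e"
      using limit[of D "\<lambda>n. snd (R n)"] D(1) ne R(1,4) dec by (auto simp: ok_def small_def)
    have "f p \<noteq> g q" using p(1) q(1) C(3) D(3) assms(3) by blast
    then obtain U V where UV: "open U" "open V" "f p \<in> U" "g q \<in> V" "U \<inter> V = {}"
      using hausdorff by metis
    have nbhd: "\<exists>e>0. \<forall>x\<in>K. dist x z < e \<longrightarrow> h x \<in> W"
      if "continuous_on K h" "z \<in> K" "open W" "h z \<in> W"
      for K W and h :: "(nat \<Rightarrow> real) \<Rightarrow> 'a" and z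
    proof -
      obtain d where "d > 0" "ball (h z) d \<subseteq> W"
        using \<open>open W\<close> \<open>h z \<in> W\<close> open_contains_ball by blast
      moreover obtain e where "e > 0" "\<forall>x\<in>K. dist x z < e \<longrightarrow> dist (h x) (h z) < d"
        using \<open>continuous_on K h\<close> \<open>z \<in> K\<close> \<open>d > 0\<close> unfolding continuous_on_iff by blast
      moreover have "h x \<in> ball (h z) d" if "dist (h x) (h z) < d" for x
        using that by (simp add: dist_commute)
      ultimately show ?thesis by blast
    qed
    obtain e where e: "e > 0" "\<forall>x\<in>C. dist x p < e \<longrightarrow> f x \<in> U"
      using nbhd[OF C(2) p(1) UV(1,3)] by blast
    obtain e' where e': "e' > 0" "\<forall>x\<in>D. dist x q < e' \<longrightarrow> g x \<in> V"
      using nbhd[OF D(2) q(1) UV(2,4)] by blast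
    obtain m m' where m: "\<forall>x\<in>fst (R m). dist x p < e" and m': "\<forall>x\<in>snd (R m'). dist x q < e'"
      using p(2)[OF e(1)] q(2)[OF e'(1)] by blast
    define n where "n = max m m'"
    have "fst (R n) \<subseteq> fst (R m) \<inter> C" "snd (R n) \<subseteq> snd (R m') \<inter> D"
      using dec[of m n] dec[of m' n] R(1)[of n] by (auto simp: ok_def n_def)
    then have "f ` fst (R n) \<subseteq> U" "g ` snd (R n) \<subseteq> V"
      using m m' e(2) e'(2) by blast+
    then have "sep (fst (R n)) (snd (R n))"
      unfolding sep_def using UV by (intro bexI[of _ U]) auto
    then show False using R(1) by (simp add: ok_def)
  qed
  then show ?thesis using that C(3) D(3) unfolding sep_def by blast
qed

section \<open>Standard Borel spaces inside the space of real sequences\<close>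

text \<open>An isomorphism onto a Borel subset of sequence space with its usual topology, whereas
  \<open>standard_borel\<close> admits any Polish topology on that type. The last clause expresses
  measurability of the inverse.\<close>

definition borel_embedding :: "'a measure \<Rightarrow> ('a \<Rightarrow> nat \<Rightarrow> real) \<Rightarrow> bool" where
  "borel_embedding M f \<longleftrightarrow>
     f \<in> borel_measurable M \<and> inj_on f (space M) \<and> f ` space M \<in> sets borel \<and>
     (\<forall>A\<in>sets M. \<exists>B\<in>sets borel. A = f -` B \<inter> space M)"

lemma borel_embedding_image:
  assumes "borel_embedding M f" "A \<in> sets M"
  shows "f ` A \<in> sets borel"
proof -
  obtain B where "B \<in> sets borel" "A = f -` B \<inter> space M"
    using assms by (auto simp: borel_embedding_def)
  moreover from this have "f ` A = B \<inter> f ` space M" by auto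
  ultimately show ?thesis
    using assms(1) by (auto simp: borel_embedding_def)
qed

lemma inv_into_measurable:
  assumes "borel_embedding M f"
  shows "inv_into (space M) f \<in> restrict_space borel (f ` space M) \<rightarrow>\<^sub>M M"
proof (rule measurableI)
  fix y assume "y \<in> space (restrict_space borel (f ` space M))"
  then show "inv_into (space M) f y \<in> space M"
    by (auto simp: space_restrict_space inv_into_into)
next
  fix A assume A: "A \<in> sets M"
  have inj: "inj_on f (space M)" and B: "f ` space M \<in> sets borel"
    using assms by (auto simp: borel_embedding_def)
  have "inv_into (space M) f -` A \<inter> space (restrict_space borel (f ` space M)) = f ` A"
    using sets.sets_into_space[OF A] inj by (auto simp: space_restrict_space image_iff)
  then show "inv_into (space M) f -` A \<inter> space (restrict_space borel (f ` space M))
      \<in> sets (restrict_space borel (f ` space M))"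
    using borel_embedding_image[OF assms A] borel_embedding_image[OF assms sets.top] A
    by (auto simp: sets_restrict_space_iff sets.sets_into_space image_mono)
qed

lemma borel_embedding_imp_standard_borel:
  assumes "borel_embedding M f"
  shows "standard_borel M"
  unfolding standard_borel_def
proof (intro exI conjI)
  let ?P = "euclidean :: (nat \<Rightarrow> real) topology"
  have borel_of: "borel_of ?P = borel"
    by (simp add: borel_of_def borel_def)
  show "polish_space ?P"
    unfolding polish_space_def
    by (intro conjI completely_metrizable_space_euclidean second_countable_imp_separable_space)
      (simp add: second_countable_def, metis ex_countable_basis topological_basis_open topological_basisE)
  show "f ` space M \<in> sets (borel_of ?P)"
    using assms by (simp add: borel_of borel_embedding_def)
  show "measurable_iso M (restrict_space (borel_of ?P) (f ` space M))"
    unfolding measurable_iso_def borel_of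
  proof (intro exI conjI)
    show "f \<in> M \<rightarrow>\<^sub>M restrict_space borel (f ` space M)"
      using assms by (intro measurable_restrict_space2) (auto simp: borel_embedding_def)
    show "inv_into (space M) f \<in> restrict_space borel (f ` space M) \<rightarrow>\<^sub>M M"
      by (rule inv_into_measurable[OF assms])
  qed (use assms in \<open>auto simp: borel_embedding_def space_restrict_space\<close>)
qed

text \<open>These are the Katetov functions with infimum 0 on the points of a sequence, that is, the
  distance functions of the points of its completion. All quantifiers are countable, so membership
  is a Borel condition on \<open>y\<close> and \<open>\<Delta>\<close> jointly.\<close>

definition distance_sequences :: "(nat \<Rightarrow> nat \<Rightarrow> real) \<Rightarrow> (nat \<Rightarrow> real) set" where
  "distance_sequences \<Delta> = {y. (\<forall>k. \<exists>i. y i < 1 / real (Suc k)) \<and>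
     (\<forall>i j. \<bar>y i - y j\<bar> \<le> \<Delta> i j \<and> \<Delta> i j \<le> y i + y j)}"

context Metric_space
begin

definition dense_seq :: "(nat \<Rightarrow> 'a) \<Rightarrow> bool" where
  "dense_seq s \<longleftrightarrow> range s \<subseteq> M \<and> (\<forall>x\<in>M. \<forall>e>0. \<exists>n. d x (s n) < e)"

lemma dense_seqI_closure:
  assumes "range s \<subseteq> M" "mtopology closure_of range s = M"
  shows "dense_seq s"
  unfolding dense_seq_def
proof (intro conjI ballI allI impI assms(1))
  fix x e assume "x \<in> M" "(0::real) < e"
  then obtain y where "y \<in> range s" "y \<in> mball x e"
    using assms(2) by (force simp: metric_closure_of)
  then show "\<exists>n. d x (s n) < e" by auto
qed

lemma continuous_map_dist:
  assumes "a \<in> M"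
  shows "continuous_map mtopology euclidean (\<lambda>x. d x a)"
proof -
  have "\<bar>d x a - d y a\<bar> \<le> d x y" if "x \<in> M" "y \<in> M" for x y
    using triangle[OF that assms] triangle[OF that(2,1) assms] commute[of x y] by linarith
  then have "continuous_map mtopology Met_TC.mtopology (\<lambda>x. d x a)"
    unfolding metric_continuous_map[OF Met_TC.Metric_space_axioms]
    by (auto simp: dist_real_def intro: le_less_trans)
  then show ?thesis by simp
qed

lemma inj_on_distances:
  assumes "dense_seq s"
  shows "inj_on (\<lambda>x n. d x (s n)) M"
proof (rule inj_onI)
  fix x y assume x: "x \<in> M" "y \<in> M" and eq: "(\<lambda>n. d x (s n)) = (\<lambda>n. d y (s n))"
  have s: "s n \<in> M" for n using assms by (auto simp: dense_seq_def)
  have "d x y < e" if e: "e > 0" for e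
  proof -
    obtain n where "d x (s n) < e / 2"
      using assms x e unfolding dense_seq_def by (meson half_gt_zero)
    moreover have "d y (s n) = d x (s n)" using eq by metis
    moreover have "d x y \<le> d x (s n) + d y (s n)"
      using triangle'[OF x(1) s x(2)] .
    ultimately show ?thesis by linarith
  qed
  then have "d x y = 0"
    using nonneg[of x y] by (metis less_irrefl order_le_less)
  then show "x = y" using x by simp
qed

text \<open>From right to left: indices with \<open>y (r k)\<close> tending to 0 give a Cauchy
  sequence because \<open>\<Delta> i j \<le> y i + y j\<close>. Completeness provides its limit
  \<open>x\<close>, and the Lipschitz condition forces \<open>d x (s n) = y n\<close>.\<close>

lemma distances_image:
  assumes "dense_seq s" and mcomplete
  shows "(\<lambda>x n. d x (s n)) ` M = distance_sequences (\<lambda>i j. d (s i) (s j))"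
proof (intro equalityI subsetI)
  have s: "s n \<in> M" for n using assms by (auto simp: dense_seq_def)
  fix y
  { assume "y \<in> (\<lambda>x n. d x (s n)) ` M"
    then obtain x where x: "x \<in> M" "\<And>n. y n = d x (s n)" by auto
    show "y \<in> distance_sequences (\<lambda>i j. d (s i) (s j))"
      unfolding distance_sequences_def mem_Collect_eq
    proof (intro conjI allI)
      fix k
      have "0 < 1 / real (Suc k)" by simp
      then show "\<exists>i. y i < 1 / real (Suc k)"
        using assms(1) x unfolding dense_seq_def by metis
    next
      fix i j
      show "d (s i) (s j) \<le> y i + y j"
        using triangle''[OF s x(1) s] x(2) by simp
      show "\<bar>y i - y j\<bar> \<le> d (s i) (s j)"
        unfolding x(2)
        using triangle[OF x(1) s[of j] s[of i]] triangle[OF x(1) s[of i] s[of j]]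
          commute[of "s i" "s j"] by linarith
    qed }
  { assume "y \<in> distance_sequences (\<lambda>i j. d (s i) (s j))"
    then have near: "\<exists>i. y i < 1 / real (Suc k)"
      and y: "\<bar>y i - y j\<bar> \<le> d (s i) (s j)" "d (s i) (s j) \<le> y i + y j" for i j k
      by (auto simp: distance_sequences_def)
    \<comment> \<open>The case of equal indices: 0 is the distance of \<open>s i\<close> to itself
      and is at most \<open>2 * y i\<close>.\<close>
    have nonneg_y: "0 \<le> y i" for i
      using y[of i i] s by simp
    obtain r where r: "\<And>k. y (r k) < 1 / real (Suc k)"
      using near by metis
    have lim0: "(\<lambda>k. y (r k)) \<longlonglongrightarrow> 0"
      by (rule tendsto_sandwich[OF _ _ tendsto_const LIMSEQ_Suc[OF lim_const_over_n[of 1]]])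
        (use nonneg_y r in \<open>auto intro!: always_eventually less_imp_le\<close>)
    have "MCauchy (\<lambda>k. s (r k))"
      unfolding MCauchy_def
    proof (intro conjI allI impI)
      show "range (\<lambda>k. s (r k)) \<subseteq> M" using s by auto
      fix e :: real assume e: "e > 0"
      then obtain N where N: "\<And>k. k \<ge> N \<Longrightarrow> y (r k) < e / 2"
        using order_tendstoD(2)[OF lim0, of "e / 2"] by (auto simp: eventually_sequentially)
      show "\<exists>N. \<forall>n n'. N \<le> n \<longrightarrow> N \<le> n' \<longrightarrow> d (s (r n)) (s (r n')) < e"
      proof (intro exI allI impI)
        fix n n' assume "N \<le> n" "N \<le> n'"
        then have "y (r n) < e / 2" "y (r n') < e / 2"
          using N by blast+
        then show "d (s (r n)) (s (r n')) < e"
          using y(2)[of "r n" "r n'"] by linarith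
      qed
    qed
    then obtain x where x: "limitin mtopology (\<lambda>k. s (r k)) x sequentially"
      using \<open>mcomplete\<close> by (auto simp: mcomplete_def)
    then have xM: "x \<in> M" and limx: "(\<lambda>k. d (s (r k)) x) \<longlonglongrightarrow> 0"
      by (auto simp: limit_metric_sequentially limitin_metric_dist_null)
    have "d x (s n) = y n" for n
    proof -
      have "\<bar>d x (s n) - y n\<bar> \<le> d (s (r k)) x + 2 * y (r k)" for k
        using y[of "r k" n] triangle[OF s xM s, of "r k" n] triangle[OF xM s[of "r k"] s[of n]]
          commute[of x "s (r k)"] nonneg_y[of "r k"]
        by linarith
      moreover have "(\<lambda>k. d (s (r k)) x + 2 * y (r k)) \<longlonglongrightarrow> 0 + 2 * 0"
        by (intro tendsto_intros limx lim0)
      ultimately have "\<bar>d x (s n) - y n\<bar> \<le> 0"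
        by (intro LIMSEQ_le_const[of "\<lambda>k. d (s (r k)) x + 2 * y (r k)"]) auto
      then show ?thesis by simp
    qed
    then have "y = (\<lambda>n. d x (s n))" by auto
    with xM show "y \<in> (\<lambda>x n. d x (s n)) ` M" by blast }
qed

end

lemma borel_measurable_sequenceI:
  fixes f :: "'a \<Rightarrow> nat \<Rightarrow> real"
  assumes "\<And>n. (\<lambda>x. f x n) \<in> borel_measurable M"
  shows "f \<in> borel_measurable M"
  using assms by (rule measurable_coordinatewise_then_product)

lemma borel_measurable_sequence_coord [measurable]:
  "(\<lambda>y :: nat \<Rightarrow> real. y n) \<in> borel_measurable borel"
  by (rule measurable_product_then_coordinatewise) simp

text \<open>The matrix of distances may vary measurably with the point. This is what makes the image
  of a whole field of complete spaces Borel, not only that of one space.\<close>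

lemma distance_sequences_measurable:
  assumes [measurable]: "\<And>i j. \<Delta> i j \<in> borel_measurable M"
    and [measurable]: "h \<in> borel_measurable M"
  shows "{x \<in> space M. h x \<in> distance_sequences (\<lambda>i j. \<Delta> i j x)} \<in> sets M"
proof -
  have [measurable]: "(\<lambda>x. h x n) \<in> borel_measurable M" for n
    using measurable_compose[OF assms(2) borel_measurable_sequence_coord] .
  show ?thesis
    unfolding distance_sequences_def mem_Collect_eq by measurable
qed

lemma borel_of_topology_generated:
  assumes "\<And>U. openin T U \<Longrightarrow> \<exists>B\<in>sets N. U = f -` B \<inter> topspace T" and "A \<in> sets (borel_of T)"
  shows "\<exists>B\<in>sets N. A = f -` B \<inter> topspace T"
proof -
  have "{U. openin T U} \<subseteq> Pow (topspace T)"
    using openin_subset by auto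
  then have "A \<in> sigma_sets (topspace T) {U. openin T U}"
    using assms(2) by (simp add: borel_of_def)
  then show ?thesis
  proof induction
    case (Basic a)
    then show ?case using assms(1) by simp
  next
    case Empty
    show ?case by (intro bexI[of _ "{}"]) auto
  next
    case (Compl a)
    then obtain B where "B \<in> sets N" "a = f -` B \<inter> topspace T" by blast
    moreover obtain C where "C \<in> sets N" "topspace T = f -` C \<inter> topspace T"
      using assms(1)[OF openin_topspace] by blast
    ultimately show ?case
      by (intro bexI[of _ "C - B"]) auto
  next
    case (Union a)
    then obtain B where B: "\<And>i. B i \<in> sets N" "\<And>i. a i = f -` B i \<inter> topspace T"
      by metis
    then show ?case
      by (intro bexI[of _ "\<Union>i. B i"]) auto
  qed
qed

lemma space_borel_of: "space (borel_of T) = topspace T"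
  unfolding borel_of_def by (rule space_measure_of) (use openin_subset in auto)

lemma sets_borel_of_open: "openin T U \<Longrightarrow> U \<in> sets (borel_of T)"
  unfolding borel_of_def using openin_subset by (subst sets_measure_of) auto

lemma borel_of_measurable_continuous:
  assumes "continuous_map T euclidean (f :: _ \<Rightarrow> 'b::topological_space)"
  shows "f \<in> borel_measurable (borel_of T)"
proof (rule borel_measurableI)
  fix S :: "'b set" assume "open S"
  then have "openin T {x \<in> topspace T. f x \<in> S}"
    using assms by (auto simp: continuous_map)
  also have "{x \<in> topspace T. f x \<in> S} = f -` S \<inter> space (borel_of T)"
    by (auto simp: space_borel_of)
  finally show "f -` S \<inter> space (borel_of T) \<in> sets (borel_of T)"
    by (rule sets_borel_of_open)
qed

context Metric_space
begin

lemma open_eq_UN_dense_balls: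
  assumes "dense_seq s" "openin mtopology U"
  shows "U = {x \<in> M. \<exists>n k. mball (s n) (1 / real (Suc k)) \<subseteq> U \<and> d x (s n) < 1 / real (Suc k)}"
proof (intro equalityI subsetI)
  fix x assume "x \<in> U"
  then obtain r where r: "r > 0" "mball x r \<subseteq> U" and x: "x \<in> M"
    using assms(2) by (meson openin_mtopology subsetD)
  obtain k where k: "1 / real (Suc k) < r / 2"
    using nat_approx_posE[of "r / 2"] r(1) by auto
  have "0 < 1 / real (Suc k)" by simp
  with x assms(1) obtain n where n: "d x (s n) < 1 / real (Suc k)" "s n \<in> M"
    unfolding dense_seq_def by blast
  have "mball (s n) (1 / real (Suc k)) \<subseteq> mball x r"
    by (rule mball_subset) (use n k x commute[of "s n" x] in auto)
  with r(2) n x show "x \<in> {x \<in> M. \<exists>n k. mball (s n) (1 / real (Suc k)) \<subseteq> U \<and> d x (s n) < 1 / real (Suc k)}"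
    by blast
next
  fix x assume "x \<in> {x \<in> M. \<exists>n k. mball (s n) (1 / real (Suc k)) \<subseteq> U \<and> d x (s n) < 1 / real (Suc k)}"
  then obtain n k where "x \<in> M" "mball (s n) (1 / real (Suc k)) \<subseteq> U" "d x (s n) < 1 / real (Suc k)"
    by blast
  moreover have "s n \<in> M" using assms(1) by (auto simp: dense_seq_def)
  ultimately show "x \<in> U" by (auto simp: commute)
qed

text \<open>An open set is a countable union of balls about the dense points, and each such ball is
  a bound on one coordinate; the last clause of the embedding follows from this.\<close>

lemma borel_embedding_distances:
  assumes "dense_seq s" mcomplete
  shows "borel_embedding (borel_of mtopology) (\<lambda>x n. d x (s n))"
  unfolding borel_embedding_def space_borel_of topspace_mtopology
proof (intro conjI ballI)
  have s: "s n \<in> M" for n using assms by (auto simp: dense_seq_def)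
  show "inj_on (\<lambda>x n. d x (s n)) M"
    by (rule inj_on_distances[OF assms(1)])
  have "continuous_map mtopology euclidean (\<lambda>x. d x (s n))" for n
    by (rule continuous_map_dist) (rule s)
  then show "(\<lambda>x n. d x (s n)) \<in> borel_measurable (borel_of mtopology)"
    by (intro borel_measurable_sequenceI borel_of_measurable_continuous)
  show "(\<lambda>x n. d x (s n)) ` M \<in> sets borel"
    using distance_sequences_measurable[of "\<lambda>i j _. d (s i) (s j)" borel "\<lambda>y. y"]
    by (simp add: distances_image assms)
  fix A assume A: "A \<in> sets (borel_of mtopology)"
  show "\<exists>B\<in>sets borel. A = (\<lambda>x n. d x (s n)) -` B \<inter> M"
  proof (rule borel_of_topology_generated[OF _ A, unfolded topspace_mtopology])
    fix U assume U: "openin mtopology U"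
    let ?B = "\<Union>n. \<Union>k \<in> {k. mball (s n) (1 / real (Suc k)) \<subseteq> U}. {y. y n < 1 / real (Suc k)}"
    have "{y :: nat \<Rightarrow> real. y n < c} \<in> sets borel" for n c
      by measurable
    then have "?B \<in> sets borel"
      by (intro sets.countable_UN' sets.countable_UN) auto
    then show "\<exists>B\<in>sets borel. U = (\<lambda>x n. d x (s n)) -` B \<inter> M"
      by (intro bexI[of _ ?B], subst open_eq_UN_dense_balls[OF assms(1) U]) auto
  qed
qed

end

text \<open>\<open>P\<close> carries an arbitrary Polish topology on a set of sequences, unrelated
  to the product topology; distances to a dense sequence of \<open>P\<close> transport it to the
  latter.\<close>

theorem standard_borel_embedding:
  assumes "standard_borel M"
  obtains f where "borel_embedding M f"
proof -
  obtain P :: "(nat \<Rightarrow> real) topology" and B where P: "polish_space P" "B \<in> sets (borel_of P)"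
    and iso: "measurable_iso M (restrict_space (borel_of P) B)"
    using assms unfolding standard_borel_def by blast
  obtain h k where h: "h \<in> M \<rightarrow>\<^sub>M restrict_space (borel_of P) B" and
    k: "k \<in> restrict_space (borel_of P) B \<rightarrow>\<^sub>M M" and
    kh: "\<And>x. x \<in> space M \<Longrightarrow> k (h x) = x" and
    hk: "\<And>y. y \<in> space (restrict_space (borel_of P) B) \<Longrightarrow> h (k y) = y"
    using iso unfolding measurable_iso_def by blast
  have B: "B \<subseteq> topspace P" "space (restrict_space (borel_of P) B) = B"
    using sets.sets_into_space[OF P(2)] by (auto simp: space_borel_of space_restrict_space)
  obtain e where e: "borel_embedding (borel_of P) e"
  \<comment> \<open>The empty space has no dense sequence and is treated separately.\<close>
  proof (cases "topspace P = {}")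
    case True
    then have "borel_embedding (borel_of P) (\<lambda>_ _. 0)"
      using sets.sets_into_space[of _ "borel_of P"]
      by (auto simp: borel_embedding_def space_borel_of measurable_def)
    then show ?thesis by (rule that)
  next
    case False
    obtain S d where Sd: "Metric_space S d" "Metric_space.mcomplete S d" "P = Metric_space.mtopology S d"
      using P(1) by (auto simp: polish_space_def completely_metrizable_space_def)
    interpret Metric_space S d by (rule Sd(1))
    obtain C where C: "countable C" "C \<subseteq> topspace P" "P closure_of C = topspace P"
      using P(1) by (auto simp: polish_space_def separable_space_def)
    have "C \<noteq> {}"
      using C(3) False closure_of_empty[of P] by metis
    then have "range (from_nat_into C) = C"
      using C(1) by (simp add: range_from_nat_into)
    then have "dense_seq (from_nat_into C)"
      using C by (intro dense_seqI_closure) (auto simp: Sd(3))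
    from borel_embedding_distances[OF this Sd(2)] show ?thesis
      using that by (simp add: Sd(3))
  qed
  have "borel_embedding M (e \<circ> h)"
    unfolding borel_embedding_def
  proof (intro conjI ballI)
    have h': "h \<in> M \<rightarrow>\<^sub>M borel_of P"
      using h by (simp add: measurable_restrict_space2_iff)
    show "e \<circ> h \<in> borel_measurable M"
      using h' e by (auto simp: borel_embedding_def intro: measurable_comp)
    have hB: "h x \<in> B" if "x \<in> space M" for x
      using measurable_space[OF h that] B by simp
    have "inj_on h (space M)"
      by (rule inj_on_inverseI[of _ k]) (rule kh)
    moreover have hM: "h ` space M = B"
    proof (intro equalityI subsetI)
      fix y assume "y \<in> B"
      then have "k y \<in> space M" "h (k y) = y"
        using hk measurable_space[OF k] B by auto
      then show "y \<in> h ` space M" by (metis imageI)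
    qed (use hB in auto)
    moreover have "inj_on e B"
      using e B by (auto simp: borel_embedding_def space_borel_of intro: inj_on_subset)
    ultimately show "inj_on (e \<circ> h) (space M)"
      by (intro comp_inj_on) auto
    show "(e \<circ> h) ` space M \<in> sets borel"
      using borel_embedding_image[OF e P(2)] by (simp only: image_comp[symmetric] hM)
    fix A assume A: "A \<in> sets M"
    have "k -` A \<inter> B \<in> sets (restrict_space (borel_of P) B)"
      using measurable_sets[OF k A] B by simp
    then have "k -` A \<inter> B \<in> sets (borel_of P)"
      using P(2) B(1) by (subst (asm) sets_restrict_space_iff) (auto simp: space_borel_of Int_absorb2)
    then obtain C where C: "C \<in> sets borel" "k -` A \<inter> B = e -` C \<inter> space (borel_of P)"
      using e by (auto simp: borel_embedding_def)
    have "x \<in> A \<longleftrightarrow> e (h x) \<in> C" if "x \<in> space M" for x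
    proof -
      have "h x \<in> space (borel_of P)" using hB[OF that] B by (auto simp: space_borel_of)
      have "x \<in> A \<longleftrightarrow> h x \<in> k -` A \<inter> B"
        using kh[OF that] hB[OF that] by simp
      also have "\<dots> \<longleftrightarrow> e (h x) \<in> C"
        unfolding C(2) using \<open>h x \<in> space (borel_of P)\<close> by simp
      finally show ?thesis .
    qed
    then have "A = (e \<circ> h) -` C \<inter> space M"
      using sets.sets_into_space[OF A] by auto
    with C(1) show "\<exists>B\<in>sets borel. A = (e \<circ> h) -` B \<inter> space M" by blast
  qed
  then show ?thesis by (rule that)
qed

corollary standard_borel_coordinates:
  fixes M :: "'a measure"
  assumes "standard_borel M"
  obtains j :: "'a \<Rightarrow> nat \<Rightarrow> real" where "j \<in> borel_measurable M" "inj_on j (space M)"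
proof -
  obtain f where "borel_embedding M f" by (rule standard_borel_embedding[OF assms])
  then show ?thesis by (intro that[of f]) (simp_all add: borel_embedding_def)
qed

section \<open>Blackwell's theorem\<close>

text \<open>These maps realise the homeomorphism of real sequence space with its square, so that
  pairs of codes stay within one type.\<close>

definition evens :: "(nat \<Rightarrow> real) \<Rightarrow> nat \<Rightarrow> real" where "evens z n = z (2 * n)"
definition odds :: "(nat \<Rightarrow> real) \<Rightarrow> nat \<Rightarrow> real" where "odds z n = z (2 * n + 1)"
definition interleave :: "(nat \<Rightarrow> real) \<Rightarrow> (nat \<Rightarrow> real) \<Rightarrow> nat \<Rightarrow> real" where
  "interleave y z n = (if even n then y (n div 2) else z (n div 2))"

lemma evens_interleave [simp]: "evens (interleave y z) = y"
  and odds_interleave [simp]: "odds (interleave y z) = z"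
  by (auto simp: evens_def odds_def interleave_def)

lemma interleave_evens_odds [simp]: "interleave (evens z) (odds z) = z"
  by (auto simp: evens_def odds_def interleave_def)

lemma continuous_evens: "continuous_on S evens" and continuous_odds: "continuous_on S odds"
  unfolding evens_def[abs_def] odds_def[abs_def] by (rule continuous_on_reindex)+

lemma evens_measurable [measurable]: "evens \<in> borel_measurable borel"
  and odds_measurable [measurable]: "odds \<in> borel_measurable borel"
  by (intro borel_measurable_continuous_onI continuous_evens continuous_odds)+

lemma interleave_measurable [measurable]:
  assumes [measurable]: "f \<in> borel_measurable M" "g \<in> borel_measurable M"
  shows "(\<lambda>x. interleave (f x) (g x)) \<in> borel_measurable M"
  unfolding interleave_def
  by (intro borel_measurable_sequenceI)
    (auto intro!: measurable_compose[OF assms(1) borel_measurable_sequence_coord]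
      measurable_compose[OF assms(2) borel_measurable_sequence_coord])

text \<open>Transported along \<open>f\<close>, the map \<open>h\<close> has a Borel graph in the
  square. Over the image of \<open>A\<close> the graph is Borel, hence analytic, and the wanted
  image is its continuous projection.\<close>

lemma analytic_borel_image:
  assumes f: "borel_embedding M f" and h: "h \<in> borel_measurable M" and A: "A \<in> sets M"
  shows "analytic (h ` A :: (nat \<Rightarrow> real) set)"
proof -
  let ?B = "f ` space M"
  have [measurable]: "?B \<in> sets borel" "f ` A \<in> sets borel"
    using borel_embedding_image[OF f] A by auto
  \<comment> \<open>The value off the image of \<open>f\<close> is arbitrary; it only makes
    \<open>g\<close> Borel on the whole sequence space.\<close>
  define g where "g = (\<lambda>y. if y \<in> ?B then h (inv_into (space M) f y) else (\<lambda>_. 0))"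
  have "(\<lambda>y. h (inv_into (space M) f y)) \<in> borel_measurable (restrict_space borel ?B)"
    using inv_into_measurable[OF f] h by (rule measurable_compose)
  then have [measurable]: "g \<in> borel_measurable borel"
    unfolding g_def by (subst measurable_If_restrict_space_iff) auto
  let ?G = "{z. evens z \<in> f ` A \<and> odds z = g (evens z)}"
  have "?G = {z \<in> space borel. evens z \<in> f ` A \<and> (\<forall>n. odds z n = g (evens z) n)}"
    by (auto simp: fun_eq_iff)
  also have "\<dots> \<in> sets borel"
  proof -
    have [measurable]: "(\<lambda>z. odds z n) \<in> borel_measurable borel"
        "(\<lambda>z. g (evens z) n) \<in> borel_measurable borel" for n
      by (rule measurable_compose[OF _ borel_measurable_sequence_coord], measurable)+
    have "{z \<in> space borel. odds z n = g (evens z) n} \<in> sets borel" for n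
      by (rule borel_measurable_eq) measurable
    moreover have "{z \<in> space borel. evens z \<in> f ` A} \<in> sets borel"
      by measurable
    ultimately show ?thesis
      by (intro sets.sets_Collect_conj sets.sets_Collect_countable_All)
  qed
  finally have "analytic ?G"
    by (intro borel_imp_analytic[of "\<lambda>z. z"]) auto
  then have "analytic (odds ` ?G)"
    by (rule analytic_image[OF _ continuous_odds])
  also have "odds ` ?G = h ` A"
  proof (intro equalityI subsetI)
    have inj: "inv_into (space M) f (f x) = x" "f x \<in> ?B" if "x \<in> A" for x
      using that f sets.sets_into_space[OF A] by (auto simp: borel_embedding_def)
    fix y
    { assume "y \<in> odds ` ?G"
      then obtain x where "x \<in> A" "y = g (f x)" by auto
      then show "y \<in> h ` A" using inj[of x] by (auto simp: g_def) }
    { assume "y \<in> h ` A"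
      then obtain x where "x \<in> A" "y = h x" by auto
      then have "interleave (f x) y \<in> ?G" using inj[of x] by (auto simp: g_def)
      then show "y \<in> odds ` ?G"
        by (intro image_eqI[of _ _ "interleave (f x) y"]) (simp only: odds_interleave) }
  qed
  finally show ?thesis .
qed

theorem standard_borel_generated:
  fixes h :: "'a \<Rightarrow> nat \<Rightarrow> real"
  assumes M: "standard_borel M" and h: "h \<in> borel_measurable M" "inj_on h (space M)"
    and A: "A \<in> sets M"
  obtains B where "B \<in> sets borel" "A = h -` B \<inter> space M"
proof -
  obtain f where f: "borel_embedding M f"
    using standard_borel_embedding[OF M] .
  have "analytic (h ` A)" "analytic (h ` (space M - A))"
    using A by (auto intro: analytic_borel_image[OF f h(1)])
  moreover have "h ` A \<inter> h ` (space M - A) = {}"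
  proof (rule equals0I)
    fix y assume "y \<in> h ` A \<inter> h ` (space M - A)"
    then obtain x x' where "x \<in> A" "x' \<in> space M - A" "h x = h x'" by blast
    then show False
      using inj_onD[OF h(2), of x x'] sets.sets_into_space[OF A] by auto
  qed
  ultimately obtain B where B: "B \<in> sets borel" "h ` A \<subseteq> B" "B \<inter> h ` (space M - A) = {}"
    by (rule analytic_separation)
  then have "A = h -` B \<inter> space M"
    using sets.sets_into_space[OF A] by auto
  with B(1) show ?thesis by (rule that)
qed

corollary standard_borel_sets_eq:
  fixes h :: "'a \<Rightarrow> nat \<Rightarrow> real"
  assumes "standard_borel M" "standard_borel N" "space M = space N"
    and "h \<in> borel_measurable M" "h \<in> borel_measurable N" "inj_on h (space M)"
  shows "sets M = sets N"
proof -
  have "sets M \<subseteq> sets N"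
    if MN: "standard_borel M" "space M = space N" "h \<in> borel_measurable M" "h \<in> borel_measurable N"
      "inj_on h (space M)" for M N :: "'a measure"
  proof
    fix A assume "A \<in> sets M"
    obtain B where "B \<in> sets borel" "A = h -` B \<inter> space M"
      by (rule standard_borel_generated[OF MN(1,3,5) \<open>A \<in> sets M\<close>])
    then show "A \<in> sets N"
      using measurable_sets[OF MN(4)] MN(2) by simp
  qed
  from this[OF assms(1,3,4,5,6)] this[OF assms(2) assms(3)[symmetric] assms(5,4)] assms(3,6)
  show ?thesis by simp
qed

section \<open>The Banach space \<open>L\<^sup>p\<close>\<close>

lemma powr_convex_nonneg:
  fixes a b u v p :: real
  assumes p: "1 \<le> p" and nn: "0 \<le> a" "0 \<le> b" "0 \<le> u" "0 \<le> v" and uv: "u + v = 1"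
  shows "(u * a + v * b) powr p \<le> u * a powr p + v * b powr p"
proof -
  \<comment> \<open>Covers the boundary: with one argument 0 the claim reduces to
    \<open>w powr p \<le> w\<close> for weights at most 1. The remaining case is convexity on the
    positive half-line.\<close>
  have le: "(w * c) powr p \<le> w * c powr p" if "0 \<le> w" "w \<le> 1" "0 \<le> c" for w c :: real
  proof -
    have "w powr p \<le> w"
      using powr_mono'[of 1 p w] that p by (cases "w = 0") auto
    then show ?thesis
      using that by (simp add: powr_mult mult_right_mono)
  qed
  consider "a = 0" | "b = 0" | "a > 0" "b > 0"
    using nn by linarith
  then show ?thesis
  proof cases
    case 1
    then show ?thesis using le[of v b] nn uv by simp
  next
    case 2
    then show ?thesis using le[of u a] nn uv by simp
  next
    case 3
    then show ?thesis
      using convex_onD[OF powr_convex[OF p], of v a b] nn uv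
      by (simp add: eq_diff_eq[symmetric])
  qed
qed

section \<open>The seminorm on p-integrable functions: Minkowski's inequality and
  completeness\<close>

definition lp_norm :: "real \<Rightarrow> 'a measure \<Rightarrow> ('a \<Rightarrow> complex) \<Rightarrow> real" where
  "lp_norm p M f = (LINT g|M. cmod (f g) powr p) powr (1 / p)"

lemma lp_norm_nonneg: "0 \<le> lp_norm p M f"
  by (simp add: lp_norm_def)

lemma lp_norm_powr:
  assumes "1 \<le> p"
  shows "lp_norm p M f powr p = (LINT g|M. cmod (f g) powr p)"
proof -
  have "0 \<le> (LINT g|M. cmod (f g) powr p)"
    by (intro integral_nonneg_AE) auto
  then show ?thesis
    using assms by (simp add: lp_norm_def powr_powr)
qed

lemma lp_norm_le:
  assumes "1 \<le> p" "0 \<le> c" "(LINT g|M. cmod (f g) powr p) \<le> c powr p"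
  shows "lp_norm p M f \<le> c"
proof (rule ccontr)
  assume "\<not> lp_norm p M f \<le> c"
  then have "c powr p < lp_norm p M f powr p"
    using assms by (intro powr_less_mono2) auto
  then show False
    using assms(1,3) by (simp add: lp_norm_powr)
qed

lemma lp_norm_minus_commute: "lp_norm p M (\<lambda>g. f g - h g) = lp_norm p M (\<lambda>g. h g - f g)"
  by (simp add: lp_norm_def norm_minus_commute)

lemma lp_funs_minus:
  assumes "0 \<le> p" "f \<in> lp_funs p M" "h \<in> lp_funs p M"
  shows "(\<lambda>g. f g - h g) \<in> lp_funs p M"
  using lp_funs_add[OF assms(1,2) lp_funs_scale[OF assms(3), of "- 1"]] by simp

lemma nn_integral_lp:
  assumes "1 \<le> p" "f \<in> lp_funs p M"
  shows "(\<integral>\<^sup>+ g. ennreal (cmod (f g) powr p) \<partial>M) = ennreal (lp_norm p M f powr p)"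
  using assms by (simp add: lp_norm_powr lp_funs_def nn_integral_eq_integral)

lemma lp_norm_eq_enn2real:
  assumes "1 \<le> p" "f \<in> borel_measurable M"
  shows "lp_norm p M f = enn2real (\<integral>\<^sup>+ g. ennreal (cmod (f g) powr p) \<partial>M) powr (1 / p)"
  unfolding lp_norm_def using assms(2) by (subst integral_eq_nn_integral) auto

lemma lp_funsI_nn_integral:
  assumes p: "1 \<le> p" and [measurable]: "f \<in> borel_measurable M" and c: "0 \<le> c"
    and le: "(\<integral>\<^sup>+ g. ennreal (cmod (f g) powr p) \<partial>M) \<le> ennreal (c powr p)"
  shows "f \<in> lp_funs p M" "lp_norm p M f \<le> c"
proof -
  have int: "integrable M (\<lambda>g. cmod (f g) powr p)"
    using le_less_trans[OF le ennreal_less_top] by (intro integrableI_bounded) auto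
  then show "f \<in> lp_funs p M"
    by (simp add: lp_funs_def)
  have "ennreal (LINT g|M. cmod (f g) powr p) \<le> ennreal (c powr p)"
    using le int by (simp add: nn_integral_eq_integral)
  then show "lp_norm p M f \<le> c"
    by (intro lp_norm_le p c) (simp add: ennreal_le_iff)
qed

lemma lp_norm_scale:
  assumes "1 \<le> p"
  shows "lp_norm p M (\<lambda>g. c * f g) = cmod c * lp_norm p M f"
  using assms by (simp add: lp_norm_def norm_mult powr_mult powr_powr)

lemma lp_norm_zero_iff:
  assumes "1 \<le> p" "f \<in> lp_funs p M"
  shows "lp_norm p M f = 0 \<longleftrightarrow> (AE g in M. f g = 0)"
proof -
  have "lp_norm p M f = 0 \<longleftrightarrow> (LINT g|M. cmod (f g) powr p) = 0"
    using assms(1) by (simp add: lp_norm_def)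
  also have "\<dots> \<longleftrightarrow> (AE g in M. cmod (f g) powr p = 0)"
    using assms by (intro integral_nonneg_eq_0_iff_AE) (auto simp: lp_funs_def)
  also have "\<dots> \<longleftrightarrow> (AE g in M. f g = 0)"
    by simp
  finally show ?thesis .
qed

text \<open>Minkowski from convexity alone: the sum of the moduli is \<open>a + b\<close> times the
  convex combination, with weights \<open>u\<close> and \<open>v\<close>, of the moduli divided by
  \<open>a\<close> and \<open>b\<close>, and both normalised functions have p-th power integral at
  most 1.\<close>

lemma lp_norm_triangle:
  assumes p: "1 \<le> p" and f: "f \<in> lp_funs p M" and h: "h \<in> lp_funs p M"
  shows "lp_norm p M (\<lambda>g. f g + h g) \<le> lp_norm p M f + lp_norm p M h"
proof (rule field_le_epsilon)
  fix e :: real assume "e > 0"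
  \<comment> \<open>The slack \<open>e / 2\<close> keeps \<open>a\<close> and \<open>b\<close>
    positive even when a norm vanishes.\<close>
  define a where "a = lp_norm p M f + e / 2"
  define b where "b = lp_norm p M h + e / 2"
  have pos: "a > 0" "b > 0"
    using \<open>e > 0\<close> lp_norm_nonneg[of p M f] lp_norm_nonneg[of p M h] by (auto simp: a_def b_def)
  define u where "u = a / (a + b)"
  define v where "v = b / (a + b)"
  have uv: "u + v = 1" "0 \<le> u" "0 \<le> v"
    using pos by (auto simp: u_def v_def add_divide_distrib[symmetric])
  have int: "integrable M (\<lambda>g. cmod (f g) powr p)" "integrable M (\<lambda>g. cmod (h g) powr p)"
    using f h by (auto simp: lp_funs_def)
  have "(LINT g|M. cmod (f g) powr p) \<le> a powr p" "(LINT g|M. cmod (h g) powr p) \<le> b powr p"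
    unfolding lp_norm_powr[OF p, symmetric]
    using \<open>e > 0\<close> p by (auto intro!: powr_mono2 lp_norm_nonneg simp: a_def b_def)
  then have le1: "(LINT g|M. cmod (f g) powr p) / a powr p \<le> 1"
    "(LINT g|M. cmod (h g) powr p) / b powr p \<le> 1"
    using pos by (auto simp: divide_le_eq_1)
  have "cmod (f g + h g) powr p
      \<le> (a + b) powr p * (u * (cmod (f g) powr p / a powr p) + v * (cmod (h g) powr p / b powr p))" for g
  proof -
    have "cmod (f g + h g) \<le> (a + b) * (u * (cmod (f g) / a) + v * (cmod (h g) / b))"
    proof -
      have "(a + b) * (u * (cmod (f g) / a) + v * (cmod (h g) / b)) = cmod (f g) + cmod (h g)"
        using pos by (simp add: u_def v_def distrib_left)
      then show ?thesis
        using norm_triangle_ineq[of "f g" "h g"] by simp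
    qed
    then have "cmod (f g + h g) powr p
        \<le> ((a + b) * (u * (cmod (f g) / a) + v * (cmod (h g) / b))) powr p"
      using p by (intro powr_mono2) auto
    also have "\<dots> = (a + b) powr p * (u * (cmod (f g) / a) + v * (cmod (h g) / b)) powr p"
      by (simp add: powr_mult)
    also have "\<dots> \<le> (a + b) powr p * (u * (cmod (f g) / a) powr p + v * (cmod (h g) / b) powr p)"
      using pos uv p by (intro mult_left_mono powr_convex_nonneg) auto
    finally show ?thesis
      using pos by (simp add: powr_divide)
  qed
  then have "(LINT g|M. cmod (f g + h g) powr p) \<le>
      (LINT g|M. (a + b) powr p * (u * (cmod (f g) powr p / a powr p) + v * (cmod (h g) powr p / b powr p)))"
    using int lp_funs_add[OF _ f h] p
    by (intro integral_mono) (auto simp: lp_funs_def)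
  also have "\<dots> = (a + b) powr p * (u * ((LINT g|M. cmod (f g) powr p) / a powr p)
      + v * ((LINT g|M. cmod (h g) powr p) / b powr p))"
    using int by simp
  also have "\<dots> \<le> (a + b) powr p * (u * 1 + v * 1)"
    using le1 uv by (intro mult_left_mono add_mono) auto
  finally have "lp_norm p M (\<lambda>g. f g + h g) \<le> a + b"
    using pos uv p by (intro lp_norm_le) auto
  then show "lp_norm p M (\<lambda>g. f g + h g) \<le> lp_norm p M f + lp_norm p M h + e"
    by (simp add: a_def b_def)
qed

lemma lp_norm_triangle3:
  assumes "1 \<le> p" "f \<in> lp_funs p M" "h \<in> lp_funs p M" "k \<in> lp_funs p M"
  shows "lp_norm p M (\<lambda>g. f g - k g) \<le> lp_norm p M (\<lambda>g. f g - h g) + lp_norm p M (\<lambda>g. h g - k g)"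
  using lp_norm_triangle[OF assms(1) lp_funs_minus lp_funs_minus, of f M h h k] assms by simp

text \<open>Riesz-Fischer: a fast subsequence converges almost everywhere, and Fatou's lemma bounds
  the distance to the limit for every late \<open>f n\<close>, not only along the
  subsequence.\<close>

theorem lp_complete:
  fixes f :: "nat \<Rightarrow> 'a \<Rightarrow> complex"
  assumes p: "1 \<le> p" and f: "\<And>n. f n \<in> lp_funs p M"
    and Cauchy: "\<And>e. e > 0 \<Longrightarrow> \<exists>N. \<forall>m\<ge>N. \<forall>n\<ge>N. lp_norm p M (\<lambda>g. f m g - f n g) < e"
  obtains h where "h \<in> lp_funs p M" "(\<lambda>n. lp_norm p M (\<lambda>g. f n g - h g)) \<longlonglongrightarrow> 0"
proof -
  have [measurable]: "f n \<in> borel_measurable M" for n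
    using f by (auto simp: lp_funs_def)
  have "\<forall>k. \<exists>N. \<forall>m\<ge>N. \<forall>n\<ge>N. lp_norm p M (\<lambda>g. f m g - f n g) < (1 / 4) ^ k"
    using Cauchy by simp
  then obtain N where N: "\<And>k m n. m \<ge> N k \<Longrightarrow> n \<ge> N k \<Longrightarrow> lp_norm p M (\<lambda>g. f m g - f n g) < (1 / 4) ^ k"
    by metis
  \<comment> \<open>Adding all earlier \<open>N i\<close> makes \<open>r k\<close> dominate both
    \<open>k\<close> and \<open>N k\<close>, and \<open>r (Suc k)\<close> dominate
    \<open>N k\<close> as well.\<close>
  define r where "r k = k + (\<Sum>i\<le>k. N i)" for k
  have r_ge: "N k \<le> r k" "k \<le> r k" for k
    using member_le_sum[of k "{..k}" N] by (auto simp: r_def)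
  have "N k \<le> r (Suc k)" for k
    using r_ge(1)[of k] by (simp add: r_def)
  then have D: "lp_norm p M (\<lambda>g. f (r (Suc k)) g - f (r k) g) < (1 / 4) ^ k" for k
    using N[of k] r_ge by blast
  \<comment> \<open>With weights \<open>2 ^ k\<close> against gaps \<open>(1 / 4) ^ k\<close> the
    integrals are summable. Where the sum is finite it bounds every term, so the increments are of
    order \<open>(1 / 2) ^ k\<close>, with no triangle inequality for infinite sums.\<close>
  define D' where "D' k g = (2 ^ k * cmod (f (r (Suc k)) g - f (r k) g)) powr p" for k g
  have [measurable]: "D' k \<in> borel_measurable M" for k
    unfolding D'_def by measurable
  have "(\<integral>\<^sup>+ g. ennreal (D' k g) \<partial>M) \<le> ennreal ((1 / 2) ^ k)" for k
  proof -
    have "(\<integral>\<^sup>+ g. ennreal (D' k g) \<partial>M) =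
        (\<integral>\<^sup>+ g. ennreal (cmod (2 ^ k * (f (r (Suc k)) g - f (r k) g)) powr p) \<partial>M)"
      by (simp add: D'_def norm_mult norm_power)
    also have "\<dots> = ennreal (lp_norm p M (\<lambda>g. 2 ^ k * (f (r (Suc k)) g - f (r k) g)) powr p)"
      using p f by (intro nn_integral_lp lp_funs_scale lp_funs_minus) auto
    also have "\<dots> = ennreal ((2 ^ k * lp_norm p M (\<lambda>g. f (r (Suc k)) g - f (r k) g)) powr p)"
      by (simp add: lp_norm_scale[OF p] norm_power)
    also have "\<dots> \<le> ennreal (((1 / 2) ^ k) powr p)"
    proof (intro ennreal_leI powr_mono2)
      have "2 ^ k * lp_norm p M (\<lambda>g. f (r (Suc k)) g - f (r k) g) \<le> 2 ^ k * (1 / 4) ^ k"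
        using D[of k] by (intro mult_left_mono) auto
      also have "\<dots> = (1 / 2) ^ k"
        by (simp add: power_mult_distrib[symmetric])
      finally show "2 ^ k * lp_norm p M (\<lambda>g. f (r (Suc k)) g - f (r k) g) \<le> (1 / 2) ^ k" .
    qed (use p in \<open>auto intro!: mult_nonneg_nonneg lp_norm_nonneg\<close>)
    \<comment> \<open>Raising a number in [0, 1] to a power \<open>p\<close> at least 1 does not
      increase it.\<close>
    also have "((1 / 2 :: real) ^ k) powr p \<le> ((1 / 2) ^ k) powr 1"
      using p by (intro powr_mono') (auto simp: power_le_one)
    finally show ?thesis
      by (simp add: ennreal_leI)
  qed
  then have "(\<Sum>k. \<integral>\<^sup>+ g. ennreal (D' k g) \<partial>M) \<le> (\<Sum>k. ennreal ((1 / 2) ^ k))"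
    by (intro suminf_le) auto
  also have "\<dots> = ennreal (\<Sum>k. (1 / 2) ^ k)"
    by (intro suminf_ennreal2) auto
  finally have "(\<Sum>k. \<integral>\<^sup>+ g. ennreal (D' k g) \<partial>M) < \<infinity>"
    by (rule le_less_trans) auto
  then have "(\<integral>\<^sup>+ g. (\<Sum>k. ennreal (D' k g)) \<partial>M) \<noteq> \<infinity>"
    by (subst nn_integral_suminf) auto
  then have ae: "AE g in M. (\<Sum>k. ennreal (D' k g)) \<noteq> \<infinity>"
    by (intro nn_integral_PInf_AE) auto
  have conv: "convergent (\<lambda>k. f (r k) g)" if "(\<Sum>k. ennreal (D' k g)) \<noteq> \<infinity>" for g
  proof -
    obtain C where C: "C \<ge> 0" "(\<Sum>k. ennreal (D' k g)) = ennreal C"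
      using \<open>(\<Sum>k. ennreal (D' k g)) \<noteq> \<infinity>\<close> by (cases "\<Sum>k. ennreal (D' k g)") auto
    have le: "cmod (f (r (Suc k)) g - f (r k) g) \<le> C powr (1 / p) * (1 / 2) ^ k" for k
    proof -
      have "ennreal (D' k g) \<le> ennreal C"
        using sum_le_suminf[of "\<lambda>k. ennreal (D' k g)" "{k}"] C by simp
      then have "D' k g \<le> C" using C by (simp add: ennreal_le_iff)
      then have "D' k g powr (1 / p) \<le> C powr (1 / p)"
        using p by (intro powr_mono2) (auto simp: D'_def)
      then have "2 ^ k * cmod (f (r (Suc k)) g - f (r k) g) \<le> C powr (1 / p)"
        using p by (simp add: D'_def powr_powr)
      then show ?thesis by (simp add: field_simps power_divide)
    qed
    have "summable (\<lambda>k. f (r (Suc k)) g - f (r k) g)"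
      by (rule summable_comparison_test'[of "\<lambda>k. C powr (1 / p) * (1 / 2) ^ k" 0]) (use le in auto)
    then have "convergent (\<lambda>n. \<Sum>k<n. f (r (Suc k)) g - f (r k) g)"
      by (simp add: summable_iff_convergent)
    then have "convergent (\<lambda>n. f (r n) g - f (r 0) g)"
      by (simp only: sum_lessThan_telescope[of "\<lambda>n. f (r n) g"])
    from convergent_add[OF this convergent_const[of "f (r 0) g"]] show ?thesis by simp
  qed
  define h where "h g = lim (\<lambda>k. f (r k) g)" for g
  have [measurable]: "h \<in> borel_measurable M"
    unfolding h_def by measurable
  have lim: "AE g in M. (\<lambda>k. f (r k) g) \<longlonglongrightarrow> h g"
    using ae by eventually_elim (use conv in \<open>auto simp: h_def convergent_LIMSEQ_iff\<close>)
  have close: "(\<lambda>g. f n g - h g) \<in> lp_funs p M \<and> lp_norm p M (\<lambda>g. f n g - h g) \<le> (1 / 4) ^ k"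
    if n: "n \<ge> N k" for n k
  proof -
    have "(\<integral>\<^sup>+ g. ennreal (cmod (f n g - h g) powr p) \<partial>M) =
        (\<integral>\<^sup>+ g. liminf (\<lambda>j. ennreal (cmod (f n g - f (r j) g) powr p)) \<partial>M)"
    proof (rule nn_integral_cong_AE)
      show "AE g in M. ennreal (cmod (f n g - h g) powr p) =
          liminf (\<lambda>j. ennreal (cmod (f n g - f (r j) g) powr p))"
        using lim
      proof eventually_elim
        case (elim g)
        then have "(\<lambda>j. ennreal (cmod (f n g - f (r j) g) powr p)) \<longlonglongrightarrow> ennreal (cmod (f n g - h g) powr p)"
          using p by (intro tendsto_ennrealI tendsto_powr' tendsto_intros) auto
        then show ?case
          by (intro lim_imp_Liminf[symmetric]) auto
      qed
    qed
    also have "\<dots> \<le> liminf (\<lambda>j. \<integral>\<^sup>+ g. ennreal (cmod (f n g - f (r j) g) powr p) \<partial>M)"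
      by (intro nn_integral_liminf) auto
    also have "\<dots> \<le> ennreal (((1 / 4) ^ k) powr p)"
    proof (rule Liminf_le)
      show "\<forall>\<^sub>F j in sequentially. (\<integral>\<^sup>+ g. ennreal (cmod (f n g - f (r j) g) powr p) \<partial>M)
          \<le> ennreal (((1 / 4) ^ k) powr p)"
        using eventually_ge_at_top[of "N k"]
      proof eventually_elim
        case (elim j)
        have "lp_norm p M (\<lambda>g. f n g - f (r j) g) \<le> (1 / 4) ^ k"
          using N[OF n, of "r j"] elim r_ge(2)[of j] by simp
        then show ?case
          using p f by (subst nn_integral_lp) (auto intro!: lp_funs_minus ennreal_leI powr_mono2 lp_norm_nonneg)
      qed
    qed simp
    finally show ?thesis
      using lp_funsI_nn_integral[OF p, of "\<lambda>g. f n g - h g" M "(1 / 4) ^ k"] by simp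
  qed
  \<comment> \<open>\<open>h\<close> is recovered as \<open>f n\<close> minus the p-integrable
    difference \<open>f n - h\<close>, for \<open>n = N 0\<close>.\<close>
  have "h \<in> lp_funs p M"
    using lp_funs_minus[OF _ f[of "N 0"] conjunct1[OF close[of 0 "N 0"]]] p by simp
  moreover have "(\<lambda>n. lp_norm p M (\<lambda>g. f n g - h g)) \<longlonglongrightarrow> 0"
  proof (rule LIMSEQ_I)
    fix e :: real assume "e > 0"
    obtain k where k: "(1 / 4 :: real) ^ k < e"
      using real_arch_pow_inv[of e "1 / 4"] \<open>e > 0\<close> by auto
    have "norm (lp_norm p M (\<lambda>g. f n g - h g) - 0) < e" if "n \<ge> N k" for n
      using close[OF that] k lp_norm_nonneg[of p M "\<lambda>g. f n g - h g"] by simp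
    then show "\<exists>n0. \<forall>n\<ge>n0. norm (lp_norm p M (\<lambda>g. f n g - h g) - 0) < e"
      by blast
  qed
  ultimately show ?thesis by (rule that)
qed

section \<open>The space of classes as a Banach space\<close>

abbreviation lp_class :: "real \<Rightarrow> 'a measure \<Rightarrow> ('a \<Rightarrow> complex) \<Rightarrow> ('a \<Rightarrow> complex) set" where
  "lp_class p M f \<equiv> lp_rel p M `` {f}"

lemma lp_class_in_carrier: "f \<in> lp_funs p M \<Longrightarrow> lp_class p M f \<in> carrier (Lp p M)"
  by (simp add: carrier_Lp quotientI)

lemma lp_carrierE:
  assumes "\<xi> \<in> carrier (Lp p M)"
  obtains f where "f \<in> lp_funs p M" "\<xi> = lp_class p M f"
  using assms by (auto simp: carrier_Lp elim: quotientE)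

lemma lp_class_eq_iff:
  assumes "f \<in> lp_funs p M" "h \<in> lp_funs p M"
  shows "lp_class p M f = lp_class p M h \<longleftrightarrow> (AE g in M. f g = h g)"
  using eq_equiv_class_iff[OF equiv_lp_rel assms] assms by (simp add: lp_rel_def)

lemma Lp_zero: "\<zero>\<^bsub>Lp p M\<^esub> = lp_class p M (\<lambda>_. 0)"
  by (simp add: Lp_def)

lemma cring_complex_ring: "cring complex_ring"
  by (rule cringI)
    (auto simp: complex_ring_def algebra_simps intro!: abelian_groupI comm_monoidI
      intro: exI[of _ "- _"] bexI[of _ "- _"])

lemma abelian_group_Lp:
  assumes p: "1 \<le> p"
  shows "abelian_group (Lp p M)"
proof (rule abelian_groupI)
  note [simp] = lp_add_class lp_funs_add lp_class_in_carrier Lp_zero lp_funs_zero lp_funs_scale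
  have p0 [simp]: "0 \<le> p" using p by simp
  show "\<xi> \<oplus>\<^bsub>Lp p M\<^esub> \<eta> \<in> carrier (Lp p M)"
    if "\<xi> \<in> carrier (Lp p M)" "\<eta> \<in> carrier (Lp p M)" for \<xi> \<eta>
    using that by (auto elim!: lp_carrierE)
  show "\<zero>\<^bsub>Lp p M\<^esub> \<in> carrier (Lp p M)" by simp
  show "\<xi> \<oplus>\<^bsub>Lp p M\<^esub> \<eta> \<oplus>\<^bsub>Lp p M\<^esub> \<zeta> = \<xi> \<oplus>\<^bsub>Lp p M\<^esub> (\<eta> \<oplus>\<^bsub>Lp p M\<^esub> \<zeta>)"
    if "\<xi> \<in> carrier (Lp p M)" "\<eta> \<in> carrier (Lp p M)" "\<zeta> \<in> carrier (Lp p M)" for \<xi> \<eta> \<zeta>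
    using that by (auto elim!: lp_carrierE simp: add.assoc)
  show "\<xi> \<oplus>\<^bsub>Lp p M\<^esub> \<eta> = \<eta> \<oplus>\<^bsub>Lp p M\<^esub> \<xi>"
    if "\<xi> \<in> carrier (Lp p M)" "\<eta> \<in> carrier (Lp p M)" for \<xi> \<eta>
    using that by (auto elim!: lp_carrierE simp: add.commute)
  show "\<zero>\<^bsub>Lp p M\<^esub> \<oplus>\<^bsub>Lp p M\<^esub> \<xi> = \<xi>" if "\<xi> \<in> carrier (Lp p M)" for \<xi>
    using that by (auto elim!: lp_carrierE)
  show "\<exists>\<eta>\<in>carrier (Lp p M). \<eta> \<oplus>\<^bsub>Lp p M\<^esub> \<xi> = \<zero>\<^bsub>Lp p M\<^esub>" if "\<xi> \<in> carrier (Lp p M)" for \<xi>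
  proof -
    obtain f where f: "f \<in> lp_funs p M" "\<xi> = lp_class p M f"
      using \<open>\<xi> \<in> carrier (Lp p M)\<close> by (rule lp_carrierE)
    show ?thesis
      by (rule bexI[of _ "lp_class p M (\<lambda>g. - 1 * f g)"])
        (use f lp_funs_scale[OF f(1), of "- 1"] in simp_all)
  qed
qed

lemma module_Lp:
  assumes p: "1 \<le> p"
  shows "Module.module complex_ring (Lp p M)"
proof (rule moduleI)
  note [simp] = lp_add_class lp_funs_add lp_class_in_carrier lp_smult_class lp_funs_scale
  have p0 [simp]: "0 \<le> p" using p by simp
  show "c \<odot>\<^bsub>Lp p M\<^esub> \<xi> \<in> carrier (Lp p M)" if "\<xi> \<in> carrier (Lp p M)" for c \<xi>
    using that by (auto elim!: lp_carrierE)
  show "(c \<oplus>\<^bsub>complex_ring\<^esub> d) \<odot>\<^bsub>Lp p M\<^esub> \<xi> = c \<odot>\<^bsub>Lp p M\<^esub> \<xi> \<oplus>\<^bsub>Lp p M\<^esub> d \<odot>\<^bsub>Lp p M\<^esub> \<xi>"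
    if "\<xi> \<in> carrier (Lp p M)" for c d \<xi>
    using that by (auto elim!: lp_carrierE simp: complex_ring_def algebra_simps)
  show "c \<odot>\<^bsub>Lp p M\<^esub> (\<xi> \<oplus>\<^bsub>Lp p M\<^esub> \<eta>) = c \<odot>\<^bsub>Lp p M\<^esub> \<xi> \<oplus>\<^bsub>Lp p M\<^esub> c \<odot>\<^bsub>Lp p M\<^esub> \<eta>"
    if "\<xi> \<in> carrier (Lp p M)" "\<eta> \<in> carrier (Lp p M)" for c \<xi> \<eta>
    using that by (auto elim!: lp_carrierE simp: algebra_simps)
  show "(c \<otimes>\<^bsub>complex_ring\<^esub> d) \<odot>\<^bsub>Lp p M\<^esub> \<xi> = c \<odot>\<^bsub>Lp p M\<^esub> (d \<odot>\<^bsub>Lp p M\<^esub> \<xi>)"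
    if "\<xi> \<in> carrier (Lp p M)" for c d \<xi>
    using that by (auto elim!: lp_carrierE simp: complex_ring_def mult.assoc)
  show "\<one>\<^bsub>complex_ring\<^esub> \<odot>\<^bsub>Lp p M\<^esub> \<xi> = \<xi>" if "\<xi> \<in> carrier (Lp p M)" for \<xi>
    using that by (auto elim!: lp_carrierE simp: complex_ring_def)
qed (use p in \<open>auto intro: cring_complex_ring abelian_group_Lp\<close>)

lemma lp_minus_class:
  assumes p: "1 \<le> p" and f: "f \<in> lp_funs p M" and h: "h \<in> lp_funs p M"
  shows "lp_class p M f \<ominus>\<^bsub>Lp p M\<^esub> lp_class p M h = lp_class p M (\<lambda>g. f g - h g)"
proof -
  interpret abelian_group "Lp p M" by (rule abelian_group_Lp[OF p])
  have m: "(\<lambda>g. - 1 * h g) \<in> lp_funs p M" by (rule lp_funs_scale[OF h])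
  have "\<ominus>\<^bsub>Lp p M\<^esub> lp_class p M h = lp_class p M (\<lambda>g. - 1 * h g)"
    by (rule minus_equality)
      (use p h m in \<open>simp_all add: lp_class_in_carrier lp_add_class Lp_zero\<close>)
  then show ?thesis
    using p f m by (simp add: a_minus_def lp_add_class)
qed

lemma norm_dist_Lp:
  assumes "1 \<le> p" "f \<in> lp_funs p M" "h \<in> lp_funs p M"
  shows "norm_dist (Lp p M) (lp_class p M f) (lp_class p M h) = lp_norm p M (\<lambda>g. f g - h g)"
proof -
  have "(\<lambda>g. f g - h g) \<in> lp_funs p M"
    using assms by (intro lp_funs_minus) auto
  then show ?thesis
    using assms by (simp add: norm_dist_def lp_class_in_carrier lp_minus_class lp_nrm_class lp_norm_def)
qed

lemma Metric_space_Lp: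
  assumes p: "1 \<le> p"
  shows "Metric_space (carrier (Lp p M)) (norm_dist (Lp p M))"
proof
  have nd: "norm_dist (Lp p M) \<xi> \<eta> = 0" if "\<not> (\<xi> \<in> carrier (Lp p M) \<and> \<eta> \<in> carrier (Lp p M))" for \<xi> \<eta>
    using that by (auto simp: norm_dist_def)
  fix \<xi> \<eta> \<zeta>
  show "0 \<le> norm_dist (Lp p M) \<xi> \<eta>"
    using nd[of \<xi> \<eta>] by (cases "\<xi> \<in> carrier (Lp p M) \<and> \<eta> \<in> carrier (Lp p M)")
      (auto elim!: lp_carrierE simp: norm_dist_Lp p lp_norm_nonneg)
  show "norm_dist (Lp p M) \<xi> \<eta> = norm_dist (Lp p M) \<eta> \<xi>"
    using nd[of \<xi> \<eta>] nd[of \<eta> \<xi>] by (cases "\<xi> \<in> carrier (Lp p M) \<and> \<eta> \<in> carrier (Lp p M)")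
      (auto elim!: lp_carrierE simp: norm_dist_Lp p intro: lp_norm_minus_commute)
  assume "\<xi> \<in> carrier (Lp p M)" "\<eta> \<in> carrier (Lp p M)"
  then obtain f h where f: "f \<in> lp_funs p M" "\<xi> = lp_class p M f"
    and h: "h \<in> lp_funs p M" "\<eta> = lp_class p M h"
    by (auto elim!: lp_carrierE)
  have "(\<lambda>g. f g - h g) \<in> lp_funs p M"
    using p f h by (intro lp_funs_minus) auto
  then show "norm_dist (Lp p M) \<xi> \<eta> = 0 \<longleftrightarrow> \<xi> = \<eta>"
    using f h p by (simp add: norm_dist_Lp lp_norm_zero_iff lp_class_eq_iff)
  assume "\<zeta> \<in> carrier (Lp p M)"
  then obtain k where k: "k \<in> lp_funs p M" "\<zeta> = lp_class p M k"
    by (rule lp_carrierE)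
  show "norm_dist (Lp p M) \<xi> \<zeta> \<le> norm_dist (Lp p M) \<xi> \<eta> + norm_dist (Lp p M) \<eta> \<zeta>"
    using f h k p by (simp add: norm_dist_Lp lp_norm_triangle3)
qed

lemma mcomplete_Lp:
  assumes p: "1 \<le> p"
  shows "Metric_space.mcomplete (carrier (Lp p M)) (norm_dist (Lp p M))"
proof -
  interpret Metric_space "carrier (Lp p M)" "norm_dist (Lp p M)"
    by (rule Metric_space_Lp[OF p])
  show ?thesis
    unfolding mcomplete_def
  proof (intro allI impI)
    fix \<sigma> :: "nat \<Rightarrow> _" assume \<sigma>: "MCauchy \<sigma>"
    then have "\<forall>n. \<exists>f. f \<in> lp_funs p M \<and> \<sigma> n = lp_class p M f"
      unfolding MCauchy_def by (metis lp_carrierE range_subsetD)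
    then obtain f where f: "\<And>n. f n \<in> lp_funs p M" "\<And>n. \<sigma> n = lp_class p M (f n)"
      by metis
    have C: "\<exists>N. \<forall>m\<ge>N. \<forall>n\<ge>N. lp_norm p M (\<lambda>g. f m g - f n g) < e" if "e > 0" for e
      using \<sigma> that unfolding MCauchy_def by (simp add: f norm_dist_Lp p)
    obtain h where h: "h \<in> lp_funs p M" "(\<lambda>n. lp_norm p M (\<lambda>g. f n g - h g)) \<longlonglongrightarrow> 0"
      by (rule lp_complete[OF p f(1) C])
    then have "limitin mtopology \<sigma> (lp_class p M h) sequentially"
      by (simp add: limitin_metric_dist_null lp_class_in_carrier f norm_dist_Lp p)
    then show "\<exists>x. limitin mtopology \<sigma> x sequentially" ..
  qed
qed

lemma banach_space_Lp:
  assumes p: "1 \<le> p"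
  shows "banach_space (Lp p M)"
  unfolding banach_space_def
proof (intro conjI ballI allI)
  have p0: "0 \<le> p" using p by simp
  have nrm: "nrm (Lp p M) (lp_class p M f) = lp_norm p M f" if "f \<in> lp_funs p M" for f
    using that by (simp add: lp_nrm_class lp_norm_def)
  fix \<xi> assume "\<xi> \<in> carrier (Lp p M)"
  then obtain f where f: "f \<in> lp_funs p M" "\<xi> = lp_class p M f"
    by (rule lp_carrierE)
  show "0 \<le> nrm (Lp p M) \<xi>"
    by (simp add: f nrm lp_norm_nonneg)
  show "nrm (Lp p M) \<xi> = 0 \<longleftrightarrow> \<xi> = \<zero>\<^bsub>Lp p M\<^esub>"
    using f p by (simp add: nrm Lp_zero lp_norm_zero_iff lp_class_eq_iff lp_funs_zero)
  show "nrm (Lp p M) (c \<odot>\<^bsub>Lp p M\<^esub> \<xi>) = cmod c * nrm (Lp p M) \<xi>" for c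
    using f p by (simp add: nrm lp_smult_class lp_funs_scale lp_norm_scale)
  fix \<eta> assume "\<eta> \<in> carrier (Lp p M)"
  then obtain h where h: "h \<in> lp_funs p M" "\<eta> = lp_class p M h"
    by (rule lp_carrierE)
  show "nrm (Lp p M) (\<xi> \<oplus>\<^bsub>Lp p M\<^esub> \<eta>) \<le> nrm (Lp p M) \<xi> + nrm (Lp p M) \<eta>"
    using f h p p0 by (simp add: nrm lp_add_class lp_funs_add lp_norm_triangle)
qed (use p in \<open>auto intro: module_Lp mcomplete_Lp\<close>)

section \<open>Borel fields of complete separable metric spaces\<close>

text \<open>The fibres come without a Borel structure on their union. Borel dependence on
  \<open>x\<close> enters only through the distances between sections, and the structure is
  constructed from these.\<close>

locale metric_field =
  fixes X :: "'x measure" and C :: "'x \<Rightarrow> 'v set" and D :: "'x \<Rightarrow> 'v \<Rightarrow> 'v \<Rightarrow> real"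
    and \<sigma> :: "nat \<Rightarrow> 'x \<Rightarrow> 'v"
  assumes standard: "standard_borel X"
    and metric: "x \<in> space X \<Longrightarrow> Metric_space (C x) (D x)"
    and complete: "x \<in> space X \<Longrightarrow> Metric_space.mcomplete (C x) (D x)"
    and dense: "x \<in> space X \<Longrightarrow> Metric_space.dense_seq (C x) (D x) (\<lambda>n. \<sigma> n x)"
    and dist_measurable: "(\<lambda>x. D x (\<sigma> m x) (\<sigma> n x)) \<in> borel_measurable X"
begin

definition total_space :: "('x \<times> 'v) measure" where
  "total_space = vimage_algebra (Sigma (space X) C)
     (\<lambda>(x, v). (x, \<lambda>n. D x v (\<sigma> n x))) (X \<Otimes>\<^sub>M (borel :: (nat \<Rightarrow> real) measure))"

lemma section_in: "x \<in> space X \<Longrightarrow> \<sigma> n x \<in> C x"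
  using dense[of x] metric[of x] by (auto simp: Metric_space.dense_seq_def)

lemma dense_near:
  assumes "x \<in> space X" "v \<in> C x" "e > 0"
  shows "\<exists>n. D x v (\<sigma> n x) < e"
  using dense[OF assms(1)] assms(2,3) by (simp add: Metric_space.dense_seq_def[OF metric[OF assms(1)]])

lemma space_total_space: "space total_space = Sigma (space X) C"
  by (simp add: total_space_def)

lemma total_space_measurable_key:
  "(\<lambda>(x, v). (x, \<lambda>n. D x v (\<sigma> n x))) \<in> total_space \<rightarrow>\<^sub>M X \<Otimes>\<^sub>M (borel :: (nat \<Rightarrow> real) measure)"
  unfolding total_space_def by (rule measurable_vimage_algebra1) (auto simp: space_pair_measure)

lemma fst_measurable_total_space: "fst \<in> total_space \<rightarrow>\<^sub>M X"
proof -
  have "(\<lambda>w. fst ((\<lambda>(x, v). (x, \<lambda>n. D x v (\<sigma> n x))) w)) \<in> total_space \<rightarrow>\<^sub>M X"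
    by (rule measurable_compose[OF total_space_measurable_key measurable_fst])
  then show ?thesis by (simp add: split_def)
qed

lemma dist_measurable_total_space: "(\<lambda>w. D (fst w) (snd w) (\<sigma> n (fst w))) \<in> borel_measurable total_space"
proof -
  have "(\<lambda>w. snd ((\<lambda>(x, v). (x, \<lambda>n. D x v (\<sigma> n x))) w) n) \<in> borel_measurable total_space"
    by (rule measurable_compose[OF measurable_compose[OF total_space_measurable_key measurable_snd]
        borel_measurable_sequence_coord])
  then show ?thesis by (simp add: split_def)
qed

text \<open>Universal property of the generated sigma-algebra. It reduces Borel maps into the field
  to Borel real functions, and is applied to the sections, to addition and to scalar
  multiplication.\<close>

lemma measurable_into_total_space:
  assumes "r \<in> N \<rightarrow>\<^sub>M X" "\<And>w. w \<in> space N \<Longrightarrow> v w \<in> C (r w)"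
    and "\<And>n. (\<lambda>w. D (r w) (v w) (\<sigma> n (r w))) \<in> borel_measurable N"
  shows "(\<lambda>w. (r w, v w)) \<in> N \<rightarrow>\<^sub>M total_space"
  unfolding total_space_def
proof (rule measurable_vimage_algebra2)
  show "(\<lambda>w. (r w, v w)) \<in> space N \<rightarrow> Sigma (space X) C"
    using measurable_space[OF assms(1)] assms(2) by auto
  have "(\<lambda>w n. D (r w) (v w) (\<sigma> n (r w))) \<in> borel_measurable N"
    by (rule borel_measurable_sequenceI[OF assms(3)])
  then show "(\<lambda>w. case (r w, v w) of (x, v) \<Rightarrow> (x, \<lambda>n. D x v (\<sigma> n x)))
      \<in> N \<rightarrow>\<^sub>M X \<Otimes>\<^sub>M (borel :: (nat \<Rightarrow> real) measure)"
    using assms(1) by simp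
qed

lemma section_measurable: "(\<lambda>x. (x, \<sigma> n x)) \<in> X \<rightarrow>\<^sub>M total_space"
  by (rule measurable_into_total_space) (auto simp: section_in dist_measurable)

text \<open>A sequence lies in the image of \<open>\<Psi>\<close> iff its even part codes some
  \<open>x\<close> and its odd part is a distance sequence for the matrix at this \<open>x\<close>.
  The second condition is Borel because the decoded base point depends measurably on the even
  part.\<close>

lemma standard_borel_total_space: "standard_borel total_space"
proof -
  obtain j where j: "borel_embedding X j"
    using standard_borel_embedding[OF standard] .
  have j_meas: "j \<in> borel_measurable X" and inj: "inj_on j (space X)"
    and [measurable]: "j ` space X \<in> sets borel"
    using j by (auto simp: borel_embedding_def)
  define k where "k = inv_into (space X) j"
  have k: "k (j x) = x" if "x \<in> space X" for x
    using inj that by (simp add: k_def)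
  \<comment> \<open>Decoding by \<open>k\<close> is meaningful only on \<open>W\<close>;
    measurability is therefore stated relative to \<open>W\<close> and transferred because
    \<open>W\<close> is Borel.\<close>
  define W where "W = {z. evens z \<in> j ` space X}"
  have W: "W \<in> sets borel"
  proof -
    have "{z \<in> space borel. evens z \<in> j ` space X} \<in> sets borel" by measurable
    then show ?thesis by (simp add: W_def)
  qed
  let ?R = "restrict_space borel W"
  have kW: "(\<lambda>z. k (evens z)) \<in> ?R \<rightarrow>\<^sub>M X"
  proof (rule measurable_compose[OF _ inv_into_measurable[OF j, folded k_def]])
    show "evens \<in> ?R \<rightarrow>\<^sub>M restrict_space borel (j ` space X)"
      by (intro measurable_restrict_space2 measurable_restrict_space1)
        (auto simp: space_restrict_space W_def)
  qed
  have odds: "odds \<in> borel_measurable ?R"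
    by (intro measurable_restrict_space1) auto
  define \<Psi> where "\<Psi> w = interleave (j (fst w)) (\<lambda>n. D (fst w) (snd w) (\<sigma> n (fst w)))" for w
  have "borel_embedding total_space \<Psi>"
    unfolding borel_embedding_def
  proof (intro conjI ballI)
    show "\<Psi> \<in> borel_measurable total_space"
      unfolding \<Psi>_def
      by (intro interleave_measurable borel_measurable_sequenceI dist_measurable_total_space
          measurable_compose[OF fst_measurable_total_space j_meas])
    show "inj_on \<Psi> (space total_space)"
    proof (rule inj_onI)
      fix w w' assume w: "w \<in> space total_space" "w' \<in> space total_space" "\<Psi> w = \<Psi> w'"
      then have "evens (\<Psi> w) = evens (\<Psi> w')" "odds (\<Psi> w) = odds (\<Psi> w')" by simp_all
      then have "j (fst w) = j (fst w')" and
        eq: "(\<lambda>n. D (fst w) (snd w) (\<sigma> n (fst w))) = (\<lambda>n. D (fst w') (snd w') (\<sigma> n (fst w')))"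
        by (simp_all add: \<Psi>_def)
      then have fst: "fst w = fst w'"
        using w inj by (auto simp: space_total_space dest: inj_onD)
      have x: "fst w \<in> space X" using w by (auto simp: space_total_space)
      from Metric_space.inj_on_distances[OF metric[OF x] dense[OF x]]
      have "snd w = snd w'"
        using w eq fst by (auto simp: space_total_space dest!: inj_onD)
      with fst show "w = w'" by (simp add: prod_eq_iff)
    qed
    have "\<Psi> ` space total_space = {z \<in> space ?R. odds z \<in>
        distance_sequences (\<lambda>i l. D (k (evens z)) (\<sigma> i (k (evens z))) (\<sigma> l (k (evens z))))}"
      (is "_ = ?S")
    proof (intro equalityI subsetI)
      fix z assume "z \<in> \<Psi> ` space total_space"
      then obtain x v where xv: "x \<in> space X" "v \<in> C x" "z = \<Psi> (x, v)"
        by (auto simp: space_total_space)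
      then have "odds z \<in> (\<lambda>v n. D x v (\<sigma> n x)) ` C x"
        by (auto simp: \<Psi>_def)
      then show "z \<in> ?S"
        unfolding Metric_space.distances_image[OF metric[OF xv(1)] dense[OF xv(1)] complete[OF xv(1)]]
        using xv k[OF xv(1)] by (auto simp: \<Psi>_def W_def space_restrict_space)
    next
      fix z assume z: "z \<in> ?S"
      then obtain x where x: "x \<in> space X" "evens z = j x"
        by (auto simp: space_restrict_space W_def)
      then have "odds z \<in> (\<lambda>v n. D x v (\<sigma> n x)) ` C x"
        unfolding Metric_space.distances_image[OF metric[OF x(1)] dense[OF x(1)] complete[OF x(1)]]
        using z k[OF x(1)] by auto
      then obtain v where v: "v \<in> C x" "odds z = (\<lambda>n. D x v (\<sigma> n x))" by auto
      then have "\<Psi> (x, v) = z"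
        using interleave_evens_odds[of z] x by (simp add: \<Psi>_def)
      then show "z \<in> \<Psi> ` space total_space"
        using x v by (auto simp: space_total_space intro!: image_eqI[of _ _ "(x, v)"])
    qed
    also have "\<dots> \<in> sets ?R"
      by (intro distance_sequences_measurable odds measurable_compose[OF kW dist_measurable])
    finally show "\<Psi> ` space total_space \<in> sets borel"
      using W by (simp add: sets_restrict_space_iff)
    fix A assume "A \<in> sets total_space"
    then obtain E where E: "E \<in> sets (X \<Otimes>\<^sub>M (borel :: (nat \<Rightarrow> real) measure))"
      "A = (\<lambda>(x, v). (x, \<lambda>n. D x v (\<sigma> n x))) -` E \<inter> Sigma (space X) C"
      unfolding total_space_def by (subst (asm) sets_vimage_algebra2) (auto simp: space_pair_measure)
    have "(\<lambda>z. (k (evens z), odds z)) -` E \<inter> space ?R \<in> sets ?R"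
      using kW odds E(1) by (intro measurable_sets[OF measurable_Pair])
    then have "(\<lambda>z. (k (evens z), odds z)) -` E \<inter> W \<in> sets borel"
      using W by (simp add: sets_restrict_space_iff space_restrict_space)
    moreover have "A = \<Psi> -` ((\<lambda>z. (k (evens z), odds z)) -` E \<inter> W) \<inter> space total_space"
      using E(2) k by (auto simp: \<Psi>_def space_total_space W_def)
    ultimately show "\<exists>B\<in>sets borel. A = \<Psi> -` B \<inter> space total_space" by blast
  qed
  then show ?thesis by (rule borel_embedding_imp_standard_borel)
qed

text \<open>A Caratheodory-type argument: approximate by the first section within distance \<open>1 / Suc k\<close>.\<close>

lemma measurable_if_continuous:
  fixes h :: "'w \<Rightarrow> 'v \<Rightarrow> 'b::metric_space"
  assumes v: "(\<lambda>w. (r w, v w)) \<in> N \<rightarrow>\<^sub>M total_space"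
    and h: "\<And>n. (\<lambda>w. h w (\<sigma> n (r w))) \<in> borel_measurable N"
    and cont: "\<And>w u. w \<in> space N \<Longrightarrow> (\<And>k :: nat. u k \<in> C (r w)) \<Longrightarrow>
      (\<lambda>k. D (r w) (v w) (u k)) \<longlonglongrightarrow> 0 \<Longrightarrow> (\<lambda>k. h w (u k)) \<longlonglongrightarrow> h w (v w)"
  shows "(\<lambda>w. h w (v w)) \<in> borel_measurable N"
proof -
  have r: "r \<in> N \<rightarrow>\<^sub>M X"
    using measurable_compose[OF v fst_measurable_total_space] by simp
  have [measurable]: "(\<lambda>w. D (r w) (v w) (\<sigma> n (r w))) \<in> borel_measurable N" for n
    using measurable_compose[OF v dist_measurable_total_space] by simp
  define n where "n k w = (LEAST n. D (r w) (v w) (\<sigma> n (r w)) < 1 / real (Suc k))" for k w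
  have n_meas: "n k \<in> N \<rightarrow>\<^sub>M count_space UNIV" for k
    unfolding n_def by measurable
  show ?thesis
  proof (rule borel_measurable_LIMSEQ_metric)
    \<comment> \<open>The index takes countably many values, so evaluating \<open>h\<close> at the
      section with that index stays measurable.\<close>
    show "(\<lambda>w. h w (\<sigma> (n k w) (r w))) \<in> borel_measurable N" for k
      by (rule measurable_compose_countable[OF h n_meas])
    fix w assume w: "w \<in> space N"
    have x: "r w \<in> space X" "v w \<in> C (r w)"
      using measurable_space[OF v w] by (auto simp: space_total_space)
    interpret Metric_space "C (r w)" "D (r w)" by (rule metric[OF x(1)])
    have "D (r w) (v w) (\<sigma> (n k w) (r w)) < 1 / real (Suc k)" for k
      unfolding n_def by (rule LeastI_ex[OF dense_near[OF x]]) simp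
    then have "(\<lambda>k. D (r w) (v w) (\<sigma> (n k w) (r w))) \<longlonglongrightarrow> 0"
      by (intro tendsto_sandwich[OF _ _ tendsto_const LIMSEQ_Suc[OF lim_const_over_n[of 1]]])
        (auto intro!: always_eventually less_imp_le)
    then show "(\<lambda>k. h w (\<sigma> (n k w) (r w))) \<longlonglongrightarrow> h w (v w)"
      by (intro cont w section_in x(1))
  qed
qed

end

section \<open>Pairing \<open>L\<^sup>p\<close> with bounded functions of finite support\<close>

text \<open>Stands in for Hoelder's inequality and treats p = 1 uniformly: for \<open>a > t\<close>
  the factor \<open>a powr (1 - p)\<close> is at most \<open>t powr (1 - p)\<close>. Choosing
  \<open>t\<close> small later makes the contribution of the support small.\<close>

lemma le_plus_powr:
  fixes a t p :: real
  assumes "0 < t" "0 \<le> a" "1 \<le> p"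
  shows "a \<le> t + t powr (1 - p) * a powr p"
proof (cases "a \<le> t")
  case False
  then have "a powr (1 - p) \<le> t powr (1 - p)"
    using assms by (intro powr_mono2') auto
  then have "a powr (1 - p) * a powr p \<le> t powr (1 - p) * a powr p"
    by (intro mult_right_mono) auto
  moreover have "a powr (1 - p) * a powr p = a"
    using False assms by (simp add: powr_add[symmetric])
  ultimately show ?thesis using assms by simp
qed (use assms in \<open>simp add: add_increasing2\<close>)

lemma lp_pairing_integrable:
  fixes F :: "'a \<Rightarrow> complex"
  assumes p: "1 \<le> p" and f: "f \<in> lp_funs p M" and [measurable]: "F \<in> borel_measurable M"
    and K [measurable]: "K \<in> sets M" "emeasure M K < \<infinity>"
    and F: "\<And>g. g \<in> space M \<Longrightarrow> cmod (F g) \<le> B * indicator K g"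
  shows "integrable M (\<lambda>g. f g * F g)"
    and "0 < t \<Longrightarrow> 0 \<le> B \<Longrightarrow> cmod (LINT g|M. f g * F g) \<le> B * (t * measure M K + t powr (1 - p) * lp_norm p M f powr p)"
proof -
  have [measurable]: "f \<in> borel_measurable M" and intf: "integrable M (\<lambda>g. cmod (f g) powr p)"
    using f by (auto simp: lp_funs_def)
  have intK: "integrable M (indicator K :: _ \<Rightarrow> real)"
    using K by (simp add: integrable_indicator_iff)
  have le: "cmod (f g * F g) \<le> \<bar>B\<bar> * (t * indicator K g + t powr (1 - p) * cmod (f g) powr p)"
    if "g \<in> space M" "0 < t" for g t
  proof -
    \<comment> \<open>The first conclusion has no sign condition on \<open>B\<close>, hence the
      absolute value.\<close>
    have "cmod (F g) \<le> \<bar>B\<bar> * indicator K g"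
      using F[OF that(1)] by (auto simp: indicator_def split: if_splits)
    then have "cmod (f g * F g) \<le> cmod (f g) * (\<bar>B\<bar> * indicator K g)"
      unfolding norm_mult by (intro mult_left_mono) auto
    also have "\<dots> \<le> (t + t powr (1 - p) * cmod (f g) powr p) * (\<bar>B\<bar> * indicator K g)"
      using le_plus_powr[OF that(2) _ p, of "cmod (f g)"] by (intro mult_right_mono) auto
    also have "\<dots> \<le> \<bar>B\<bar> * (t * indicator K g + t powr (1 - p) * cmod (f g) powr p)"
      by (auto simp: indicator_def algebra_simps)
    finally show ?thesis .
  qed
  show int: "integrable M (\<lambda>g. f g * F g)"
  proof (rule Bochner_Integration.integrable_bound)
    show "integrable M (\<lambda>g. \<bar>B\<bar> * (1 * indicator K g + 1 powr (1 - p) * cmod (f g) powr p))"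
      using intf intK by simp
    show "AE g in M. norm (f g * F g)
        \<le> norm (\<bar>B\<bar> * (1 * indicator K g + 1 powr (1 - p) * cmod (f g) powr p))"
      using le[of _ 1] by (intro AE_I2) (force intro: order_trans)
  qed simp
  assume t: "0 < t" "0 \<le> B"
  have "cmod (LINT g|M. f g * F g) \<le> (LINT g|M. cmod (f g * F g))"
    by (rule integral_norm_bound)
  also have "\<dots> \<le> (LINT g|M. B * (t * indicator K g + t powr (1 - p) * cmod (f g) powr p))"
    using int intf intK le[of _ t] t by (intro integral_mono) auto
  also have "\<dots> = B * (t * measure M K + t powr (1 - p) * lp_norm p M f powr p)"
    using intf intK p by (simp add: lp_norm_powr)
  finally show "cmod (LINT g|M. f g * F g) \<le> B * (t * measure M K + t powr (1 - p) * lp_norm p M f powr p)" .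
qed

text \<open>The two terms of the bound are controlled in turn: \<open>t\<close> is fixed so that the
  term with \<open>measure M K\<close> is at most e / 2, and for this \<open>t\<close> the norm term
  tends to 0.\<close>

lemma lp_pairing_tendsto:
  fixes F :: "'a \<Rightarrow> complex"
  assumes p: "1 \<le> p" and f: "f \<in> lp_funs p M" "\<And>k. u k \<in> lp_funs p M"
    and F_meas: "F \<in> borel_measurable M"
    and K: "K \<in> sets M" "emeasure M K < \<infinity>" and B: "0 \<le> B"
    and F: "\<And>g. g \<in> space M \<Longrightarrow> cmod (F g) \<le> B * indicator K g"
    and lim: "(\<lambda>k. lp_norm p M (\<lambda>g. f g - u k g)) \<longlonglongrightarrow> 0"
  shows "(\<lambda>k. LINT g|M. u k g * F g) \<longlonglongrightarrow> (LINT g|M. f g * F g)"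
proof (rule LIMSEQ_I)
  fix e :: real assume e: "e > 0"
  \<comment> \<open>The summand 1 keeps the denominator positive when \<open>B\<close> or the
    measure of \<open>K\<close> vanishes.\<close>
  define t where "t = e / (2 * (B * measure M K + 1))"
  have den: "B * measure M K + 1 > 0"
    using B by (simp add: add_nonneg_pos)
  then have t: "t > 0" using e by (simp add: t_def)
  have "B * (t * measure M K) = e / 2 * (B * measure M K / (B * measure M K + 1))"
    by (simp add: t_def)
  also have "\<dots> \<le> e / 2 * 1"
    using e den by (intro mult_left_mono) auto
  finally have small: "B * (t * measure M K) \<le> e / 2" by simp
  have "(\<lambda>k. B * (t powr (1 - p) * lp_norm p M (\<lambda>g. f g - u k g) powr p)) \<longlonglongrightarrow> B * (t powr (1 - p) * 0 powr p)"
    using p by (intro tendsto_intros tendsto_powr' lim) (auto simp: lp_norm_nonneg)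
  then have "(\<lambda>k. B * (t powr (1 - p) * lp_norm p M (\<lambda>g. f g - u k g) powr p)) \<longlonglongrightarrow> 0"
    by simp
  then have "\<forall>\<^sub>F k in sequentially. B * (t powr (1 - p) * lp_norm p M (\<lambda>g. f g - u k g) powr p) < e / 2"
    using e by (intro order_tendstoD(2)) auto
  then obtain N where N: "\<And>k. k \<ge> N \<Longrightarrow> B * (t powr (1 - p) * lp_norm p M (\<lambda>g. f g - u k g) powr p) < e / 2"
    by (auto simp: eventually_sequentially)
  have "norm ((LINT g|M. u k g * F g) - (LINT g|M. f g * F g)) < e" if "k \<ge> N" for k
  proof -
    have d: "(\<lambda>g. f g - u k g) \<in> lp_funs p M"
      using p f by (intro lp_funs_minus) auto
    have "norm ((LINT g|M. u k g * F g) - (LINT g|M. f g * F g)) =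
        norm ((LINT g|M. f g * F g) - (LINT g|M. u k g * F g))"
      by (rule norm_minus_commute)
    also have "(LINT g|M. f g * F g) - (LINT g|M. u k g * F g) = (LINT g|M. (f g - u k g) * F g)"
      by (simp add: left_diff_distrib Bochner_Integration.integral_diff
          lp_pairing_integrable(1)[OF p f(1) F_meas K F] lp_pairing_integrable(1)[OF p f(2) F_meas K F])
    also have "cmod \<dots> \<le> B * (t * measure M K + t powr (1 - p) * lp_norm p M (\<lambda>g. f g - u k g) powr p)"
      by (rule lp_pairing_integrable(2)[OF p d F_meas K F t B])
    also have "\<dots> < e"
      using small N[OF that] by (simp add: distrib_left)
    finally show ?thesis .
  qed
  then show "\<exists>N. \<forall>k\<ge>N. norm ((LINT g|M. u k g * F g) - (LINT g|M. f g * F g)) < e" by blast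
qed

lemma lp_norm_cong:
  assumes "\<And>g. g \<in> space M \<Longrightarrow> f g = h g"
  shows "lp_norm p M f = lp_norm p M h"
  unfolding lp_norm_def using assms by (intro arg_cong[of _ _ "\<lambda>x. x powr _"] Bochner_Integration.integral_cong) auto

lemma lp_funs_cong:
  assumes "\<And>g. g \<in> space M \<Longrightarrow> f g = h g"
  shows "f \<in> lp_funs p M \<longleftrightarrow> h \<in> lp_funs p M"
  unfolding lp_funs_def mem_Collect_eq
  using assms by (intro conj_cong measurable_cong Bochner_Integration.integrable_cong) auto

lemma lp_funs_indicator:
  assumes "A \<in> sets M" "emeasure M A < \<infinity>" "1 \<le> p"
  shows "(\<lambda>g. c * indicator A g) \<in> lp_funs p M"
proof -
  have "(\<lambda>g. cmod (indicator A g) powr p) = (indicator A :: _ \<Rightarrow> real)"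
    using assms(3) by (auto simp: indicator_def)
  then have "indicator A \<in> lp_funs p M"
    using assms by (simp add: lp_funs_def integrable_indicator_iff)
  then show ?thesis by (rule lp_funs_scale)
qed

section \<open>Cut-off functions and rational step functions\<close>

text \<open>
  These notions depend only on the distances \<open>\<Delta> m n = d (s m) (s n)\<close> within a dense sequence and the
  distances \<open>y n = d g (s n)\<close> of a point \<open>g\<close> from it, so that they are Borel in the base point.  The pair \<open>(n, k)\<close> encodes the ball of
  radius \<open>1 / Suc k\<close> about \<open>s n\<close>; it is good if the members of the sequence inside it are totally bounded.
\<close>

definition good_ball :: "(nat \<Rightarrow> nat \<Rightarrow> real) \<Rightarrow> nat \<Rightarrow> nat \<Rightarrow> bool" where
  "good_ball \<Delta> n k \<longleftrightarrow> (\<forall>e. \<exists>N. \<forall>m. \<Delta> m n < 1 / real (Suc k) \<longrightarrow>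
     (\<exists>i\<le>N. \<Delta> i n < 1 / real (Suc k) \<and> \<Delta> m i < 1 / real (Suc e)))"

definition in_balls :: "(nat \<Rightarrow> nat \<Rightarrow> real) \<Rightarrow> (nat \<times> nat) list \<Rightarrow> (nat \<Rightarrow> real) \<Rightarrow> bool" where
  "in_balls \<Delta> l y \<longleftrightarrow> (\<exists>(n, k)\<in>set l. good_ball \<Delta> n k \<and> y n < 1 / real (Suc k))"

definition bump :: "(nat \<Rightarrow> nat \<Rightarrow> real) \<Rightarrow> (nat \<times> nat) list \<Rightarrow> (nat \<Rightarrow> real) \<Rightarrow> real" where
  "bump \<Delta> l y = (\<Sum>(n, k)\<leftarrow>l. if good_ball \<Delta> n k then max 0 (1 / real (Suc k) - y n) else 0)"

definition cutoff :: "(nat \<Rightarrow> nat \<Rightarrow> real) \<Rightarrow> (nat \<times> nat) list \<Rightarrow> nat \<Rightarrow> (nat \<Rightarrow> real) \<Rightarrow> real" where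
  "cutoff \<Delta> l j y = min 1 (real j * bump \<Delta> l y)"

definition rat_complex :: "rat \<times> rat \<Rightarrow> complex" where
  "rat_complex q = Complex (of_rat (fst q)) (of_rat (snd q))"

definition rational_step ::
    "(nat \<Rightarrow> nat \<Rightarrow> real) \<Rightarrow> ((rat \<times> rat) \<times> (nat \<times> nat) list) list \<Rightarrow> (nat \<Rightarrow> real) \<Rightarrow> complex" where
  "rational_step \<Delta> c y = (\<Sum>(q, l)\<leftarrow>c. rat_complex q * of_bool (in_balls \<Delta> l y))"

lemma rat_complex_dense:
  assumes "e > 0"
  obtains q where "cmod (c - rat_complex q) < e"
proof -
  obtain a b where a: "Re c < of_rat a" "of_rat a < Re c + e / 2"
    and b: "Im c < of_rat b" "of_rat b < Im c + e / 2"
    using of_rat_dense[of "Re c" "Re c + e / 2"] of_rat_dense[of "Im c" "Im c + e / 2"] assms by auto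
  have "cmod (c - rat_complex (a, b)) \<le> \<bar>Re c - of_rat a\<bar> + \<bar>Im c - of_rat b\<bar>"
    using cmod_le[of "c - rat_complex (a, b)"] by (simp add: rat_complex_def)
  also have "\<dots> < e" using a b by linarith
  finally show ?thesis by (rule that)
qed

lemma bump_Cons:
  "bump \<Delta> ((n, k) # l) y = (if good_ball \<Delta> n k then max 0 (1 / real (Suc k) - y n) else 0) + bump \<Delta> l y"
  by (simp add: bump_def)

lemma bump_nonneg: "0 \<le> bump \<Delta> l y"
  unfolding bump_def by (induction l) auto

lemma bump_pos_iff: "0 < bump \<Delta> l y \<longleftrightarrow> in_balls \<Delta> l y"
proof (induction l)
  case Nil
  then show ?case by (simp add: bump_def in_balls_def)
next
  case (Cons a l)
  obtain n k where a: "a = (n, k)" by (cases a)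
  have "in_balls \<Delta> (a # l) y \<longleftrightarrow> (good_ball \<Delta> n k \<and> y n < 1 / real (Suc k)) \<or> in_balls \<Delta> l y"
    by (auto simp: in_balls_def a)
  then show ?case
    using Cons bump_nonneg[of \<Delta> l y] by (auto simp: a bump_Cons max_def)
qed

lemma cutoff_bounds: "0 \<le> cutoff \<Delta> l j y" "cutoff \<Delta> l j y \<le> of_bool (in_balls \<Delta> l y)"
  using bump_nonneg[of \<Delta> l y] bump_pos_iff[of \<Delta> l y]
  by (auto simp: cutoff_def of_bool_def min_def)

text \<open>Where the bump is positive, its multiples eventually exceed 1 and the truncation is
  constantly 1; elsewhere the bump vanishes. This turns indicators of unions of good balls into
  limits of continuous functions.\<close>

lemma cutoff_tendsto: "(\<lambda>j. cutoff \<Delta> l j y) \<longlonglongrightarrow> of_bool (in_balls \<Delta> l y)"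
proof (cases "in_balls \<Delta> l y")
  case True
  then have pos: "bump \<Delta> l y > 0" by (simp add: bump_pos_iff)
  obtain N where N: "1 / bump \<Delta> l y < real N" using reals_Archimedean2 by blast
  have "cutoff \<Delta> l j y = 1" if "j \<ge> N" for j
  proof -
    have "1 / bump \<Delta> l y < real j" using N that by linarith
    then have "1 < real j * bump \<Delta> l y" using pos by (simp add: divide_less_eq)
    then show ?thesis by (simp add: cutoff_def)
  qed
  then have "\<forall>\<^sub>F j in sequentially. cutoff \<Delta> l j y = 1"
    by (auto simp: eventually_sequentially)
  then show ?thesis using True by (simp add: tendsto_eventually)
next
  case False
  then have "bump \<Delta> l y = 0"
    using bump_pos_iff[of \<Delta> l y] bump_nonneg[of \<Delta> l y] by linarith
  then show ?thesis using False by (simp add: cutoff_def)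
qed

lemma rational_step_append: "rational_step \<Delta> (c @ c') y = rational_step \<Delta> c y + rational_step \<Delta> c' y"
  by (simp add: rational_step_def)

section \<open>A single locally compact fibre with its Radon measure\<close>

locale radon_fibre = Metric_space M d for M :: "'a set" and d :: "'a \<Rightarrow> 'a \<Rightarrow> real" +
  fixes s :: "nat \<Rightarrow> 'a" and \<mu> :: "'a measure"
  assumes s: "dense_seq s" and complete: mcomplete
    and locally_compact: "locally_compact_space mtopology"
    and radon: "radon_measure mtopology \<mu>"
begin

abbreviation \<Delta> :: "nat \<Rightarrow> nat \<Rightarrow> real" where "\<Delta> m n \<equiv> d (s m) (s n)"
abbreviation dists :: "'a \<Rightarrow> nat \<Rightarrow> real" where "dists g \<equiv> \<lambda>n. d g (s n)"

definition balls :: "(nat \<times> nat) list \<Rightarrow> 'a set" where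
  "balls l = {g \<in> M. in_balls \<Delta> l (dists g)}"

lemma s_in: "s n \<in> M"
  using s by (auto simp: dense_seq_def)

lemma s_near: "x \<in> M \<Longrightarrow> e > 0 \<Longrightarrow> \<exists>n. d x (s n) < e"
  using s by (auto simp: dense_seq_def)

text \<open>Ties the countable test on distances to topology. A finite net inside the set
  corresponds to a bound \<open>N\<close> on the indices of its centres, which is why the test
  requires the centres to lie in the ball.\<close>

lemma good_ball_iff:
  "good_ball \<Delta> n k \<longleftrightarrow> mtotally_bounded {s m |m. \<Delta> m n < 1 / real (Suc k)}" (is "_ \<longleftrightarrow> mtotally_bounded ?S")
proof
  assume good: "good_ball \<Delta> n k"
  show "mtotally_bounded ?S"
    unfolding mtotally_bounded_def
  proof (intro allI impI)
    fix \<epsilon> :: real assume "\<epsilon> > 0"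
    then obtain e where e: "1 / real (Suc e) < \<epsilon>" using nat_approx_posE by blast
    obtain N where N: "\<And>m. \<Delta> m n < 1 / real (Suc k) \<Longrightarrow>
        \<exists>i\<le>N. \<Delta> i n < 1 / real (Suc k) \<and> \<Delta> m i < 1 / real (Suc e)"
      using good unfolding good_ball_def by blast
    show "\<exists>K. finite K \<and> K \<subseteq> ?S \<and> ?S \<subseteq> (\<Union>x\<in>K. mball x \<epsilon>)"
    proof (intro exI conjI)
      let ?K = "s ` {i. i \<le> N \<and> \<Delta> i n < 1 / real (Suc k)}"
      show "finite ?K" by simp
      show "?K \<subseteq> ?S" by blast
      show "?S \<subseteq> (\<Union>x\<in>?K. mball x \<epsilon>)"
      proof
        fix x assume "x \<in> ?S"
        then obtain m where m: "x = s m" "\<Delta> m n < 1 / real (Suc k)" by blast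
        then obtain i where "i \<le> N" "\<Delta> i n < 1 / real (Suc k)" "\<Delta> m i < 1 / real (Suc e)"
          using N by blast
        moreover from this have "x \<in> mball (s i) \<epsilon>"
          using e m s_in commute[of "s m" "s i"] by (auto simp: in_mball)
        ultimately show "x \<in> (\<Union>x\<in>?K. mball x \<epsilon>)" by blast
      qed
    qed
  qed
next
  assume tb: "mtotally_bounded ?S"
  show "good_ball \<Delta> n k"
    unfolding good_ball_def
  proof
    fix e
    have "0 < 1 / real (Suc e)" by simp
    from tb[unfolded mtotally_bounded_def, THEN spec, THEN mp, OF this]
    obtain K where "finite K \<and> K \<subseteq> ?S \<and> ?S \<subseteq> (\<Union>x\<in>K. mball x (1 / real (Suc e)))"
      by (elim exE) blast
    then have K: "finite K" "K \<subseteq> ?S" "?S \<subseteq> (\<Union>x\<in>K. mball x (1 / real (Suc e)))"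
      by simp_all
    have "\<forall>x\<in>K. \<exists>i. x = s i \<and> \<Delta> i n < 1 / real (Suc k)"
      using K(2) by blast
    then obtain i where i: "\<And>x. x \<in> K \<Longrightarrow> x = s (i x) \<and> \<Delta> (i x) n < 1 / real (Suc k)"
      by metis
    obtain N where N: "\<And>x. x \<in> K \<Longrightarrow> i x \<le> N"
      using finite_nat_set_iff_bounded_le[of "i ` K"] K(1) by auto
    show "\<exists>N. \<forall>m. \<Delta> m n < 1 / real (Suc k) \<longrightarrow>
        (\<exists>i\<le>N. \<Delta> i n < 1 / real (Suc k) \<and> \<Delta> m i < 1 / real (Suc e))"
    proof (rule exI[of _ N], intro allI impI)
      fix m assume "\<Delta> m n < 1 / real (Suc k)"
      then have "s m \<in> (\<Union>x\<in>K. mball x (1 / real (Suc e)))" using K(3) by blast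
      then obtain x where x: "x \<in> K" "d x (s m) < 1 / real (Suc e)" by (auto simp: in_mball)
      then show "\<exists>i\<le>N. \<Delta> i n < 1 / real (Suc k) \<and> \<Delta> m i < 1 / real (Suc e)"
        using i[OF x(1)] N[OF x(1)] commute[of x "s m"] by (intro exI[of _ "i x"]) auto
    qed
  qed
qed

text \<open>The members of the sequence inside a ball are dense in it, and in a complete space the
  closure of a totally bounded set is compact.\<close>

lemma good_ball_compact:
  assumes "good_ball \<Delta> n k"
  shows "\<exists>K. compactin mtopology K \<and> mball (s n) (1 / real (Suc k)) \<subseteq> K"
proof (intro exI conjI)
  let ?S = "{s m |m. \<Delta> m n < 1 / real (Suc k)}"
  show "compactin mtopology (mtopology closure_of ?S)"
    using assms mtotally_bounded_eq_compact_closure_of[OF complete] by (simp add: good_ball_iff)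
  show "mball (s n) (1 / real (Suc k)) \<subseteq> mtopology closure_of ?S"
  proof
    fix g assume g: "g \<in> mball (s n) (1 / real (Suc k))"
    have "\<exists>y\<in>?S. y \<in> mball g r" if "r > 0" for r
    proof -
      \<comment> \<open>The second bound keeps \<open>s m\<close> inside the ball about
        \<open>s n\<close>.\<close>
      have pos: "min r (1 / real (Suc k) - d g (s n)) > 0"
        using g that by (auto simp: in_mball commute)
      obtain m where m: "d g (s m) < min r (1 / real (Suc k) - d g (s n))"
        using s_near[OF _ pos, of g] g unfolding in_mball by blast
      have "d (s m) (s n) \<le> d g (s m) + d g (s n)"
        using triangle[of "s m" g "s n"] g s_in commute[of g "s m"] by (auto simp: in_mball)
      then have "s m \<in> ?S" using m by auto
      moreover have "s m \<in> mball g r" using m g s_in by (auto simp: in_mball)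
      ultimately show ?thesis by blast
    qed
    then show "g \<in> mtopology closure_of ?S"
      using g by (auto simp: metric_closure_of in_mball)
  qed
qed

text \<open>Local compactness provides a compact neighbourhood; a small ball inside it about a
  nearby \<open>s n\<close> is totally bounded, hence good.\<close>

lemma good_ball_near:
  assumes U: "openin mtopology U" and g: "g \<in> U"
  obtains n k where "good_ball \<Delta> n k" "d g (s n) < 1 / real (Suc k)" "mball (s n) (1 / real (Suc k)) \<subseteq> U"
proof -
  have gM: "g \<in> M" using U g openin_subset by force
  obtain V K where VK: "openin mtopology V" "compactin mtopology K" "g \<in> V" "V \<subseteq> K"
    using locally_compact gM unfolding locally_compact_space_def by auto
  have "openin mtopology (U \<inter> V)" using U VK(1) by blast
  then obtain r where r: "r > 0" "mball g r \<subseteq> U \<inter> V"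
    using g VK(3) by (auto simp: openin_mtopology)
  obtain k where k: "1 / real (Suc k) < r / 2" using nat_approx_posE[of "r / 2"] r(1) by auto
  have "0 < 1 / real (Suc k)" by simp
  then obtain n where n: "d g (s n) < 1 / real (Suc k)" using s_near[OF gM] by blast
  have sub: "mball (s n) (1 / real (Suc k)) \<subseteq> mball g r"
    by (rule mball_subset) (use n k gM commute[of "s n" g] in auto)
  have "mtotally_bounded (mball (s n) (1 / real (Suc k)))"
    by (rule mtotally_bounded_subset[OF compactin_imp_mtotally_bounded[OF VK(2)]])
      (use sub r(2) VK(4) in blast)
  moreover have "{s m |m. \<Delta> m n < 1 / real (Suc k)} \<subseteq> mball (s n) (1 / real (Suc k))"
    using s_in by (auto simp: in_mball commute)
  ultimately have "good_ball \<Delta> n k"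
    unfolding good_ball_iff by (rule mtotally_bounded_subset)
  with n sub r(2) show ?thesis by (intro that) auto
qed

lemma balls_Nil: "balls [] = {}"
  by (simp add: balls_def in_balls_def)

lemma balls_Cons:
  "balls ((n, k) # l) = (if good_ball \<Delta> n k then mball (s n) (1 / real (Suc k)) else {}) \<union> balls l"
  using s_in commute by (auto simp: balls_def in_balls_def in_mball)

lemma openin_balls: "openin mtopology (balls l)"
  by (induction l) (auto simp: balls_Nil balls_Cons split: prod.split)

lemma balls_subset_compact: "\<exists>K. compactin mtopology K \<and> balls l \<subseteq> K"
proof (induction l)
  case Nil
  show ?case by (intro exI[of _ "{}"]) (simp add: balls_Nil)
next
  case (Cons a l)
  obtain n k where a: "a = (n, k)" by (cases a)
  obtain K where K: "compactin mtopology K" "balls l \<subseteq> K" using Cons by blast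
  show ?case
  proof (cases "good_ball \<Delta> n k")
    case True
    then obtain K' where "compactin mtopology K'" "mball (s n) (1 / real (Suc k)) \<subseteq> K'"
      using good_ball_compact by blast
    with K True show ?thesis
      by (intro exI[of _ "K' \<union> K"]) (auto simp: a balls_Cons compactin_Un)
  next
    case False
    with K show ?thesis by (intro exI[of _ K]) (simp add: a balls_Cons)
  qed
qed

text \<open>The list of stage \<open>n\<close> keeps those of the first \<open>n\<close> codes whose
  ball lies in \<open>U\<close>. Codes of balls that are not good may remain, since
  \<open>balls\<close> ignores them. The list depends on \<open>U\<close> and on the fibre.\<close>

lemma open_exhaustion:
  assumes U: "openin mtopology U"
  obtains l where "incseq (\<lambda>n. balls (l n))" "U = (\<Union>n. balls (l n))"
proof -
  let ?P = "\<lambda>a. mball (s (fst a)) (1 / real (Suc (snd a))) \<subseteq> U"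
  define l where "l n = filter ?P (map prod_decode [0..<n])" for n
  have mem: "g \<in> balls (l n) \<longleftrightarrow> (\<exists>i<n. ?P (prod_decode i) \<and> good_ball \<Delta> (fst (prod_decode i)) (snd (prod_decode i))
      \<and> g \<in> mball (s (fst (prod_decode i))) (1 / real (Suc (snd (prod_decode i)))))" for g n
  proof -
    have set: "set (l n) = {a. ?P a \<and> (\<exists>i<n. a = prod_decode i)}"
      by (auto simp: l_def)
    have mb: "g \<in> mball (s a) r \<longleftrightarrow> g \<in> M \<and> d g (s a) < r" for a r
      using s_in commute[of g "s a"] by (auto simp: in_mball)
    have "g \<in> balls (l n) \<longleftrightarrow> g \<in> M \<and>
        (\<exists>a\<in>set (l n). good_ball \<Delta> (fst a) (snd a) \<and> d g (s (fst a)) < 1 / real (Suc (snd a)))"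
      by (simp add: balls_def in_balls_def split_beta)
    then show ?thesis
      unfolding set mb by blast
  qed
  have "incseq (\<lambda>n. balls (l n))"
  proof (intro incseq_SucI subsetI)
    fix n g assume "g \<in> balls (l n)"
    then show "g \<in> balls (l (Suc n))"
      unfolding mem using less_SucI by blast
  qed
  moreover have "U = (\<Union>n. balls (l n))"
  proof (intro equalityI subsetI)
    fix g assume g: "g \<in> U"
    obtain n k where nk: "good_ball \<Delta> n k" "d g (s n) < 1 / real (Suc k)" "mball (s n) (1 / real (Suc k)) \<subseteq> U"
      using good_ball_near[OF U g] .
    have "g \<in> M" using U g openin_subset by force
    then have "g \<in> balls (l (Suc (prod_encode (n, k))))"
      unfolding mem using nk s_in commute[of g "s n"]
      by (intro exI[of _ "prod_encode (n, k)"]) (auto simp: in_mball)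
    then show "g \<in> (\<Union>n. balls (l n))" by blast
  next
    fix g assume "g \<in> (\<Union>n. balls (l n))"
    then show "g \<in> U" by (auto simp: mem)
  qed
  ultimately show ?thesis by (rule that)
qed

lemma sets_\<mu>: "sets \<mu> = sets (borel_of mtopology)"
  using radon by (simp add: radon_measure_def)

lemma space_\<mu>: "space \<mu> = M"
  using sets_eq_imp_space_eq[OF sets_\<mu>] by (simp add: space_borel_of)

lemma open_in_sets: "openin mtopology U \<Longrightarrow> U \<in> sets \<mu>"
  by (simp add: sets_\<mu> sets_borel_of_open)

lemma compact_in_sets:
  assumes "compactin mtopology K"
  shows "K \<in> sets \<mu>"
proof -
  have "closedin mtopology K"
    using assms compactin_imp_closedin_gen Hausdorff_imp_kc_space Hausdorff_space_mtopology by blast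
  then have "openin mtopology (M - K)" "K \<subseteq> M"
    by (auto simp: closedin_def)
  then have "space \<mu> - (M - K) \<in> sets \<mu>"
    by (intro sets.compl_sets open_in_sets)
  then show ?thesis using \<open>K \<subseteq> M\<close> by (simp add: space_\<mu> double_diff)
qed

lemma balls_sets [measurable]: "balls l \<in> sets \<mu>"
  by (rule open_in_sets[OF openin_balls])

lemma compact_finite: "compactin mtopology K \<Longrightarrow> emeasure \<mu> K < \<infinity>"
  using radon by (simp add: radon_measure_def)

lemma balls_finite: "emeasure \<mu> (balls l) < \<infinity>"
proof -
  obtain K where "compactin mtopology K" "balls l \<subseteq> K" using balls_subset_compact by blast
  then show ?thesis
    using emeasure_mono[of "balls l" K \<mu>] compact_in_sets compact_finite by (metis le_less_trans)
qed

lemma continuous_measurable: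
  "continuous_map mtopology euclidean (F :: 'a \<Rightarrow> 'b::topological_space) \<Longrightarrow> F \<in> borel_measurable \<mu>"
  using borel_of_measurable_continuous measurable_cong_sets[OF sets_\<mu> refl] by blast

lemma continuous_cutoff: "continuous_map mtopology euclidean (\<lambda>g. cutoff \<Delta> l j (dists g))"
proof -
  have "continuous_map mtopology euclidean (\<lambda>g. bump \<Delta> l (dists g))"
  proof (induction l)
    case Nil
    then show ?case by (simp add: bump_def)
  next
    case (Cons a l)
    obtain n k where a: "a = (n, k)" by (cases a)
    have "continuous_map mtopology euclidean
        (\<lambda>g. if good_ball \<Delta> n k then max 0 (1 / real (Suc k) - d g (s n)) else 0)"
      by (cases "good_ball \<Delta> n k")
        (auto intro!: continuous_map_real_max continuous_map_diff continuous_map_dist s_in)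
    from continuous_map_add[OF this Cons] show ?case by (simp only: a bump_Cons)
  qed
  then show ?thesis
    unfolding cutoff_def by (intro continuous_map_real_min continuous_map_real_mult) auto
qed

definition cutoff_Cc :: "(nat \<times> nat) list \<Rightarrow> nat \<Rightarrow> 'a \<Rightarrow> complex" where
  "cutoff_Cc l j = restrict (\<lambda>g. complex_of_real (cutoff \<Delta> l j (dists g))) M"

text \<open>The nonzero set lies in finitely many good balls, hence in a compact set; this is closed
  by the Hausdorff property and so contains the closed support.\<close>

lemma cutoff_Cc_in_Cc: "cutoff_Cc l j \<in> Cc mtopology"
  unfolding Cc_def mem_Collect_eq
proof (intro conjI)
  show "cutoff_Cc l j \<in> extensional (topspace mtopology)"
    by (simp add: cutoff_Cc_def)
  have "continuous_map mtopology euclidean (complex_of_real \<circ> (\<lambda>g. cutoff \<Delta> l j (dists g)))"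
    by (rule continuous_map_compose[OF continuous_cutoff]) (simp add: continuous_map_iff_continuous2 continuous_on_of_real)
  then show "continuous_map mtopology euclidean (cutoff_Cc l j)"
    by (rule continuous_map_eq) (simp add: cutoff_Cc_def)
  obtain K where K: "compactin mtopology K" "balls l \<subseteq> K" using balls_subset_compact by blast
  have "in_balls \<Delta> l (dists g)" if "cutoff \<Delta> l j (dists g) \<noteq> 0" for g
    using that cutoff_bounds[of \<Delta> l j "dists g"] by (cases "in_balls \<Delta> l (dists g)") auto
  then have "{g \<in> topspace mtopology. cutoff_Cc l j g \<noteq> 0} \<subseteq> K"
    using K(2) by (auto simp: cutoff_Cc_def balls_def)
  moreover have "closedin mtopology K"
    using K(1) compactin_imp_closedin_gen Hausdorff_imp_kc_space Hausdorff_space_mtopology by blast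
  ultimately have "mtopology closure_of {g \<in> topspace mtopology. cutoff_Cc l j g \<noteq> 0} \<subseteq> K"
    by (intro closure_of_minimal)
  then show "compactin mtopology (mtopology closure_of {g \<in> topspace mtopology. cutoff_Cc l j g \<noteq> 0})"
    by (rule closed_compactin[OF K(1) _ closedin_closure_of])
qed

lemma Cc_bound:
  assumes F: "F \<in> Cc mtopology"
  shows "\<exists>B K. K \<in> sets \<mu> \<and> emeasure \<mu> K < \<infinity> \<and> 0 \<le> B \<and> (\<forall>g\<in>space \<mu>. cmod (F g) \<le> B * indicator K g)"
proof -
  let ?K = "mtopology closure_of {g \<in> topspace mtopology. F g \<noteq> 0}"
  have K: "compactin mtopology ?K" and cont: "continuous_map mtopology euclidean F"
    using F by (auto simp: Cc_def)
  have "compact (F ` ?K)"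
    using image_compactin[OF K cont] by simp
  from compact_imp_bounded[OF this]
  obtain B where "\<forall>z\<in>F ` ?K. cmod z \<le> B"
    unfolding bounded_iff by blast
  then have B: "cmod (F g) \<le> B" if "g \<in> ?K" for g
    using that by simp
  have sub: "{g \<in> topspace mtopology. F g \<noteq> 0} \<subseteq> ?K"
    by (intro closure_of_subset) auto
  have "cmod (F g) \<le> \<bar>B\<bar> * indicator ?K g" if "g \<in> space \<mu>" for g
    using B[of g] sub that by (auto simp: space_\<mu> indicator_def)
  then show ?thesis
    by (intro exI[of _ "\<bar>B\<bar>"] exI[of _ ?K] conjI ballI compact_in_sets compact_finite K) auto
qed

lemma exhaustion:
  obtains l where "incseq (\<lambda>n. balls (l n))" "M = (\<Union>n. balls (l n))"
  using open_exhaustion[OF openin_topspace] by auto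

lemma sigma_finite: "sigma_finite_measure \<mu>"
proof
  obtain l where l: "incseq (\<lambda>n. balls (l n))" "M = (\<Union>n. balls (l n))" by (rule exhaustion)
  show "\<exists>A. countable A \<and> A \<subseteq> sets \<mu> \<and> \<Union> A = space \<mu> \<and> (\<forall>a\<in>A. emeasure \<mu> a \<noteq> \<infinity>)"
  proof (intro exI conjI)
    let ?A = "range (\<lambda>n. balls (l n))"
    show "countable ?A" by simp
    show "?A \<subseteq> sets \<mu>" by auto
    show "\<Union> ?A = space \<mu>" using l by (simp add: space_\<mu>)
    show "\<forall>a\<in>?A. emeasure \<mu> a \<noteq> \<infinity>"
      using balls_finite by (auto simp: less_top)
  qed
qed

text \<open>Vanishing integrals spread from cutoffs to finite unions of good balls, from there to
  open sets, and by Dynkin's theorem to Borel sets. All sets are cut down to a fixed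
  \<open>balls l\<close>, because p-integrability gives an integral of \<open>f\<close> only over
  sets of finite measure.\<close>

theorem cutoffs_separate:
  assumes p: "1 \<le> p" and f: "f \<in> lp_funs p \<mu>"
    and zero: "\<And>l j. (LINT g|\<mu>. f g * cutoff_Cc l j g) = 0"
  shows "AE g in \<mu>. f g = 0"
proof -
  interpret sigma_finite_measure \<mu> by (rule sigma_finite)
  have [measurable]: "f \<in> borel_measurable \<mu>" using f by (simp add: lp_funs_def)
  have int: "integrable \<mu> (\<lambda>g. f g * indicator (balls l) g)" for l
    by (rule lp_pairing_integrable(1)[OF p f _ balls_sets[of l] balls_finite, where B = 1])
      (auto simp: indicator_def)
  \<comment> \<open>Dominated convergence with \<open>f\<close> on \<open>balls l\<close> as
    majorant; it serves the cutoffs, the exhaustion of open sets and the countable disjoint unions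
    alike.\<close>
  have lim: "(\<lambda>n. LINT g|\<mu>. f g * h n g) \<longlonglongrightarrow> (LINT g|\<mu>. f g * k g)"
    if [measurable]: "\<And>n. h n \<in> borel_measurable \<mu>" "k \<in> borel_measurable \<mu>"
      and h: "\<And>g. g \<in> M \<Longrightarrow> (\<lambda>n. h n g) \<longlonglongrightarrow> k g" "\<And>n g. g \<in> M \<Longrightarrow> cmod (h n g) \<le> indicator (balls l) g"
    for h :: "nat \<Rightarrow> 'a \<Rightarrow> complex" and k l
  proof (rule integral_dominated_convergence[where w = "\<lambda>g. cmod (f g * indicator (balls l) g)"])
    show "integrable \<mu> (\<lambda>g. cmod (f g * indicator (balls l) g))"
      using int by simp
    show "AE g in \<mu>. (\<lambda>n. f g * h n g) \<longlonglongrightarrow> f g * k g"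
      using h(1) by (intro AE_I2 tendsto_mult tendsto_const) (simp add: space_\<mu>)
    show "AE g in \<mu>. cmod (f g * h n g) \<le> cmod (f g * indicator (balls l) g)" for n
    proof (rule AE_I2)
      fix g assume "g \<in> space \<mu>"
      then have "cmod (h n g) \<le> cmod (indicator (balls l) g)"
        using h(2)[of g n] by (cases "g \<in> balls l") (simp_all add: space_\<mu>)
      then show "cmod (f g * h n g) \<le> cmod (f g * indicator (balls l) g)"
        unfolding norm_mult by (intro mult_left_mono) auto
    qed
  qed measurable
  have balls0: "(LINT g|\<mu>. f g * indicator (balls l) g) = 0" for l
  proof -
    have "(\<lambda>j. LINT g|\<mu>. f g * cutoff_Cc l j g) \<longlonglongrightarrow> (LINT g|\<mu>. f g * indicator (balls l) g)"
    proof (rule lim)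
      show "cutoff_Cc l j \<in> borel_measurable \<mu>" for j
        using cutoff_Cc_in_Cc by (intro continuous_measurable) (auto simp: Cc_def)
      fix g assume g: "g \<in> M"
      have ind: "indicator (balls l) g = (of_bool (in_balls \<Delta> l (dists g)) :: 'c::zero_neq_one)"
        using g by (simp add: balls_def indicator_def)
      show "(\<lambda>j. cutoff_Cc l j g) \<longlonglongrightarrow> indicator (balls l) g"
        using g tendsto_of_real[OF cutoff_tendsto[of \<Delta> l "dists g"], where 'a = complex]
        by (cases "in_balls \<Delta> l (dists g)") (simp_all add: cutoff_Cc_def balls_def)
      show "cmod (cutoff_Cc l j g) \<le> indicator (balls l) g" for j
        using g cutoff_bounds[of \<Delta> l j "dists g"] by (simp add: cutoff_Cc_def balls_def indicator_def)
    qed simp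
    then show ?thesis by (simp add: zero LIMSEQ_const_iff)
  qed
  have "AE g in \<mu>. f g * indicator (balls l) g = 0" for l
  proof (rule density_zero[OF int])
    fix A assume "A \<in> sets \<mu>"
    have openset: "(LINT g|\<mu>. f g * indicator (U \<inter> balls l) g) = 0" if "openin mtopology U" for U
    proof -
      have "openin mtopology (U \<inter> balls l)" using that openin_balls by blast
      then obtain l' where l': "incseq (\<lambda>n. balls (l' n))" "U \<inter> balls l = (\<Union>n. balls (l' n))"
        by (rule open_exhaustion)
      have U: "U \<in> sets \<mu>" by (rule open_in_sets[OF that])
      have "(\<lambda>n. LINT g|\<mu>. f g * indicator (balls (l' n)) g) \<longlonglongrightarrow> (LINT g|\<mu>. f g * indicator (U \<inter> balls l) g)"
      proof (rule lim)
        show "(\<lambda>n. indicator (balls (l' n)) g :: complex) \<longlonglongrightarrow> indicator (U \<inter> balls l) g" for g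
          unfolding l'(2) by (rule LIMSEQ_indicator_incseq[OF l'(1)])
        show "cmod (indicator (balls (l' n)) g) \<le> indicator (balls l) g" for n g
          using l'(2) by (auto simp: indicator_def)
      qed (use U in auto)
      then show ?thesis by (simp add: balls0 LIMSEQ_const_iff)
    qed
    have sub: "{U. openin mtopology U} \<subseteq> Pow M"
      using openin_subset[of mtopology] by auto
    have stable: "Int_stable {U. openin mtopology U}" by (auto simp: Int_stable_def)
    have "A \<in> sigma_sets M {U. openin mtopology U}"
      using \<open>A \<in> sets \<mu>\<close> sub by (simp add: sets_\<mu> borel_of_def)
    with stable sub have "A \<in> sets \<mu> \<and> (LINT g|\<mu>. f g * indicator (A \<inter> balls l) g) = 0"
    proof (induction rule: sigma_sets_induct_disjoint)
      case (basic A)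
      then show ?case using openset open_in_sets by auto
    next
      case empty
      then show ?case by simp
    next
      case (compl A)
      then have [measurable]: "A \<in> sets \<mu>" by simp
      have intA: "integrable \<mu> (\<lambda>g. f g * indicator (A \<inter> balls l) g)"
        by (rule lp_pairing_integrable(1)[OF p f _ balls_sets[of l] balls_finite, where B = 1])
          (auto simp: indicator_def)
      have "(LINT g|\<mu>. f g * indicator ((M - A) \<inter> balls l) g) =
          (LINT g|\<mu>. f g * indicator (balls l) g - f g * indicator (A \<inter> balls l) g)"
        by (intro Bochner_Integration.integral_cong) (auto simp: indicator_def space_\<mu>)
      also have "\<dots> = 0"
        using int intA compl by (simp add: balls0)
      finally show ?case
        using sets.compl_sets[of A \<mu>] by (simp add: space_\<mu>)
    next
      case (union A)
      then have [measurable]: "A i \<in> sets \<mu>" for i by blast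
      have partial: "(LINT g|\<mu>. f g * indicator ((\<Union>i<n. A i) \<inter> balls l) g) = 0" for n
      proof -
        have intA: "integrable \<mu> (\<lambda>g. f g * indicator (A i \<inter> balls l) g)" for i
          by (rule lp_pairing_integrable(1)[OF p f _ balls_sets[of l] balls_finite, where B = 1])
            (auto simp: indicator_def)
        have disj: "disjoint_family_on A {..<n}"
          using union(1) by (rule disjoint_family_on_mono[rotated]) simp
        have "(indicator ((\<Union>i<n. A i) \<inter> balls l) g :: complex) = (\<Sum>i<n. indicator (A i \<inter> balls l) g)" for g
          by (simp only: indicator_inter_arith indicator_UN_disjoint[OF finite_lessThan disj] sum_distrib_right)
        then have "(LINT g|\<mu>. f g * indicator ((\<Union>i<n. A i) \<inter> balls l) g) =
            (LINT g|\<mu>. (\<Sum>i<n. f g * indicator (A i \<inter> balls l) g))"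
          by (simp only: sum_distrib_left)
        also have "\<dots> = 0"
          by (subst Bochner_Integration.integral_sum) (use intA union in simp_all)
        finally show ?thesis .
      qed
      have "(\<lambda>n. LINT g|\<mu>. f g * indicator ((\<Union>i<n. A i) \<inter> balls l) g) \<longlonglongrightarrow>
          (LINT g|\<mu>. f g * indicator ((\<Union>i. A i) \<inter> balls l) g)"
      proof (rule lim)
        fix g
        have "(\<lambda>n. indicator (\<Union>i<n. A i) g :: complex) \<longlonglongrightarrow> indicator (\<Union>i. A i) g"
          by (rule LIMSEQ_indicator_UN)
        then show "(\<lambda>n. indicator ((\<Union>i<n. A i) \<inter> balls l) g :: complex) \<longlonglongrightarrow> indicator ((\<Union>i. A i) \<inter> balls l) g"
          unfolding indicator_inter_arith by (intro tendsto_mult tendsto_const)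
        show "cmod (indicator ((\<Union>i<n. A i) \<inter> balls l) g) \<le> indicator (balls l) g" for n
          by (auto simp: indicator_def)
      qed measurable
      then have "(LINT g|\<mu>. f g * indicator ((\<Union>i. A i) \<inter> balls l) g) = 0"
        by (simp add: partial LIMSEQ_const_iff)
      then show ?case by auto
    qed
    moreover have "(LINT g|\<mu>. f g * indicator (A \<inter> balls l) g) = set_lebesgue_integral \<mu> A (\<lambda>g. f g * indicator (balls l) g)"
      unfolding set_lebesgue_integral_def
      by (intro Bochner_Integration.integral_cong) (auto simp: indicator_def)
    ultimately show "set_lebesgue_integral \<mu> A (\<lambda>g. f g * indicator (balls l) g) = 0"
      by simp
  qed
  \<comment> \<open>Lists of codes are countable, so one null set works for all
    \<open>l\<close>.\<close>
  then have ae: "AE g in \<mu>. \<forall>l. f g * indicator (balls l) g = 0"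
    by (subst AE_all_countable) auto
  obtain l where l: "incseq (\<lambda>n. balls (l n))" "M = (\<Union>n. balls (l n))" by (rule exhaustion)
  from ae show ?thesis
  proof (rule AE_mp, intro AE_I2 impI)
    fix g assume "g \<in> space \<mu>" and z: "\<forall>l. f g * indicator (balls l) g = 0"
    then obtain n where "g \<in> balls (l n)" using l by (auto simp: space_\<mu>)
    with z[rule_format, of "l n"] show "f g = 0" by simp
  qed
qed

end

section \<open>Density of the rational step functions in a fibre\<close>

context radon_fibre
begin

abbreviation step :: "((rat \<times> rat) \<times> (nat \<times> nat) list) list \<Rightarrow> 'a \<Rightarrow> complex" where
  "step c g \<equiv> rational_step \<Delta> c (dists g)"

lemma step_Cons: "g \<in> M \<Longrightarrow> step ((q, l) # c) g = rat_complex q * indicator (balls l) g + step c g"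
  by (simp add: rational_step_def balls_def indicator_def)

lemma step_lp_funs:
  assumes "1 \<le> p"
  shows "step c \<in> lp_funs p \<mu>"
proof (induction c)
  case Nil
  then show ?case by (simp add: rational_step_def lp_funs_zero)
next
  case (Cons a c)
  obtain q l where a: "a = (q, l)" by (cases a)
  have "(\<lambda>g. rat_complex q * indicator (balls l) g + step c g) \<in> lp_funs p \<mu>"
    using assms by (intro lp_funs_add lp_funs_indicator Cons balls_sets balls_finite) auto
  then show ?case
    by (subst lp_funs_cong[where h = "\<lambda>g. rat_complex q * indicator (balls l) g + step c g"])
      (auto simp: a step_Cons space_\<mu>)
qed

lemma lp_norm_indicator_diff:
  assumes p: "1 \<le> p" and A: "A \<in> sets \<mu>" "emeasure \<mu> A < \<infinity>"
    and B: "B \<in> sets \<mu>" "emeasure \<mu> B < \<infinity>"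
    and c: "0 \<le> c" "measure \<mu> (A - B) + measure \<mu> (B - A) \<le> c powr p"
  shows "lp_norm p \<mu> (\<lambda>g. indicator A g - indicator B g) \<le> c"
proof (rule lp_norm_le[OF p c(1)])
  have fin: "emeasure \<mu> (A - B) < \<infinity>" "emeasure \<mu> (B - A) < \<infinity>"
    using A B by (auto intro: le_less_trans[OF emeasure_mono])
  have "(LINT g|\<mu>. cmod (indicator A g - indicator B g) powr p)
      = (LINT g|\<mu>. indicator (A - B) g + indicator (B - A) g)"
    using p by (intro Bochner_Integration.integral_cong) (auto simp: indicator_def)
  also have "\<dots> = measure \<mu> (A - B) + measure \<mu> (B - A)"
    using A B fin by (subst Bochner_Integration.integral_add) (auto simp: integrable_indicator_iff)
  finally show "(LINT g|\<mu>. cmod (indicator A g - indicator B g) powr p) \<le> c powr p"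
    using c(2) by simp
qed

text \<open>Outer regularity and the exhaustion of open sets by finite unions of good balls.\<close>

lemma balls_approximate:
  assumes p: "1 \<le> p" and A: "A \<in> sets \<mu>" "emeasure \<mu> A < \<infinity>" and e: "e > 0"
  obtains l where "lp_norm p \<mu> (\<lambda>g. indicator A g - indicator (balls l) g) \<le> e"
proof -
  \<comment> \<open>Half of \<open>e powr p\<close> for each side of the symmetric
    difference.\<close>
  define \<eta> where "\<eta> = e powr p / 2"
  have \<eta>: "\<eta> > 0" using e by (simp add: \<eta>_def)
  have "emeasure \<mu> A = (INF U\<in>{U. openin mtopology U \<and> A \<subseteq> U}. emeasure \<mu> U)"
    using radon A(1) by (simp add: radon_measure_def)
  moreover have "emeasure \<mu> A < emeasure \<mu> A + ennreal \<eta>"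
    using A(2) \<eta> by (cases "emeasure \<mu> A") (auto simp: ennreal_plus[symmetric] ennreal_less_iff simp del: ennreal_plus)
  ultimately have "(INF U\<in>{U. openin mtopology U \<and> A \<subseteq> U}. emeasure \<mu> U) < emeasure \<mu> A + ennreal \<eta>"
    by simp
  then obtain U where U: "openin mtopology U" "A \<subseteq> U" "emeasure \<mu> U < emeasure \<mu> A + ennreal \<eta>"
    by (auto simp: INF_less_iff)
  have U_sets: "U \<in> sets \<mu>" by (rule open_in_sets[OF U(1)])
  have U_fin: "emeasure \<mu> U < \<infinity>"
    using U(3) A(2) by (auto intro: less_le_trans)
  have "ennreal (measure \<mu> U) < ennreal (measure \<mu> A + \<eta>)"
    using U(3) A(2) U_fin \<eta>
    by (simp add: emeasure_eq_ennreal_measure less_top[symmetric] ennreal_plus)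
  then have mU: "measure \<mu> U < measure \<mu> A + \<eta>"
    using \<eta> by (simp add: ennreal_less_iff del: ennreal_plus)
  obtain l where l: "incseq (\<lambda>n. balls (l n))" "U = (\<Union>n. balls (l n))"
    by (rule open_exhaustion[OF U(1)])
  have "(\<lambda>n. measure \<mu> (balls (l n))) \<longlonglongrightarrow> measure \<mu> (\<Union>n. balls (l n))"
    using U_fin l by (intro Lim_measure_incseq) auto
  then have "(\<lambda>n. measure \<mu> (balls (l n))) \<longlonglongrightarrow> measure \<mu> U"
    by (simp only: l(2))
  then have "\<forall>\<^sub>F n in sequentially. measure \<mu> U - \<eta> < measure \<mu> (balls (l n))"
    using \<eta> by (intro order_tendstoD(1)) auto
  then obtain n where n: "measure \<mu> U - \<eta> < measure \<mu> (balls (l n))"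
    by (auto simp: eventually_sequentially)
  have sub: "balls (l n) \<subseteq> U" using l(2) by blast
  have fm: "A \<in> fmeasurable \<mu>" "U \<in> fmeasurable \<mu>" "balls (l n) \<in> fmeasurable \<mu>"
    using A U_fin U_sets balls_finite by (auto simp: fmeasurable_def)
  have "measure \<mu> (A - balls (l n)) \<le> measure \<mu> (U - balls (l n))"
    using U(2) fm by (intro measure_mono_fmeasurable fmeasurable.Diff) (auto simp: fmeasurable_def)
  also have "\<dots> = measure \<mu> U - measure \<mu> (balls (l n))"
    using sub fm U_sets U_fin by (intro measure_Diff) auto
  finally have 1: "measure \<mu> (A - balls (l n)) \<le> \<eta>" using n by simp
  have "measure \<mu> (balls (l n) - A) \<le> measure \<mu> (U - A)"
    using sub fm by (intro measure_mono_fmeasurable fmeasurable.Diff) (auto simp: fmeasurable_def)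
  also have "\<dots> = measure \<mu> U - measure \<mu> A"
    using U(2) fm U_sets U_fin A(1) by (intro measure_Diff) auto
  finally have 2: "measure \<mu> (balls (l n) - A) \<le> \<eta>" using mU by simp
  show ?thesis
    by (rule that[of "l n"], rule lp_norm_indicator_diff[OF p A balls_sets balls_finite])
      (use 1 2 e in \<open>auto simp: \<eta>_def\<close>)
qed

definition approximable :: "real \<Rightarrow> ('a \<Rightarrow> complex) \<Rightarrow> bool" where
  "approximable p f \<longleftrightarrow> f \<in> lp_funs p \<mu> \<and> (\<forall>e>0. \<exists>c. lp_norm p \<mu> (\<lambda>g. f g - step c g) < e)"

lemma approximable_indicator:
  assumes p: "1 \<le> p" and A: "A \<in> sets \<mu>" "emeasure \<mu> A < \<infinity>"
  shows "approximable p (\<lambda>g. z * indicator A g)"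
  unfolding approximable_def
proof (intro conjI allI impI)
  show "(\<lambda>g. z * indicator A g) \<in> lp_funs p \<mu>"
    by (rule lp_funs_indicator[OF A p])
  fix e :: real assume e: "e > 0"
  let ?N = "lp_norm p \<mu> (indicator A)"
  have N: "?N + 1 > 0" using lp_norm_nonneg[of p \<mu> "indicator A"] by linarith
  \<comment> \<open>Two errors of size e / 2: replacing the coefficient \<open>z\<close> by
    \<open>rat_complex q\<close>, and below replacing \<open>A\<close> by \<open>balls l\<close>.
    The summands 1 in the denominators avoid division by zero.\<close>
  obtain q where q: "cmod (z - rat_complex q) < e / 2 / (?N + 1)"
    using rat_complex_dense[of "e / 2 / (?N + 1)" z] e N by auto
  let ?q = "cmod (rat_complex q) + 1"
  have q1: "?q > 0" by (rule add_nonneg_pos) auto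
  obtain l where l: "lp_norm p \<mu> (\<lambda>g. indicator A g - indicator (balls l) g) \<le> e / 2 / ?q"
    using balls_approximate[OF p A, of "e / 2 / ?q"] e q1 by auto
  have lp1: "indicator A \<in> lp_funs p \<mu>" "indicator (balls l) \<in> lp_funs p \<mu>"
    using lp_funs_indicator[OF A p, of 1] lp_funs_indicator[OF balls_sets balls_finite p, of 1 l] by simp_all
  have lp2: "(\<lambda>g. indicator A g - indicator (balls l) g) \<in> lp_funs p \<mu>"
    using p lp1 by (intro lp_funs_minus) auto
  have "lp_norm p \<mu> (\<lambda>g. z * indicator A g - step [(q, l)] g) =
      lp_norm p \<mu> (\<lambda>g. (z - rat_complex q) * indicator A g + rat_complex q * (indicator A g - indicator (balls l) g))"
    by (rule lp_norm_cong) (simp add: space_\<mu> rational_step_def balls_def indicator_def algebra_simps)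
  also have "\<dots> \<le> lp_norm p \<mu> (\<lambda>g. (z - rat_complex q) * indicator A g)
      + lp_norm p \<mu> (\<lambda>g. rat_complex q * (indicator A g - indicator (balls l) g))"
    by (intro lp_norm_triangle p lp_funs_scale lp1 lp2)
  also have "\<dots> = cmod (z - rat_complex q) * ?N
      + cmod (rat_complex q) * lp_norm p \<mu> (\<lambda>g. indicator A g - indicator (balls l) g)"
    by (simp add: lp_norm_scale[OF p])
  also have "\<dots> < e / 2 + e / 2"
  proof (rule add_less_le_mono)
    have "cmod (z - rat_complex q) * ?N \<le> cmod (z - rat_complex q) * (?N + 1)"
      by (intro mult_left_mono) auto
    also have "\<dots> < e / 2" using q by (simp only: pos_less_divide_eq[OF N])
    finally show "cmod (z - rat_complex q) * ?N < e / 2" .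
    have "cmod (rat_complex q) * lp_norm p \<mu> (\<lambda>g. indicator A g - indicator (balls l) g)
        \<le> ?q * lp_norm p \<mu> (\<lambda>g. indicator A g - indicator (balls l) g)"
      by (intro mult_right_mono lp_norm_nonneg) auto
    also have "\<dots> \<le> e / 2" using l unfolding pos_le_divide_eq[OF q1] by (simp only: mult.commute)
    finally show "cmod (rat_complex q) * lp_norm p \<mu> (\<lambda>g. indicator A g - indicator (balls l) g) \<le> e / 2" .
  qed
  finally show "\<exists>c. lp_norm p \<mu> (\<lambda>g. z * indicator A g - step c g) < e"
    by (intro exI[of _ "[(q, l)]"]) simp
qed

lemma approximable_add:
  assumes p: "1 \<le> p" and "approximable p f" "approximable p h"
  shows "approximable p (\<lambda>g. f g + h g)"
  unfolding approximable_def
proof (intro conjI allI impI)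
  have f: "f \<in> lp_funs p \<mu>" and h: "h \<in> lp_funs p \<mu>"
    using assms by (auto simp: approximable_def)
  show "(\<lambda>g. f g + h g) \<in> lp_funs p \<mu>"
    using p f h by (intro lp_funs_add) auto
  fix e :: real assume "e > 0"
  then obtain c c' where c: "lp_norm p \<mu> (\<lambda>g. f g - step c g) < e / 2"
    "lp_norm p \<mu> (\<lambda>g. h g - step c' g) < e / 2"
    using assms unfolding approximable_def by (meson half_gt_zero)
  have "lp_norm p \<mu> (\<lambda>g. f g + h g - step (c @ c') g) =
      lp_norm p \<mu> (\<lambda>g. (f g - step c g) + (h g - step c' g))"
    by (simp add: rational_step_append algebra_simps)
  also have "\<dots> \<le> lp_norm p \<mu> (\<lambda>g. f g - step c g) + lp_norm p \<mu> (\<lambda>g. h g - step c' g)"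
    using p f h by (intro lp_norm_triangle lp_funs_minus step_lp_funs) auto
  also have "\<dots> < e" using c by linarith
  finally show "\<exists>c. lp_norm p \<mu> (\<lambda>g. f g + h g - step c g) < e" by blast
qed

lemma approximable_sum:
  assumes p: "1 \<le> p" and "finite Y" "\<And>y. y \<in> Y \<Longrightarrow> approximable p (h y)"
  shows "approximable p (\<lambda>g. \<Sum>y\<in>Y. h y g)"
  using assms(2,3)
proof (induction Y rule: finite_induct)
  case empty
  show ?case using approximable_indicator[OF p, of "{}" 0] by simp
next
  case (insert x F)
  then show ?case using approximable_add[OF p, of "h x" "\<lambda>g. \<Sum>y\<in>F. h y g"] by simp
qed

lemma approximable_cong:
  assumes "\<And>g. g \<in> M \<Longrightarrow> f g = h g"
  shows "approximable p f \<longleftrightarrow> approximable p h"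
proof -
  have "lp_norm p \<mu> (\<lambda>g. f g - step c g) = lp_norm p \<mu> (\<lambda>g. h g - step c g)" for c
    by (rule lp_norm_cong) (simp add: space_\<mu> assms)
  moreover have "f \<in> lp_funs p \<mu> \<longleftrightarrow> h \<in> lp_funs p \<mu>"
    by (rule lp_funs_cong) (simp add: space_\<mu> assms)
  ultimately show ?thesis by (simp add: approximable_def)
qed

text \<open>A nonzero level set has finite measure by Chebyshev's inequality, so \<open>f\<close> is
  a finite sum of approximable multiples of indicators; level 0 contributes nothing.\<close>

lemma approximable_simple:
  assumes p: "1 \<le> p" and f: "simple_function \<mu> f" "f \<in> lp_funs p \<mu>"
  shows "approximable p f"
proof -
  let ?A = "\<lambda>y. f -` {y} \<inter> space \<mu>"
  have int: "integrable \<mu> (\<lambda>g. cmod (f g) powr p)"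
    using f(2) by (simp add: lp_funs_def)
  have "approximable p (\<lambda>g. y * indicator (?A y) g)" if "y \<in> f ` space \<mu>" for y
  proof (cases "y = 0")
    case True
    then show ?thesis using approximable_indicator[OF p, of "{}" 0] by simp
  next
    case False
    have A: "?A y \<in> sets \<mu>" by (rule simple_functionD(2)[OF f(1)])
    have "ennreal (cmod y powr p) * emeasure \<mu> (?A y) = (\<integral>\<^sup>+ g. ennreal (cmod y powr p) * indicator (?A y) g \<partial>\<mu>)"
      by (rule nn_integral_cmult_indicator[OF A, symmetric])
    also have "\<dots> \<le> (\<integral>\<^sup>+ g. ennreal (cmod (f g) powr p) \<partial>\<mu>)"
      by (intro nn_integral_mono) (auto simp: indicator_def)
    also have "\<dots> < \<infinity>"
      using nn_integral_lp[OF p f(2)] by simp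
    finally have "emeasure \<mu> (?A y) < \<infinity>"
      using False by (auto simp: ennreal_mult_less_top)
    from approximable_indicator[OF p A this] show ?thesis .
  qed
  then have "approximable p (\<lambda>g. \<Sum>y\<in>f ` space \<mu>. y * indicator (?A y) g)"
    by (intro approximable_sum[OF p] simple_functionD(1)[OF f(1)])
  moreover have eq: "f g = (\<Sum>y\<in>f ` space \<mu>. y * indicator (?A y) g)" if "g \<in> M" for g
  proof -
    have "g \<in> space \<mu>" using that by (simp add: space_\<mu>)
    then have "f g = (\<Sum>y\<in>f ` space \<mu>. indicator (?A y) g *\<^sub>R y)"
      by (rule simple_function_indicator_representation_banach[OF f(1)])
    also have "\<dots> = (\<Sum>y\<in>f ` space \<mu>. y * indicator (?A y) g)"
      by (intro sum.cong) (auto simp: indicator_def)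
    finally show ?thesis .
  qed
  ultimately show ?thesis
    using iffD2[OF approximable_cong[OF eq]] by simp
qed

theorem steps_dense:
  assumes p: "1 \<le> p" and f: "f \<in> lp_funs p \<mu>" and e: "e > 0"
  obtains c where "lp_norm p \<mu> (\<lambda>g. f g - step c g) < e"
proof -
  have [measurable]: "f \<in> borel_measurable \<mu>" and int: "integrable \<mu> (\<lambda>g. cmod (f g) powr p)"
    using f by (auto simp: lp_funs_def)
  obtain F where "\<forall>i. simple_function \<mu> (F i)" "\<forall>g\<in>space \<mu>. (\<lambda>i. F i g) \<longlonglongrightarrow> f g"
    "\<forall>i. \<forall>g\<in>space \<mu>. dist (F i g) 0 \<le> 2 * dist (f g) 0"
    using borel_measurable_implies_sequence_metric[of f \<mu> 0] by auto
  then have F: "\<And>i. simple_function \<mu> (F i)" "\<And>g. g \<in> space \<mu> \<Longrightarrow> (\<lambda>i. F i g) \<longlonglongrightarrow> f g"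
    "\<And>i g. g \<in> space \<mu> \<Longrightarrow> cmod (F i g) \<le> 2 * cmod (f g)"
    by simp_all
  have [measurable]: "F i \<in> borel_measurable \<mu>" for i
    by (rule borel_measurable_simple_function[OF F(1)])
  \<comment> \<open>The approximants satisfy \<open>cmod (F i g) \<le> 2 * cmod (f g)\<close>,
    whence the factor 3 and an integrable majorant.\<close>
  have le: "cmod (f g - F i g) powr p \<le> 3 powr p * cmod (f g) powr p" if "g \<in> space \<mu>" for i g
  proof -
    have "cmod (f g - F i g) \<le> 3 * cmod (f g)"
      using norm_triangle_ineq4[of "f g" "F i g"] F(3)[OF that, of i] by linarith
    then have "cmod (f g - F i g) powr p \<le> (3 * cmod (f g)) powr p"
      using p by (intro powr_mono2) auto
    then show ?thesis by (simp add: powr_mult)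
  qed
  have "(\<lambda>i. LINT g|\<mu>. cmod (f g - F i g) powr p) \<longlonglongrightarrow> (LINT g|\<mu>. 0)"
  proof (rule integral_dominated_convergence[where w = "\<lambda>g. 3 powr p * cmod (f g) powr p"])
    show "AE g in \<mu>. (\<lambda>i. cmod (f g - F i g) powr p) \<longlonglongrightarrow> 0"
    proof (rule AE_I2)
      fix g assume "g \<in> space \<mu>"
      have "(\<lambda>i. cmod (f g - F i g) powr p) \<longlonglongrightarrow> cmod (f g - f g) powr p"
        using p by (intro tendsto_powr' tendsto_intros F(2)[OF \<open>g \<in> space \<mu>\<close>]) auto
      then show "(\<lambda>i. cmod (f g - F i g) powr p) \<longlonglongrightarrow> 0" by simp
    qed
    show "AE g in \<mu>. norm (cmod (f g - F i g) powr p) \<le> 3 powr p * cmod (f g) powr p" for i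
      using le by (intro AE_I2) simp
  qed (use int in simp_all)
  then have "(\<lambda>i. LINT g|\<mu>. cmod (f g - F i g) powr p) \<longlonglongrightarrow> 0" by simp
  then have "\<forall>\<^sub>F i in sequentially. (LINT g|\<mu>. cmod (f g - F i g) powr p) < (e / 3) powr p"
    using e by (intro order_tendstoD(2)) auto
  then obtain i where i: "(LINT g|\<mu>. cmod (f g - F i g) powr p) < (e / 3) powr p"
    by (auto simp: eventually_sequentially)
  have norm_i: "lp_norm p \<mu> (\<lambda>g. f g - F i g) \<le> e / 3"
    using i e p by (intro lp_norm_le) auto
  have "integrable \<mu> (\<lambda>g. cmod (f g - F i g) powr p)"
    by (rule Bochner_Integration.integrable_bound[where f = "\<lambda>g. 3 powr p * cmod (f g) powr p"])
      (use le int in auto)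
  then have d: "(\<lambda>g. f g - F i g) \<in> lp_funs p \<mu>"
    by (simp add: lp_funs_def)
  then have Fi: "F i \<in> lp_funs p \<mu>"
    using lp_funs_minus[OF _ f d] p by simp
  obtain c where c: "lp_norm p \<mu> (\<lambda>g. F i g - step c g) < e / 3"
    using approximable_simple[OF p F(1) Fi] e unfolding approximable_def by (meson divide_pos_pos zero_less_numeral)
  have "lp_norm p \<mu> (\<lambda>g. f g - step c g) \<le> lp_norm p \<mu> (\<lambda>g. f g - F i g) + lp_norm p \<mu> (\<lambda>g. F i g - step c g)"
    using p f Fi by (intro lp_norm_triangle3 step_lp_funs) auto
  also have "\<dots> < e" using norm_i c e by linarith
  finally show ?thesis by (rule that)
qed

end

section \<open>Fibre products\<close>

lemma measurable_fibre_prod: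
  assumes "f \<in> N \<rightarrow>\<^sub>M M1" "g \<in> N \<rightarrow>\<^sub>M M2" "\<And>w. w \<in> space N \<Longrightarrow> fst (f w) = fst (g w)"
  shows "(\<lambda>w. (f w, g w)) \<in> N \<rightarrow>\<^sub>M fibre_prod M1 M2"
  unfolding fibre_prod_def
  using assms by (intro measurable_restrict_space2) auto

lemma measurable_fibre_prod_fst: "fst \<in> fibre_prod M1 M2 \<rightarrow>\<^sub>M M1"
  and measurable_fibre_prod_snd: "snd \<in> fibre_prod M1 M2 \<rightarrow>\<^sub>M M2"
  unfolding fibre_prod_def by (intro measurable_restrict_space1 measurable_fst measurable_snd)+

lemma space_fibre_prod:
  "w \<in> space (fibre_prod M1 M2) \<longleftrightarrow> fst w \<in> space M1 \<and> snd w \<in> space M2 \<and> fst (fst w) = fst (snd w)"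
  by (auto simp: fibre_prod_def space_restrict_space space_pair_measure mem_Times_iff)

text \<open>Blackwell's theorem as a criterion for maps into a standard Borel space: every
  measurable set of \<open>M\<close> is a preimage under the injective code \<open>k\<close>, so
  only the composite with \<open>k\<close> has to be checked.\<close>

lemma measurable_by_injective_key:
  fixes k :: "'a \<Rightarrow> nat \<Rightarrow> real"
  assumes "standard_borel M" "k \<in> borel_measurable M" "inj_on k (space M)"
    and f: "f \<in> space N \<rightarrow> space M" "(\<lambda>w. k (f w)) \<in> borel_measurable N"
  shows "f \<in> N \<rightarrow>\<^sub>M M"
proof (rule measurableI)
  fix A assume "A \<in> sets M"
  obtain B where "B \<in> sets borel" "A = k -` B \<inter> space M"
    by (rule standard_borel_generated[OF assms(1-3) \<open>A \<in> sets M\<close>])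
  moreover from this have "f -` A \<inter> space N = (\<lambda>w. k (f w)) -` B \<inter> space N"
    using f(1) by auto
  ultimately show "f -` A \<inter> space N \<in> sets N"
    using measurable_sets[OF f(2)] by simp
qed (use f(1) in auto)

context radon_fibre
begin

text \<open>In contrast to \<open>open_exhaustion\<close>, the lists are the same in all fibres, so
  that these balls assemble to Borel sets in the total space.\<close>

lemma uniform_exhaustion:
  "incseq (\<lambda>n. balls (map prod_decode [0..<n]))" "(\<Union>n. balls (map prod_decode [0..<n])) = M"
proof -
  have set: "set (map prod_decode [0..<n]) = prod_decode ` {..<n}" for n
    by auto
  show "incseq (\<lambda>n. balls (map prod_decode [0..<n]))"
    unfolding incseq_def balls_def in_balls_def set by fastforce
  show "(\<Union>n. balls (map prod_decode [0..<n])) = M"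
  proof (intro equalityI subsetI)
    fix g assume "g \<in> M"
    then have "g \<in> topspace mtopology" by simp
    then obtain n k where nk: "good_ball \<Delta> n k" "d g (s n) < 1 / real (Suc k)"
      by (rule good_ball_near[OF openin_topspace])
    have "(n, k) \<in> set (map prod_decode [0..<Suc (prod_encode (n, k))])"
      unfolding set by (intro image_eqI[of _ _ "prod_encode (n, k)"]) auto
    then have "g \<in> balls (map prod_decode [0..<Suc (prod_encode (n, k))])"
      unfolding balls_def in_balls_def using nk \<open>g \<in> M\<close> by blast
    then show "g \<in> (\<Union>n. balls (map prod_decode [0..<n]))" by blast
  qed (auto simp: balls_def)
qed

end

section \<open>Borel fields of locally compact Polish spaces with Radon measures\<close>

text \<open>\<open>d\<close> and \<open>s\<close> are witnesses of the existential clauses in the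
  definition of a field of Polish spaces; once fixed, every ball, cutoff and step function is a
  definite Borel function of the base point.\<close>

locale radon_field =
  fixes X :: "'x measure" and T :: "'x \<Rightarrow> 'g topology" and GM :: "('x \<times> 'g) measure"
    and \<mu> :: "'x \<Rightarrow> 'g measure" and d :: "('x \<times> 'g) \<times> ('x \<times> 'g) \<Rightarrow> real" and s :: "nat \<Rightarrow> 'x \<Rightarrow> 'g"
  assumes X: "standard_borel X" and GM: "standard_borel GM"
    and space_GM: "space GM = Sigma (space X) (\<lambda>x. topspace (T x))"
    and fst_GM: "fst \<in> GM \<rightarrow>\<^sub>M X"
    and d_measurable: "d \<in> borel_measurable (fibre_prod GM GM)"
    and metric: "x \<in> space X \<Longrightarrow> Metric_space (topspace (T x)) (\<lambda>u v. d ((x, u), (x, v)))"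
    and complete: "x \<in> space X \<Longrightarrow> Metric_space.mcomplete (topspace (T x)) (\<lambda>u v. d ((x, u), (x, v)))"
    and topology: "x \<in> space X \<Longrightarrow> Metric_space.mtopology (topspace (T x)) (\<lambda>u v. d ((x, u), (x, v))) = T x"
    and s_measurable: "(\<lambda>x. (x, s n x)) \<in> X \<rightarrow>\<^sub>M GM"
    and s_dense: "x \<in> space X \<Longrightarrow> T x closure_of range (\<lambda>n. s n x) = topspace (T x)"
    and locally_compact: "x \<in> space X \<Longrightarrow> locally_compact_space (T x)"
    and radon: "x \<in> space X \<Longrightarrow> radon_measure (T x) (\<mu> x)"
    and integral_measurable: "F \<in> borel_measurable GM \<Longrightarrow> (\<lambda>x. \<integral>\<^sup>+ g. F (x, g) \<partial>\<mu> x) \<in> borel_measurable X"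
begin

abbreviation dist_at :: "'x \<Rightarrow> 'g \<Rightarrow> 'g \<Rightarrow> real" where
  "dist_at x \<equiv> \<lambda>u v. d ((x, u), (x, v))"

definition section_dist :: "'x \<Rightarrow> nat \<Rightarrow> nat \<Rightarrow> real" where
  "section_dist x = (\<lambda>m n. dist_at x (s m x) (s n x))"

definition point_dist :: "'x \<times> 'g \<Rightarrow> nat \<Rightarrow> real" where
  "point_dist w = (\<lambda>n. dist_at (fst w) (snd w) (s n (fst w)))"

lemma s_in: "x \<in> space X \<Longrightarrow> s n x \<in> topspace (T x)"
  using measurable_space[OF s_measurable] by (fastforce simp: space_GM)

lemma fibre:
  assumes "x \<in> space X"
  shows "radon_fibre (topspace (T x)) (dist_at x) (\<lambda>n. s n x) (\<mu> x)"
proof -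
  interpret Metric_space "topspace (T x)" "dist_at x" by (rule metric[OF assms])
  show ?thesis
  proof
    show "dense_seq (\<lambda>n. s n x)"
      by (rule dense_seqI_closure) (use assms s_in s_dense in \<open>auto simp: topology\<close>)
  qed (use assms complete locally_compact radon in \<open>auto simp: topology\<close>)
qed

lemma point_dist_measurable: "(\<lambda>w. point_dist w n) \<in> borel_measurable GM"
proof -
  have "(\<lambda>w. (w, (fst w, s n (fst w)))) \<in> GM \<rightarrow>\<^sub>M fibre_prod GM GM"
    by (intro measurable_fibre_prod measurable_compose[OF fst_GM s_measurable]) auto
  from measurable_compose[OF this d_measurable] show ?thesis
    by (simp add: point_dist_def)
qed

lemma section_dist_measurable: "(\<lambda>x. section_dist x m n) \<in> borel_measurable X"
  using measurable_compose[OF s_measurable[of m] point_dist_measurable[of n]]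
  by (simp add: section_dist_def point_dist_def)

text \<open>The base point and the distances to the sections form an injective Borel code on
  \<open>GM\<close>; on one fibre its first part is constant and its second part continuous. Hence
  Borel functions on the total space restrict to functions measurable for
  \<open>\<mu> x\<close>.\<close>

lemma Pair_measurable:
  assumes x: "x \<in> space X"
  shows "Pair x \<in> \<mu> x \<rightarrow>\<^sub>M GM"
proof -
  interpret R: radon_fibre "topspace (T x)" "dist_at x" "\<lambda>n. s n x" "\<mu> x" by (rule fibre[OF x])
  obtain j :: "_ \<Rightarrow> nat \<Rightarrow> real" where j_meas: "j \<in> borel_measurable X" and inj: "inj_on j (space X)"
    by (rule standard_borel_coordinates[OF X])
  show ?thesis
  proof (rule measurable_by_injective_key[OF GM, where k = "\<lambda>w. interleave (j (fst w)) (point_dist w)"])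
    show "(\<lambda>w. interleave (j (fst w)) (point_dist w)) \<in> borel_measurable GM"
      by (intro interleave_measurable measurable_compose[OF fst_GM j_meas]
          borel_measurable_sequenceI point_dist_measurable)
    show "inj_on (\<lambda>w. interleave (j (fst w)) (point_dist w)) (space GM)"
    proof (rule inj_onI)
      fix w w' assume w: "w \<in> space GM" "w' \<in> space GM"
        and eq: "interleave (j (fst w)) (point_dist w) = interleave (j (fst w')) (point_dist w')"
      have "j (fst w) = j (fst w')" "point_dist w = point_dist w'"
        using arg_cong[OF eq, of evens] arg_cong[OF eq, of odds] by simp_all
      then have fst: "fst w = fst w'" and
        eq': "(\<lambda>n. dist_at (fst w) (snd w) (s n (fst w))) = (\<lambda>n. dist_at (fst w) (snd w') (s n (fst w)))"
        using w inj by (auto simp: space_GM point_dist_def dest: inj_onD)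
      have y: "fst w \<in> space X" using w by (auto simp: space_GM)
      interpret Y: radon_fibre "topspace (T (fst w))" "dist_at (fst w)" "\<lambda>n. s n (fst w)" "\<mu> (fst w)"
        by (rule fibre[OF y])
      have "snd w = snd w'"
        using Y.inj_on_distances[OF Y.s, THEN inj_onD, OF eq'] w fst by (auto simp: space_GM)
      with fst show "w = w'" by (simp add: prod_eq_iff)
    qed
    show "Pair x \<in> space (\<mu> x) \<rightarrow> space GM"
      using x by (auto simp: R.space_\<mu> space_GM)
    have "(\<lambda>g. dist_at x g (s n x)) \<in> borel_measurable (\<mu> x)" for n
      by (rule R.continuous_measurable[OF R.continuous_map_dist]) (rule s_in[OF x])
    then show "(\<lambda>g. interleave (j (fst (x, g))) (point_dist (x, g))) \<in> borel_measurable (\<mu> x)"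
      by (intro interleave_measurable borel_measurable_sequenceI) (simp_all add: point_dist_def)
  qed
qed

lemma good_ball_measurable [measurable]: "Measurable.pred X (\<lambda>x. good_ball (section_dist x) n k)"
proof -
  note [measurable] = section_dist_measurable
  show ?thesis unfolding good_ball_def by measurable
qed

definition total_balls :: "(nat \<times> nat) list \<Rightarrow> ('x \<times> 'g) set" where
  "total_balls l = {w \<in> space GM. in_balls (section_dist (fst w)) l (point_dist w)}"

lemma total_balls_measurable [measurable]: "total_balls l \<in> sets GM"
proof (induction l)
  case Nil
  then show ?case by (simp add: total_balls_def in_balls_def)
next
  case (Cons a l)
  obtain n k where a: "a = (n, k)" by (cases a)
  note [measurable] = point_dist_measurable measurable_compose[OF fst_GM good_ball_measurable]
  have "total_balls (a # l) = {w \<in> space GM. good_ball (section_dist (fst w)) n k \<and> point_dist w n < 1 / real (Suc k)}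
      \<union> total_balls l"
    by (auto simp: total_balls_def in_balls_def a)
  also have "\<dots> \<in> sets GM"
    using Cons by (intro sets.Un) measurable
  finally show ?case .
qed

lemma mem_total_balls:
  assumes "x \<in> space X" "g \<in> topspace (T x)"
  shows "(x, g) \<in> total_balls l \<longleftrightarrow>
    g \<in> radon_fibre.balls (topspace (T x)) (dist_at x) (\<lambda>n. s n x) l"
proof -
  interpret R: radon_fibre "topspace (T x)" "dist_at x" "\<lambda>n. s n x" "\<mu> x" by (rule fibre[OF assms(1)])
  show ?thesis
    using assms by (simp add: total_balls_def R.balls_def space_GM section_dist_def point_dist_def)
qed

definition step :: "((rat \<times> rat) \<times> (nat \<times> nat) list) list \<Rightarrow> 'x \<times> 'g \<Rightarrow> complex" where
  "step c w = rational_step (section_dist (fst w)) c (point_dist w)"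

lemma step_measurable: "step c \<in> borel_measurable GM"
proof (induction c)
  case Nil
  then show ?case by (simp add: step_def[abs_def] rational_step_def)
next
  case (Cons a c)
  obtain q l where a: "a = (q, l)" by (cases a)
  have "(\<lambda>w. rat_complex q * indicator (total_balls l) w + step c w) \<in> borel_measurable GM"
    using Cons by measurable
  moreover have "step (a # c) w = rat_complex q * indicator (total_balls l) w + step c w" if "w \<in> space GM" for w
    using that by (simp add: step_def rational_step_def a total_balls_def indicator_def)
  ultimately show ?case
    by (subst measurable_cong) auto
qed

subsection \<open>Integrals depending on a parameter\<close>

text \<open>Equality of base points is tested on their real codes, so the fibre product is a
  measurable subset of the product.\<close>

lemma diagonal_measurable:
  assumes "r \<in> N \<rightarrow>\<^sub>M X"
  shows "{v \<in> space (N \<Otimes>\<^sub>M GM). r (fst v) = fst (snd v)} \<in> sets (N \<Otimes>\<^sub>M GM)"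
proof -
  obtain j :: "_ \<Rightarrow> nat \<Rightarrow> real" where j_meas: "j \<in> borel_measurable X" and inj: "inj_on j (space X)"
    by (rule standard_borel_coordinates[OF X])
  have [measurable]: "(\<lambda>v. j (r (fst v))) \<in> borel_measurable (N \<Otimes>\<^sub>M GM)"
    "(\<lambda>v. j (fst (snd v))) \<in> borel_measurable (N \<Otimes>\<^sub>M GM)"
    by (intro measurable_compose[OF _ j_meas] measurable_compose[OF measurable_fst assms]
        measurable_compose[OF measurable_snd fst_GM])+
  have "{v \<in> space (N \<Otimes>\<^sub>M GM). r (fst v) = fst (snd v)} =
      {v \<in> space (N \<Otimes>\<^sub>M GM). j (r (fst v)) = j (fst (snd v))}"
    using measurable_space[OF assms] inj
    by (auto simp: space_pair_measure space_GM dest: inj_onD)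
  also have "\<dots> \<in> sets (N \<Otimes>\<^sub>M GM)"
    by measurable
  finally show ?thesis .
qed

abbreviation ball_mass :: "(nat \<times> nat) list \<Rightarrow> 'x \<Rightarrow> ennreal" where
  "ball_mass l x \<equiv> \<integral>\<^sup>+ g. indicator (total_balls l) (x, g) \<partial>\<mu> x"

text \<open>The part of \<open>\<mu> x\<close> on finitely many good balls, viewed on the total
  space. Over \<open>space X\<close> the denominator is positive and finite, and it bounds the total
  mass by 1 even where the balls are null.\<close>

definition ball_kernel :: "(nat \<times> nat) list \<Rightarrow> 'x \<Rightarrow> ('x \<times> 'g) measure" where
  "ball_kernel l x = density (distr (\<mu> x) GM (Pair x))
     (\<lambda>w. indicator (total_balls l) w / (1 + ball_mass l x))"

lemma nn_integral_ball_kernel: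
  assumes x: "x \<in> space X" and [measurable]: "H \<in> borel_measurable GM"
  shows "(\<integral>\<^sup>+ w. H w \<partial>ball_kernel l x) =
    (\<integral>\<^sup>+ g. indicator (total_balls l) (x, g) * H (x, g) \<partial>\<mu> x) / (1 + ball_mass l x)"
proof -
  note [measurable] = Pair_measurable[OF x]
  have "(\<integral>\<^sup>+ w. H w \<partial>ball_kernel l x) = (\<integral>\<^sup>+ g. indicator (total_balls l) (x, g) / (1 + ball_mass l x) * H (x, g) \<partial>\<mu> x)"
    unfolding ball_kernel_def
    by (subst nn_integral_density, measurable) (subst nn_integral_distr, measurable)
  also have "\<dots> = (\<integral>\<^sup>+ g. (indicator (total_balls l) (x, g) * H (x, g)) / (1 + ball_mass l x) \<partial>\<mu> x)"
    by (intro nn_integral_cong) (simp add: divide_ennreal_def mult.assoc mult.commute mult.left_commute)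
  also have "\<dots> = (\<integral>\<^sup>+ g. indicator (total_balls l) (x, g) * H (x, g) \<partial>\<mu> x) / (1 + ball_mass l x)"
    by (intro nn_integral_divide) measurable
  finally show ?thesis .
qed

lemma nn_integral_total_balls:
  assumes "x \<in> space X"
  shows "ball_mass l x < \<infinity>"
proof -
  interpret R: radon_fibre "topspace (T x)" "dist_at x" "\<lambda>n. s n x" "\<mu> x" by (rule fibre[OF assms])
  have "ball_mass l x = (\<integral>\<^sup>+ g. indicator (R.balls l) g \<partial>\<mu> x)"
    using assms by (intro nn_integral_cong) (simp add: R.space_\<mu> mem_total_balls indicator_def)
  then show ?thesis using R.balls_finite[of l] by simp
qed

lemma emeasure_ball_kernel:
  assumes "x \<in> space X" "A \<in> sets GM"
  shows "emeasure (ball_kernel l x) A =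
    (\<integral>\<^sup>+ g. indicator (total_balls l) (x, g) * indicator A (x, g) \<partial>\<mu> x) / (1 + ball_mass l x)"
proof -
  have "A \<in> sets (ball_kernel l x)" using assms by (simp add: ball_kernel_def)
  then have "emeasure (ball_kernel l x) A = (\<integral>\<^sup>+ w. indicator A w \<partial>ball_kernel l x)" by simp
  then show ?thesis using assms by (subst (asm) nn_integral_ball_kernel) auto
qed

text \<open>The mass of a set is a quotient built from two integrals of Borel functions on the total
  space, both covered by \<open>integral_measurable\<close>.\<close>

lemma ball_kernel_measurable: "ball_kernel l \<in> X \<rightarrow>\<^sub>M subprob_algebra GM"
proof (rule measurable_subprob_algebra)
  fix x assume x: "x \<in> space X"
  show "sets (ball_kernel l x) = sets GM" by (simp add: ball_kernel_def)
  show "subprob_space (ball_kernel l x)"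
  proof
    have "emeasure (ball_kernel l x) (space GM) =
        (\<integral>\<^sup>+ g. indicator (total_balls l) (x, g) * indicator (space GM) (x, g) \<partial>\<mu> x) / (1 + ball_mass l x)"
      by (rule emeasure_ball_kernel[OF x sets.top])
    also have "\<dots> \<le> ball_mass l x / (1 + ball_mass l x)"
      by (intro divide_right_mono_ennreal nn_integral_mono) (auto simp: indicator_def)
    also have "\<dots> \<le> 1"
    proof -
      obtain c where c: "ball_mass l x = ennreal c" "c \<ge> 0"
        using nn_integral_total_balls[OF x, of l] by (cases "ball_mass l x") auto
      have "ball_mass l x / (1 + ball_mass l x) = ennreal (c / (1 + c))"
        using c by (simp add: divide_ennreal ennreal_1[symmetric] ennreal_plus[symmetric] del: ennreal_1 ennreal_plus)
      also have "\<dots> \<le> ennreal 1" using c by (intro ennreal_leI) (simp add: divide_le_eq_1)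
      finally show ?thesis by simp
    qed
    finally show "emeasure (ball_kernel l x) (space (ball_kernel l x)) \<le> 1"
      by (simp add: ball_kernel_def)
    show "space (ball_kernel l x) \<noteq> {}"
      using measurable_space[OF s_measurable x] by (auto simp: ball_kernel_def)
  qed
next
  fix A assume A [measurable]: "A \<in> sets GM"
  have [measurable]: "ball_mass l \<in> borel_measurable X"
    by (rule integral_measurable) measurable
  have [measurable]: "(\<lambda>x. \<integral>\<^sup>+ g. indicator (total_balls l) (x, g) * indicator A (x, g) \<partial>\<mu> x) \<in> borel_measurable X"
    by (intro integral_measurable[of "\<lambda>w. indicator (total_balls l) w * indicator A w"]) measurable
  have "(\<lambda>x. (\<integral>\<^sup>+ g. indicator (total_balls l) (x, g) * indicator A (x, g) \<partial>\<mu> x) / (1 + ball_mass l x)) \<in> borel_measurable X"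
    by measurable
  then show "(\<lambda>x. emeasure (ball_kernel l x) A) \<in> borel_measurable X"
    by (rule measurable_cong[THEN iffD1, rotated]) (simp add: emeasure_ball_kernel A)
qed

text \<open>Extends \<open>integral_measurable\<close> to integrands that depend on a further point
  \<open>w\<close> lying over the base point; Borel dependence on scalars and on compactly supported
  functions rests on it.\<close>

lemma nn_integral_param_measurable:
  assumes r: "r \<in> N \<rightarrow>\<^sub>M X"
    and H: "H \<in> borel_measurable (restrict_space (N \<Otimes>\<^sub>M GM) {v. r (fst v) = fst (snd v)})"
  shows "(\<lambda>w. \<integral>\<^sup>+ g. H (w, (r w, g)) \<partial>\<mu> (r w)) \<in> borel_measurable N"
proof -
  let ?D = "{v. r (fst v) = fst (snd v)}"
  have D: "?D \<inter> space (N \<Otimes>\<^sub>M GM) \<in> sets (N \<Otimes>\<^sub>M GM)"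
  proof -
    have "?D \<inter> space (N \<Otimes>\<^sub>M GM) = {v \<in> space (N \<Otimes>\<^sub>M GM). r (fst v) = fst (snd v)}" by auto
    then show ?thesis using diagonal_measurable[OF r] by simp
  qed
  \<comment> \<open>\<open>H\<close> is measurable on the fibre product only; extension by 0 off
    this measurable set makes it measurable on the product.\<close>
  define H' where "H' v = H v * indicator ?D v" for v
  have H' [measurable]: "H' \<in> borel_measurable (N \<Otimes>\<^sub>M GM)"
    unfolding H'_def using H borel_measurable_restrict_space_iff_ennreal[OF D] by simp
  let ?l = "\<lambda>n. map prod_decode [0..<n]"
  have c_meas: "(\<lambda>w. 1 + ball_mass (?l n) (r w)) \<in> borel_measurable N" for n
  proof -
    have "ball_mass (?l n) \<in> borel_measurable X" by (rule integral_measurable) measurable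
    from measurable_compose[OF r this] show ?thesis by measurable
  qed
  have k_meas: "(\<lambda>w. \<integral>\<^sup>+ v. H' (w, v) \<partial>ball_kernel (?l n) (r w)) \<in> borel_measurable N" for n
    by (rule nn_integral_measurable_subprob_algebra2[OF _ measurable_compose[OF r ball_kernel_measurable]])
      (use H' in simp)
  \<comment> \<open>The factor \<open>1 + ball_mass\<close> undoes the normalisation, and the
    supremum over the increasing balls removes the restriction to them.\<close>
  have "(\<lambda>w. SUP n. (1 + ball_mass (?l n) (r w)) * (\<integral>\<^sup>+ v. H' (w, v) \<partial>ball_kernel (?l n) (r w))) \<in> borel_measurable N"
    using c_meas k_meas by measurable
  moreover have "(\<integral>\<^sup>+ g. H (w, (r w, g)) \<partial>\<mu> (r w)) =
      (SUP n. (1 + ball_mass (?l n) (r w)) * (\<integral>\<^sup>+ v. H' (w, v) \<partial>ball_kernel (?l n) (r w)))" if w: "w \<in> space N" for w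
  proof -
    have x: "r w \<in> space X" by (rule measurable_space[OF r w])
    interpret R: radon_fibre "topspace (T (r w))" "dist_at (r w)" "\<lambda>n. s n (r w)" "\<mu> (r w)" by (rule fibre[OF x])
    note [measurable] = Pair_measurable[OF x]
    have Hw [measurable]: "(\<lambda>v. H' (w, v)) \<in> borel_measurable GM"
      using H' w by (rule measurable_Pair2)
    have Hg: "H' (w, (r w, g)) = H (w, (r w, g))" for g by (simp add: H'_def)
    have [measurable]: "(\<lambda>g. H (w, (r w, g))) \<in> borel_measurable (\<mu> (r w))"
      using measurable_compose[OF Pair_measurable[OF x] Hw] by (simp add: Hg)
    have eq: "(1 + ball_mass (?l n) (r w)) * (\<integral>\<^sup>+ v. H' (w, v) \<partial>ball_kernel (?l n) (r w)) =
        (\<integral>\<^sup>+ g. indicator (total_balls (?l n)) (r w, g) * H (w, (r w, g)) \<partial>\<mu> (r w))" for n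
    proof -
      \<comment> \<open>Cancelling in \<open>ennreal\<close> requires a factor that is neither 0 nor
        infinite.\<close>
      have "1 + ball_mass (?l n) (r w) \<noteq> 0" "1 + ball_mass (?l n) (r w) \<noteq> \<infinity>"
        using nn_integral_total_balls[OF x, of "?l n"] by auto
      then have "(1 + ball_mass (?l n) (r w)) * (b / (1 + ball_mass (?l n) (r w))) = b" for b
        by (simp add: ennreal_times_divide mult.commute[of _ b] mult_divide_eq_ennreal)
      then show ?thesis
        unfolding nn_integral_ball_kernel[OF x Hw] Hg .
    qed
    have eq': "(\<integral>\<^sup>+ g. indicator (total_balls (?l n)) (r w, g) * H (w, (r w, g)) \<partial>\<mu> (r w)) =
        (\<integral>\<^sup>+ g. indicator (R.balls (?l n)) g * H (w, (r w, g)) \<partial>\<mu> (r w))" for n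
      by (intro nn_integral_cong) (simp add: R.space_\<mu> mem_total_balls[OF x] indicator_def)
    have "(SUP n. \<integral>\<^sup>+ g. indicator (R.balls (?l n)) g * H (w, (r w, g)) \<partial>\<mu> (r w)) =
        (\<integral>\<^sup>+ g. (SUP n. indicator (R.balls (?l n)) g * H (w, (r w, g))) \<partial>\<mu> (r w))"
    proof (rule nn_integral_monotone_convergence_SUP[symmetric])
      show "incseq (\<lambda>n g. indicator (R.balls (?l n)) g * H (w, (r w, g)))"
      proof (intro incseq_SucI le_funI mult_right_mono)
        fix n g
        have "R.balls (?l n) \<subseteq> R.balls (?l (Suc n))"
          by (rule incseq_SucD[OF R.uniform_exhaustion(1)])
        then show "indicator (R.balls (?l n)) g \<le> (indicator (R.balls (?l (Suc n))) g :: ennreal)"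
          by (intro indicator_leI) blast
      qed simp
    qed measurable
    also have "\<dots> = (\<integral>\<^sup>+ g. H (w, (r w, g)) \<partial>\<mu> (r w))"
    proof (rule nn_integral_cong)
      fix g assume "g \<in> space (\<mu> (r w))"
      then obtain n where n: "g \<in> R.balls (?l n)"
        using R.uniform_exhaustion(2) by (auto simp: R.space_\<mu>)
      show "(SUP n. indicator (R.balls (?l n)) g * H (w, (r w, g))) = H (w, (r w, g))"
      proof (rule antisym)
        show "(SUP n. indicator (R.balls (?l n)) g * H (w, (r w, g))) \<le> H (w, (r w, g))"
          by (intro SUP_least) (auto simp: indicator_def)
        have "H (w, (r w, g)) = indicator (R.balls (?l n)) g * H (w, (r w, g))" using n by simp
        also have "\<dots> \<le> (SUP n. indicator (R.balls (?l n)) g * H (w, (r w, g)))"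
          by (rule SUP_upper) simp
        finally show "H (w, (r w, g)) \<le> (SUP n. indicator (R.balls (?l n)) g * H (w, (r w, g)))" .
      qed
    qed
    finally show ?thesis unfolding eq eq' by (rule sym)
  qed
  ultimately show ?thesis
    by (subst measurable_cong) auto
qed

lemma integral_param_measurable_real:
  fixes H :: "'w \<times> ('x \<times> 'g) \<Rightarrow> real"
  assumes r: "r \<in> N \<rightarrow>\<^sub>M X"
    and H [measurable]: "H \<in> borel_measurable (restrict_space (N \<Otimes>\<^sub>M GM) {v. r (fst v) = fst (snd v)})"
    and int: "\<And>w. w \<in> space N \<Longrightarrow> integrable (\<mu> (r w)) (\<lambda>g. H (w, (r w, g)))"
  shows "(\<lambda>w. LINT g|\<mu> (r w). H (w, (r w, g))) \<in> borel_measurable N"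
proof -
  have 1: "(\<lambda>w. \<integral>\<^sup>+ g. ennreal (H (w, (r w, g))) \<partial>\<mu> (r w)) \<in> borel_measurable N"
    by (rule nn_integral_param_measurable[OF r, of "\<lambda>v. ennreal (H v)"]) measurable
  have 2: "(\<lambda>w. \<integral>\<^sup>+ g. ennreal (- H (w, (r w, g))) \<partial>\<mu> (r w)) \<in> borel_measurable N"
    by (rule nn_integral_param_measurable[OF r, of "\<lambda>v. ennreal (- H v)"]) measurable
  have "(\<lambda>w. enn2real (\<integral>\<^sup>+ g. ennreal (H (w, (r w, g))) \<partial>\<mu> (r w))
      - enn2real (\<integral>\<^sup>+ g. ennreal (- H (w, (r w, g))) \<partial>\<mu> (r w))) \<in> borel_measurable N"
    using 1 2 by measurable
  then show ?thesis
    by (subst measurable_cong[OF real_lebesgue_integral_def[OF int]]) auto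
qed

lemma integral_param_measurable:
  fixes H :: "'w \<times> ('x \<times> 'g) \<Rightarrow> complex"
  assumes r: "r \<in> N \<rightarrow>\<^sub>M X"
    and H [measurable]: "H \<in> borel_measurable (restrict_space (N \<Otimes>\<^sub>M GM) {v. r (fst v) = fst (snd v)})"
    and int: "\<And>w. w \<in> space N \<Longrightarrow> integrable (\<mu> (r w)) (\<lambda>g. H (w, (r w, g)))"
  shows "(\<lambda>w. LINT g|\<mu> (r w). H (w, (r w, g))) \<in> borel_measurable N"
proof -
  have 1: "(\<lambda>w. LINT g|\<mu> (r w). Re (H (w, (r w, g)))) \<in> borel_measurable N"
    by (rule integral_param_measurable_real[OF r, of "\<lambda>v. Re (H v)"]) (use int in auto)
  have 2: "(\<lambda>w. LINT g|\<mu> (r w). Im (H (w, (r w, g)))) \<in> borel_measurable N"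
    by (rule integral_param_measurable_real[OF r, of "\<lambda>v. Im (H v)"]) (use int in auto)
  have "(\<lambda>w. Complex (LINT g|\<mu> (r w). Re (H (w, (r w, g)))) (LINT g|\<mu> (r w). Im (H (w, (r w, g))))) \<in> borel_measurable N"
    unfolding Complex_eq using 1 2 by measurable
  then show ?thesis
    by (subst measurable_cong[where g = "\<lambda>w. Complex (LINT g|\<mu> (r w). Re (H (w, (r w, g)))) (LINT g|\<mu> (r w). Im (H (w, (r w, g))))"])
      (auto simp: complex_eq_iff int)
qed

end

section \<open>The Borel structure on \<open>L\<^sup>p(G)\<close>\<close>

lemma (in Metric_space) dist_tendsto:
  assumes "v \<in> M" "z \<in> M" "\<And>k :: nat. u k \<in> M" "(\<lambda>k. d v (u k)) \<longlonglongrightarrow> 0"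
  shows "(\<lambda>k. d (u k) z) \<longlonglongrightarrow> d v z"
proof (rule LIMSEQ_I)
  fix e :: real assume "e > 0"
  then obtain N where N: "\<And>k. k \<ge> N \<Longrightarrow> d v (u k) < e"
    using order_tendstoD(2)[OF assms(4), of e] by (auto simp: eventually_sequentially)
  have "norm (d (u k) z - d v z) < e" if "k \<ge> N" for k
    using N[OF that] triangle[OF assms(3)[of k] assms(1,2)] triangle[OF assms(1) assms(3)[of k] assms(2)]
      commute[of v "u k"] by (simp add: abs_less_iff)
  then show "\<exists>N. \<forall>k\<ge>N. norm (d (u k) z - d v z) < e" by blast
qed

lemma norm_dist_add_left:
  assumes p: "1 \<le> p" and "\<xi> \<in> carrier (Lp p M)" "\<eta> \<in> carrier (Lp p M)" "\<zeta> \<in> carrier (Lp p M)"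
  shows "norm_dist (Lp p M) (\<xi> \<oplus>\<^bsub>Lp p M\<^esub> \<eta>) (\<xi> \<oplus>\<^bsub>Lp p M\<^esub> \<zeta>) = norm_dist (Lp p M) \<eta> \<zeta>"
  using assms by (auto elim!: lp_carrierE simp: lp_add_class lp_funs_add norm_dist_Lp)

lemma norm_dist_smult:
  assumes p: "1 \<le> p" and "\<xi> \<in> carrier (Lp p M)" "\<eta> \<in> carrier (Lp p M)"
  shows "norm_dist (Lp p M) (c \<odot>\<^bsub>Lp p M\<^esub> \<xi>) (c \<odot>\<^bsub>Lp p M\<^esub> \<eta>) = cmod c * norm_dist (Lp p M) \<xi> \<eta>"
  using assms
  by (auto elim!: lp_carrierE simp: lp_smult_class lp_funs_scale norm_dist_Lp lp_norm_scale
      simp flip: right_diff_distrib)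

lemma nrm_eq_norm_dist:
  assumes p: "1 \<le> p" and "\<xi> \<in> carrier (Lp p M)"
  shows "nrm (Lp p M) \<xi> = norm_dist (Lp p M) \<xi> (lp_class p M (\<lambda>_. 0))"
  using assms by (auto elim!: lp_carrierE simp: norm_dist_Lp lp_funs_zero lp_nrm_class lp_norm_def)

lemma add_closed_Lp:
  assumes "1 \<le> p" "\<xi> \<in> carrier (Lp p M)" "\<eta> \<in> carrier (Lp p M)"
  shows "\<xi> \<oplus>\<^bsub>Lp p M\<^esub> \<eta> \<in> carrier (Lp p M)"
  using assms by (auto elim!: lp_carrierE simp: lp_add_class lp_funs_add lp_class_in_carrier)

lemma smult_closed_Lp:
  assumes "\<xi> \<in> carrier (Lp p M)"
  shows "c \<odot>\<^bsub>Lp p M\<^esub> \<xi> \<in> carrier (Lp p M)"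
  using assms by (auto elim!: lp_carrierE simp: lp_smult_class lp_funs_scale lp_class_in_carrier)

lemma class_integral_tendsto:
  assumes p: "1 \<le> p" and \<xi>: "\<xi> \<in> carrier (Lp p M)" "\<And>k. u k \<in> carrier (Lp p M)"
    and F_meas: "F \<in> borel_measurable M" and K: "K \<in> sets M" "emeasure M K < \<infinity>" and B: "0 \<le> B"
    and F: "\<And>g. g \<in> space M \<Longrightarrow> cmod (F g) \<le> B * indicator K g"
    and lim: "(\<lambda>k. norm_dist (Lp p M) \<xi> (u k)) \<longlonglongrightarrow> 0"
  shows "(\<lambda>k. class_integral M (u k) F) \<longlonglongrightarrow> class_integral M \<xi> F"
proof -
  obtain f where f: "f \<in> lp_funs p M" "\<xi> = lp_class p M f"
    using \<xi>(1) by (rule lp_carrierE)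
  have "\<forall>k. \<exists>f. f \<in> lp_funs p M \<and> u k = lp_class p M f"
    using \<xi>(2) by (metis lp_carrierE)
  then obtain h where h: "\<And>k. h k \<in> lp_funs p M" "\<And>k. u k = lp_class p M (h k)"
    by metis
  show ?thesis
    using lp_pairing_tendsto[OF p f(1) h(1) F_meas K B F] lim
    by (simp add: f h norm_dist_Lp[OF p] class_integral_class[OF _ F_meas])
qed

lemma lp_funs_one_integrable: "f \<in> lp_funs 1 M \<Longrightarrow> integrable M f"
  by (auto simp: lp_funs_def intro: integrable_norm_cancel)

text \<open>The constant 1 need not have compact support, so the pairing estimate does not apply;
  for p = 1 the integral is 1-Lipschitz with respect to the norm.\<close>

lemma class_integral_one_tendsto:
  assumes \<xi>: "\<xi> \<in> carrier (Lp 1 M)" "\<And>k. u k \<in> carrier (Lp 1 M)"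
    and lim: "(\<lambda>k. norm_dist (Lp 1 M) \<xi> (u k)) \<longlonglongrightarrow> 0"
  shows "(\<lambda>k. class_integral M (u k) (\<lambda>_. 1)) \<longlonglongrightarrow> class_integral M \<xi> (\<lambda>_. 1)"
proof -
  have bound: "dist (class_integral M \<eta> (\<lambda>_. 1)) (class_integral M \<xi> (\<lambda>_. 1)) \<le> norm_dist (Lp 1 M) \<xi> \<eta>"
    if \<eta>: "\<eta> \<in> carrier (Lp 1 M)" for \<eta>
  proof -
    obtain f where f: "f \<in> lp_funs 1 M" "\<xi> = lp_class 1 M f"
      using \<xi>(1) by (rule lp_carrierE)
    obtain h where h: "h \<in> lp_funs 1 M" "\<eta> = lp_class 1 M h"
      using \<eta> by (rule lp_carrierE)
    have int: "integrable M f" "integrable M h"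
      using f(1) h(1) by (auto intro: lp_funs_one_integrable)
    have "dist (class_integral M \<eta> (\<lambda>_. 1)) (class_integral M \<xi> (\<lambda>_. 1)) = cmod (LINT g|M. f g - h g)"
      using int by (simp add: f h class_integral_class dist_norm norm_minus_commute)
    also have "\<dots> \<le> (LINT g|M. cmod (f g - h g))"
      by (rule integral_norm_bound)
    also have "\<dots> = lp_norm 1 M (\<lambda>g. f g - h g)"
      by (simp add: lp_norm_def)
    also have "\<dots> = norm_dist (Lp 1 M) \<xi> \<eta>"
      using f h by (simp add: norm_dist_Lp)
    finally show ?thesis .
  qed
  show ?thesis
    by (rule tendstoI, rule eventually_mono[OF order_tendstoD(2)[OF lim]])
      (use bound[OF \<xi>(2)] in \<open>auto intro: le_less_trans\<close>)
qed

lemma Cc_subset_C0: "Cc T \<subseteq> C0 T"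
proof
  fix F assume F: "F \<in> Cc T"
  have "{g \<in> topspace T. F g \<noteq> 0} \<subseteq> T closure_of {g \<in> topspace T. F g \<noteq> 0}"
    by (intro closure_of_subset) auto
  then have "\<forall>g\<in>topspace T - T closure_of {g \<in> topspace T. F g \<noteq> 0}. cmod (F g) < e" if "e > 0" for e
    using that by auto
  then show "F \<in> C0 T"
    using F unfolding Cc_def C0_def by blast
qed

section \<open>The field of L^p spaces and its operations\<close>

locale radon_lp_field = radon_field +
  fixes p :: real
  assumes p: "1 \<le> p"
begin

lemma step_lp_funs:
  assumes "x \<in> space X"
  shows "(\<lambda>g. step c (x, g)) \<in> lp_funs p (\<mu> x)"
proof -
  interpret R: radon_fibre "topspace (T x)" "dist_at x" "\<lambda>n. s n x" "\<mu> x" by (rule fibre[OF assms])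
  show ?thesis
    using R.step_lp_funs[OF p, of c] by (simp add: step_def section_dist_def point_dist_def)
qed

text \<open>Codes of step functions form a countable type, enumerated by \<open>from_nat\<close>.
  The same code is used over every \<open>x\<close>, so each number yields a section.\<close>

definition step_class :: "nat \<Rightarrow> 'a \<Rightarrow> ('b \<Rightarrow> complex) set" where
  "step_class n x = lp_class p (\<mu> x) (\<lambda>g. step (from_nat n) (x, g))"

lemma step_class_in: "x \<in> space X \<Longrightarrow> step_class n x \<in> carrier (Lp p (\<mu> x))"
  unfolding step_class_def by (intro lp_class_in_carrier step_lp_funs)

lemma step_restrict_measurable:
  "(\<lambda>v. step c (snd v)) \<in> borel_measurable (restrict_space (N \<Otimes>\<^sub>M GM) D)"
  by (intro measurable_restrict_space1 measurable_compose[OF measurable_snd step_measurable])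

text \<open>\<open>K w\<close> is the function on the fibre whose norm is taken; \<open>H\<close> is
  the same function seen on the fibre product, where joint measurability can be stated.\<close>

lemma lp_norm_measurable:
  fixes H :: "'w \<times> ('a \<times> 'b) \<Rightarrow> complex" and K :: "'w \<Rightarrow> 'b \<Rightarrow> complex"
  assumes r: "r \<in> N \<rightarrow>\<^sub>M X"
    and H [measurable]: "H \<in> borel_measurable (restrict_space (N \<Otimes>\<^sub>M GM) {v. r (fst v) = fst (snd v)})"
    and K: "\<And>w. w \<in> space N \<Longrightarrow> K w \<in> borel_measurable (\<mu> (r w))"
    and HK: "\<And>w g. H (w, (r w, g)) = K w g"
  shows "(\<lambda>w. lp_norm p (\<mu> (r w)) (K w)) \<in> borel_measurable N"
proof -
  have "(\<lambda>w. \<integral>\<^sup>+ g. ennreal (cmod (H (w, (r w, g))) powr p) \<partial>\<mu> (r w)) \<in> borel_measurable N"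
    by (rule nn_integral_param_measurable[OF r, of "\<lambda>v. ennreal (cmod (H v) powr p)"]) measurable
  then have [measurable]: "(\<lambda>w. \<integral>\<^sup>+ g. ennreal (cmod (K w g) powr p) \<partial>\<mu> (r w)) \<in> borel_measurable N"
    by (simp only: HK)
  have "(\<lambda>w. enn2real (\<integral>\<^sup>+ g. ennreal (cmod (K w g) powr p) \<partial>\<mu> (r w)) powr (1 / p)) \<in> borel_measurable N"
    by measurable
  then show ?thesis
    by (rule measurable_cong[THEN iffD1, rotated]) (simp add: lp_norm_eq_enn2real[OF p K])
qed

lemma step_class_dist_measurable:
  "(\<lambda>x. norm_dist (Lp p (\<mu> x)) (step_class m x) (step_class n x)) \<in> borel_measurable X"
proof -
  have "(\<lambda>x. lp_norm p (\<mu> x) (\<lambda>g. step (from_nat m) (x, g) - step (from_nat n) (x, g))) \<in> borel_measurable X"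
    by (rule lp_norm_measurable[where r = "\<lambda>x. x" and H = "\<lambda>v. step (from_nat m) (snd v) - step (from_nat n) (snd v)"])
      (auto intro!: step_restrict_measurable borel_measurable_diff lp_funs_measurable[OF step_lp_funs])
  then show ?thesis
    by (rule measurable_cong[THEN iffD1, rotated]) (simp add: step_class_def norm_dist_Lp[OF p] step_lp_funs)
qed

text \<open>Completeness of the fibres and density of the step functions meet here; the construction
  over \<open>metric_field\<close> then supplies the Borel structure.\<close>

sublocale lp: metric_field X "\<lambda>x. carrier (Lp p (\<mu> x))" "\<lambda>x. norm_dist (Lp p (\<mu> x))" step_class
proof (rule metric_field.intro)
  show "standard_borel X" by (rule X)
  fix x assume x: "x \<in> space X"
  show "Metric_space (carrier (Lp p (\<mu> x))) (norm_dist (Lp p (\<mu> x)))"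
    by (rule Metric_space_Lp[OF p])
  show "Metric_space.mcomplete (carrier (Lp p (\<mu> x))) (norm_dist (Lp p (\<mu> x)))"
    by (rule mcomplete_Lp[OF p])
  interpret R: radon_fibre "topspace (T x)" "dist_at x" "\<lambda>n. s n x" "\<mu> x" by (rule fibre[OF x])
  interpret L: Metric_space "carrier (Lp p (\<mu> x))" "norm_dist (Lp p (\<mu> x))" by (rule Metric_space_Lp[OF p])
  have "\<exists>n. norm_dist (Lp p (\<mu> x)) \<xi> (step_class n x) < e" if \<xi>: "\<xi> \<in> carrier (Lp p (\<mu> x))" and e: "e > 0" for \<xi> e
  proof -
    obtain f where f: "f \<in> lp_funs p (\<mu> x)" "\<xi> = lp_class p (\<mu> x) f"
      using \<xi> by (rule lp_carrierE)
    obtain c where "lp_norm p (\<mu> x) (\<lambda>g. f g - R.step c g) < e"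
      by (rule R.steps_dense[OF p f(1) e])
    then have "norm_dist (Lp p (\<mu> x)) \<xi> (step_class (to_nat c) x) < e"
      unfolding step_class_def f(2) norm_dist_Lp[OF p f(1) step_lp_funs[OF x]]
      by (simp add: step_def section_dist_def point_dist_def)
    then show ?thesis ..
  qed
  then show "L.dense_seq (\<lambda>n. step_class n x)"
    unfolding L.dense_seq_def using step_class_in[OF x] by blast
qed (rule step_class_dist_measurable)

abbreviation L :: "('a \<times> ('b \<Rightarrow> complex) set) measure" where "L \<equiv> lp.total_space"

text \<open>Continuity is used in one argument at a time: distances of sums of two step classes are
  Borel as parameter integrals, then the second summand is released, then the first, which
  commutativity moves to the right-hand position.\<close>

lemma add_measurable:
  "(\<lambda>((x, u), (y, v)). (x, u \<oplus>\<^bsub>Lp p (\<mu> x)\<^esub> v)) \<in> fibre_prod L L \<rightarrow>\<^sub>M L"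
proof -
  let ?N = "fibre_prod L L"
  let ?r = "\<lambda>w :: ('a \<times> ('b \<Rightarrow> complex) set) \<times> ('a \<times> ('b \<Rightarrow> complex) set). fst (fst w)"
  let ?D = "\<lambda>w. norm_dist (Lp p (\<mu> (?r w)))"
  have r: "?r \<in> ?N \<rightarrow>\<^sub>M X"
    by (rule measurable_compose[OF measurable_fibre_prod_fst lp.fst_measurable_total_space])
  have rX: "?r w \<in> space X" if "w \<in> space ?N" for w
    by (rule measurable_space[OF r that])
  have fst: "(\<lambda>w. (?r w, snd (fst w))) \<in> ?N \<rightarrow>\<^sub>M L"
    using measurable_fibre_prod_fst by simp
  have snd: "(\<lambda>w. (?r w, snd (snd w))) \<in> ?N \<rightarrow>\<^sub>M L"
    by (subst measurable_cong[where g = snd])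
      (auto simp: space_fibre_prod prod_eq_iff intro: measurable_fibre_prod_snd)
  have mem: "snd (fst w) \<in> carrier (Lp p (\<mu> (?r w)))" "snd (snd w) \<in> carrier (Lp p (\<mu> (?r w)))"
    if "w \<in> space ?N" for w
    using measurable_space[OF fst that] measurable_space[OF snd that] by (auto simp: lp.space_total_space)
  \<comment> \<open>Translation is an isometry, so convergence of \<open>u\<close> passes to the
    sums.\<close>
  have cont: "(\<lambda>k. norm_dist (Lp p (\<mu> x)) (\<xi> \<oplus>\<^bsub>Lp p (\<mu> x)\<^esub> u k) \<zeta>) \<longlonglongrightarrow> norm_dist (Lp p (\<mu> x)) (\<xi> \<oplus>\<^bsub>Lp p (\<mu> x)\<^esub> \<eta>) \<zeta>"
    if "\<xi> \<in> carrier (Lp p (\<mu> x))" "\<eta> \<in> carrier (Lp p (\<mu> x))" "\<zeta> \<in> carrier (Lp p (\<mu> x))"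
      "\<And>k. u k \<in> carrier (Lp p (\<mu> x))" "(\<lambda>k. norm_dist (Lp p (\<mu> x)) \<eta> (u k)) \<longlonglongrightarrow> 0"
    for x \<xi> \<eta> \<zeta> and u :: "nat \<Rightarrow> _"
    by (rule Metric_space.dist_tendsto[OF Metric_space_Lp[OF p]])
      (use that p in \<open>simp_all add: add_closed_Lp norm_dist_add_left\<close>)
  have comm: "\<xi> \<oplus>\<^bsub>Lp p (\<mu> x)\<^esub> \<eta> = \<eta> \<oplus>\<^bsub>Lp p (\<mu> x)\<^esub> \<xi>"
    if "\<xi> \<in> carrier (Lp p (\<mu> x))" "\<eta> \<in> carrier (Lp p (\<mu> x))" for x \<xi> \<eta>
    using abelian_group.axioms(1)[OF abelian_group_Lp[OF p, of "\<mu> x"]] that by (simp add: abelian_monoid.a_comm)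
  have steps: "(\<lambda>w. ?D w (step_class k (?r w) \<oplus>\<^bsub>Lp p (\<mu> (?r w))\<^esub> step_class m (?r w)) (step_class n (?r w))) \<in> borel_measurable ?N"
    for k m n
  proof -
    let ?st = "\<lambda>i. step (from_nat i)"
    have "(\<lambda>x. lp_norm p (\<mu> x) (\<lambda>g. ?st k (x, g) + ?st m (x, g) - ?st n (x, g))) \<in> borel_measurable X"
      by (rule lp_norm_measurable[where r = "\<lambda>x. x" and H = "\<lambda>v. ?st k (snd v) + ?st m (snd v) - ?st n (snd v)"])
        (auto intro!: step_restrict_measurable borel_measurable_diff borel_measurable_add lp_funs_measurable[OF step_lp_funs])
    then have "(\<lambda>x. norm_dist (Lp p (\<mu> x)) (step_class k x \<oplus>\<^bsub>Lp p (\<mu> x)\<^esub> step_class m x) (step_class n x)) \<in> borel_measurable X"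
      by (rule measurable_cong[THEN iffD1, rotated])
        (use p in \<open>simp add: step_class_def lp_add_class norm_dist_Lp lp_funs_add step_lp_funs\<close>)
    from measurable_compose[OF r this] show ?thesis .
  qed
  have half: "(\<lambda>w. ?D w (step_class m (?r w) \<oplus>\<^bsub>Lp p (\<mu> (?r w))\<^esub> snd (snd w)) (step_class n (?r w))) \<in> borel_measurable ?N"
    for m n
    by (rule lp.measurable_if_continuous[OF snd, where h = "\<lambda>w \<eta>. ?D w (step_class m (?r w) \<oplus>\<^bsub>Lp p (\<mu> (?r w))\<^esub> \<eta>) (step_class n (?r w))"])
      (auto intro!: steps cont mem rX step_class_in)
  have "(\<lambda>w. ?D w (snd (snd w) \<oplus>\<^bsub>Lp p (\<mu> (?r w))\<^esub> snd (fst w)) (step_class n (?r w))) \<in> borel_measurable ?N" for n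
  proof (rule lp.measurable_if_continuous[OF fst, where h = "\<lambda>w \<eta>. ?D w (snd (snd w) \<oplus>\<^bsub>Lp p (\<mu> (?r w))\<^esub> \<eta>) (step_class n (?r w))"])
    show "(\<lambda>w. ?D w (snd (snd w) \<oplus>\<^bsub>Lp p (\<mu> (?r w))\<^esub> step_class m (?r w)) (step_class n (?r w))) \<in> borel_measurable ?N" for m
      by (rule measurable_cong[THEN iffD1, OF _ half[of m n]]) (simp add: comm mem rX step_class_in)
  qed (auto intro!: cont mem rX step_class_in)
  then have "(\<lambda>w. ?D w (snd (fst w) \<oplus>\<^bsub>Lp p (\<mu> (?r w))\<^esub> snd (snd w)) (step_class n (?r w))) \<in> borel_measurable ?N" for n
    by (rule measurable_cong[THEN iffD1, rotated]) (simp add: comm mem)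
  then have "(\<lambda>w. (?r w, snd (fst w) \<oplus>\<^bsub>Lp p (\<mu> (?r w))\<^esub> snd (snd w))) \<in> ?N \<rightarrow>\<^sub>M L"
    using r p mem by (intro lp.measurable_into_total_space add_closed_Lp)
  then show ?thesis by (simp add: split_def)
qed

text \<open>Only the vector is approximated by step classes. The scalar stays in the parameter
  \<open>w\<close>, so that norms of scalar multiples of step functions arise as genuine parameter
  integrals.\<close>

lemma smult_measurable:
  "(\<lambda>(c, (x, v)). (x, c \<odot>\<^bsub>Lp p (\<mu> x)\<^esub> v)) \<in> (borel :: complex measure) \<Otimes>\<^sub>M L \<rightarrow>\<^sub>M L"
proof -
  let ?N = "(borel :: complex measure) \<Otimes>\<^sub>M L"
  let ?r = "\<lambda>w :: complex \<times> ('a \<times> ('b \<Rightarrow> complex) set). fst (snd w)"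
  let ?D = "\<lambda>w. norm_dist (Lp p (\<mu> (?r w)))"
  have r: "?r \<in> ?N \<rightarrow>\<^sub>M X"
    by (rule measurable_compose[OF measurable_snd lp.fst_measurable_total_space])
  have rX: "?r w \<in> space X" if "w \<in> space ?N" for w
    by (rule measurable_space[OF r that])
  have v: "(\<lambda>w. (?r w, snd (snd w))) \<in> ?N \<rightarrow>\<^sub>M L" by simp
  have mem: "snd (snd w) \<in> carrier (Lp p (\<mu> (?r w)))" if "w \<in> space ?N" for w
    using measurable_space[OF v that] by (auto simp: lp.space_total_space)
  have "(\<lambda>w. ?D w (fst w \<odot>\<^bsub>Lp p (\<mu> (?r w))\<^esub> snd (snd w)) (step_class n (?r w))) \<in> borel_measurable ?N" for n
  proof (rule lp.measurable_if_continuous[OF v, where h = "\<lambda>w \<eta>. ?D w (fst w \<odot>\<^bsub>Lp p (\<mu> (?r w))\<^esub> \<eta>) (step_class n (?r w))"])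
    fix m
    let ?st = "\<lambda>i. step (from_nat i)"
    have "(\<lambda>w. lp_norm p (\<mu> (?r w)) (\<lambda>g. fst w * ?st m (?r w, g) - ?st n (?r w, g))) \<in> borel_measurable ?N"
    proof -
      have "(\<lambda>v. fst (fst v)) \<in> borel_measurable (restrict_space (?N \<Otimes>\<^sub>M GM) D)" for D
        by (intro measurable_restrict_space1) measurable
      then show ?thesis
        by (intro lp_norm_measurable[where H = "\<lambda>v. fst (fst v) * ?st m (snd v) - ?st n (snd v)"] r
            step_restrict_measurable borel_measurable_diff borel_measurable_times borel_measurable_const
            lp_funs_measurable[OF step_lp_funs] rX) simp_all
    qed
    then show "(\<lambda>w. ?D w (fst w \<odot>\<^bsub>Lp p (\<mu> (?r w))\<^esub> step_class m (?r w)) (step_class n (?r w))) \<in> borel_measurable ?N"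
      by (rule measurable_cong[THEN iffD1, rotated])
        (use p in \<open>simp add: step_class_def lp_smult_class norm_dist_Lp lp_funs_scale step_lp_funs rX\<close>)
  next
    fix w and u :: "nat \<Rightarrow> _"
    assume w: "w \<in> space ?N" and u: "\<And>k. u k \<in> carrier (Lp p (\<mu> (?r w)))"
      and lim: "(\<lambda>k. ?D w (snd (snd w)) (u k)) \<longlonglongrightarrow> 0"
    show "(\<lambda>k. ?D w (fst w \<odot>\<^bsub>Lp p (\<mu> (?r w))\<^esub> u k) (step_class n (?r w)))
        \<longlonglongrightarrow> ?D w (fst w \<odot>\<^bsub>Lp p (\<mu> (?r w))\<^esub> snd (snd w)) (step_class n (?r w))"
      by (rule Metric_space.dist_tendsto[OF Metric_space_Lp[OF p]])
        (use w u p tendsto_mult_right_zero[OF lim] in \<open>simp_all add: smult_closed_Lp norm_dist_smult mem rX step_class_in\<close>)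
  qed
  then have "(\<lambda>w. (?r w, fst w \<odot>\<^bsub>Lp p (\<mu> (?r w))\<^esub> snd (snd w))) \<in> ?N \<rightarrow>\<^sub>M L"
    using r mem by (intro lp.measurable_into_total_space smult_closed_Lp)
  then show ?thesis by (simp add: split_def)
qed

text \<open>The empty code gives the zero class, so the norm is one of the distances that generate
  the structure.\<close>

lemma nrm_measurable: "(\<lambda>(x, v). nrm (Lp p (\<mu> x)) v) \<in> borel_measurable L"
proof -
  have "step_class (to_nat ([] :: ((rat \<times> rat) \<times> (nat \<times> nat) list) list)) x = lp_class p (\<mu> x) (\<lambda>_. 0)" for x
    by (simp add: step_class_def step_def rational_step_def)
  then have "(\<lambda>w. norm_dist (Lp p (\<mu> (fst w))) (snd w) (lp_class p (\<mu> (fst w)) (\<lambda>_. 0))) \<in> borel_measurable L"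
    using lp.dist_measurable_total_space[of "to_nat ([] :: ((rat \<times> rat) \<times> (nat \<times> nat) list) list)"] by simp
  then show ?thesis
    by (rule measurable_cong[THEN iffD1, rotated]) (auto simp: lp.space_total_space nrm_eq_norm_dist p)
qed

lemma closure_of_step_class:
  assumes "x \<in> space X"
  shows "norm_topology (Lp p (\<mu> x)) closure_of range (\<lambda>n. step_class n x) = carrier (Lp p (\<mu> x))"
proof -
  interpret L: Metric_space "carrier (Lp p (\<mu> x))" "norm_dist (Lp p (\<mu> x))" by (rule Metric_space_Lp[OF p])
  have "\<exists>y\<in>range (\<lambda>n. step_class n x). y \<in> L.mball \<xi> r" if "\<xi> \<in> carrier (Lp p (\<mu> x))" "r > 0" for \<xi> r
    using lp.dense_near[OF assms that] step_class_in[OF assms] that by auto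
  then show ?thesis
    unfolding norm_topology_def L.metric_closure_of by blast
qed

lemma topspace_norm_topology: "topspace (norm_topology (Lp p (\<mu> x))) = carrier (Lp p (\<mu> x))"
  unfolding norm_topology_def by (rule Metric_space.topspace_mtopology[OF Metric_space_Lp[OF p]])

theorem borel_field_L: "borel_field_of_separable_banach_spaces X (\<lambda>x. Lp p (\<mu> x)) L"
  unfolding borel_field_of_separable_banach_spaces_def
proof (intro conjI ballI)
  show "standard_borel X" by (rule X)
  show "standard_borel_structure_on (Sigma (space X) (\<lambda>x. carrier (Lp p (\<mu> x)))) L"
    by (simp add: standard_borel_structure_on_def lp.space_total_space lp.standard_borel_total_space)
  show "fst \<in> L \<rightarrow>\<^sub>M X" by (rule lp.fst_measurable_total_space)
  show "dense_sequence_of_borel_sections X (\<lambda>x. norm_topology (Lp p (\<mu> x))) L"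
    unfolding dense_sequence_of_borel_sections_def topspace_norm_topology
    using lp.section_measurable step_class_in closure_of_step_class by blast
  fix x assume x: "x \<in> space X"
  show "banach_space (Lp p (\<mu> x))" by (rule banach_space_Lp[OF p])
  show "separable_space (norm_topology (Lp p (\<mu> x)))"
    unfolding separable_space_def topspace_norm_topology
    using closure_of_step_class[OF x] step_class_in[OF x]
    by (intro exI[of _ "range (\<lambda>n. step_class n x)"]) auto
qed (rule nrm_measurable add_measurable smult_measurable)+

lemma integral_L1_measurable:
  assumes "p = 1"
  shows "(\<lambda>(x, \<xi>). class_integral (\<mu> x) \<xi> (\<lambda>_. 1)) \<in> borel_measurable L"
proof -
  have "(\<lambda>w. class_integral (\<mu> (fst w)) (snd w) (\<lambda>_. 1)) \<in> borel_measurable L"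
  proof (rule lp.measurable_if_continuous[where r = fst and v = snd and h = "\<lambda>w \<xi>. class_integral (\<mu> (fst w)) \<xi> (\<lambda>_. 1)"])
    show "(\<lambda>w. (fst w, snd w)) \<in> L \<rightarrow>\<^sub>M L" by simp
    fix n
    have "(\<lambda>x. LINT g|\<mu> x. step (from_nat n) (x, g)) \<in> borel_measurable X"
      by (rule integral_param_measurable[of "\<lambda>x. x" X "\<lambda>v. step (from_nat n) (snd v)", simplified])
        (use step_lp_funs assms in \<open>auto intro: step_restrict_measurable lp_funs_one_integrable\<close>)
    then have "(\<lambda>x. class_integral (\<mu> x) (step_class n x) (\<lambda>_. 1)) \<in> borel_measurable X"
      by (rule measurable_cong[THEN iffD1, rotated])
        (simp add: step_class_def class_integral_class[OF step_lp_funs])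
    from measurable_compose[OF lp.fst_measurable_total_space this]
    show "(\<lambda>w. class_integral (\<mu> (fst w)) (step_class n (fst w)) (\<lambda>_. 1)) \<in> borel_measurable L" .
  next
    fix w and u :: "nat \<Rightarrow> _"
    assume "w \<in> space L" and u: "\<And>k. u k \<in> carrier (Lp p (\<mu> (fst w)))"
      and lim: "(\<lambda>k. norm_dist (Lp p (\<mu> (fst w))) (snd w) (u k)) \<longlonglongrightarrow> 0"
    then have "snd w \<in> carrier (Lp p (\<mu> (fst w)))"
      by (auto simp: lp.space_total_space)
    then show "(\<lambda>k. class_integral (\<mu> (fst w)) (u k) (\<lambda>_. 1)) \<longlonglongrightarrow> class_integral (\<mu> (fst w)) (snd w) (\<lambda>_. 1)"
      using u lim unfolding assms by (rule class_integral_one_tendsto)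
  qed
  then show ?thesis by (simp add: split_def)
qed

subsection \<open>The pairing with \<open>C\<^sub>c(G)\<close>\<close>

context
  fixes C0M :: "('a \<times> ('b \<Rightarrow> complex)) measure"
  assumes C0M: "C0_borel_structure X T GM C0M"
begin

lemma space_C0M: "space C0M = Sigma (space X) (\<lambda>x. C0 (T x))"
  and standard_C0M: "standard_borel C0M"
  and fst_C0M: "fst \<in> C0M \<rightarrow>\<^sub>M X"
  using C0M by (auto simp: C0_borel_structure_def standard_borel_structure_on_def)

lemma eval_C0M: "(\<lambda>w. snd (fst w) (snd (snd w))) \<in> borel_measurable (fibre_prod C0M GM)"
  using C0M by (simp add: C0_borel_structure_def split_def)

lemma space_Cc_structure: "space (Cc_structure X T C0M) = Sigma (space X) (\<lambda>x. Cc (T x))"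
  using Cc_subset_C0 by (auto simp: Cc_structure_def space_restrict_space space_C0M)

text \<open>The structure on C_0(G) is known only through evaluation. A continuous function is
  determined by its values along the dense sections, so the base code and the real and imaginary
  parts of these values form an injective Borel code.\<close>

lemma section_C0M:
  assumes \<phi>: "\<And>x. x \<in> space X \<Longrightarrow> \<phi> x \<in> C0 (T x)"
    and meas: "\<And>n. (\<lambda>x. \<phi> x (s n x)) \<in> borel_measurable X"
  shows "(\<lambda>x. (x, \<phi> x)) \<in> X \<rightarrow>\<^sub>M C0M"
proof -
  obtain j :: "_ \<Rightarrow> nat \<Rightarrow> real" where j_meas: "j \<in> borel_measurable X" and inj: "inj_on j (space X)"
    by (rule standard_borel_coordinates[OF X])
  let ?v = "\<lambda>w n. snd w (s n (fst w)) :: complex"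
  let ?k = "\<lambda>w. interleave (j (fst w)) (interleave (\<lambda>n. Re (?v w n)) (\<lambda>n. Im (?v w n)))"
  have [measurable]: "(\<lambda>w. ?v w n) \<in> borel_measurable C0M" for n
  proof -
    have "(\<lambda>w. (w, (fst w, s n (fst w)))) \<in> C0M \<rightarrow>\<^sub>M fibre_prod C0M GM"
      by (intro measurable_fibre_prod measurable_compose[OF fst_C0M s_measurable]) auto
    from measurable_compose[OF this eval_C0M] show ?thesis by simp
  qed
  have "(\<lambda>w n. Re (?v w n)) \<in> borel_measurable C0M" "(\<lambda>w n. Im (?v w n)) \<in> borel_measurable C0M"
    by (rule borel_measurable_sequenceI, measurable)+
  then have k: "?k \<in> borel_measurable C0M"
    by (intro interleave_measurable measurable_compose[OF fst_C0M j_meas])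
  show ?thesis
  proof (rule measurable_by_injective_key[OF standard_C0M k])
    show "inj_on ?k (space C0M)"
    proof (rule inj_onI)
      fix w w' assume w: "w \<in> space C0M" "w' \<in> space C0M" and eq: "?k w = ?k w'"
      from arg_cong[OF eq, of evens] have "fst w = fst w'"
        using w inj by (auto simp: space_C0M dest: inj_onD)
      have x: "fst w \<in> space X" using w by (auto simp: space_C0M)
      have "?v w n = ?v w' n" for n
        using arg_cong[OF eq, of "\<lambda>y. evens (odds y) n"] arg_cong[OF eq, of "\<lambda>y. odds (odds y) n"]
        by (simp add: complex_eq_iff)
      then have dense: "snd w g = snd w' g" if "g \<in> range (\<lambda>n. s n (fst w))" for g
        using that \<open>fst w = fst w'\<close> by auto
      have "snd w g = snd w' g" if "g \<in> topspace (T (fst w))" for g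
        by (rule forall_in_closure_of_eq[where X = "T (fst w)" and S = "range (\<lambda>n. s n (fst w))" and Y = euclidean])
          (use w that dense \<open>fst w = fst w'\<close> s_dense[OF x] in \<open>auto simp: space_C0M C0_def\<close>)
      then have "snd w = snd w'"
        using w \<open>fst w = fst w'\<close> by (intro extensionalityI[of _ "topspace (T (fst w))"]) (auto simp: space_C0M C0_def)
      with \<open>fst w = fst w'\<close> show "w = w'" by (simp add: prod_eq_iff)
    qed
    show "(\<lambda>x. (x, \<phi> x)) \<in> space X \<rightarrow> space C0M"
      using \<phi> by (auto simp: space_C0M)
    show "(\<lambda>x. ?k (x, \<phi> x)) \<in> borel_measurable X"
    proof -
      note [measurable] = meas
      have "(\<lambda>x n. Re (\<phi> x (s n x))) \<in> borel_measurable X" "(\<lambda>x n. Im (\<phi> x (s n x))) \<in> borel_measurable X"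
        by (rule borel_measurable_sequenceI, measurable)+
      then show ?thesis
        using j_meas by (simp add: interleave_measurable)
    qed
  qed
qed

definition cutoff_section :: "(nat \<times> nat) list \<Rightarrow> nat \<Rightarrow> 'a \<Rightarrow> 'b \<Rightarrow> complex" where
  "cutoff_section l k x =
     restrict (\<lambda>g. complex_of_real (cutoff (section_dist x) l k (point_dist (x, g)))) (topspace (T x))"

lemma cutoff_section_eq:
  assumes "x \<in> space X"
  shows "cutoff_section l k x = radon_fibre.cutoff_Cc (topspace (T x)) (dist_at x) (\<lambda>n. s n x) l k"
  unfolding cutoff_section_def radon_fibre.cutoff_Cc_def[OF fibre[OF assms]]
  by (simp add: section_dist_def point_dist_def)

lemma cutoff_section_in_Cc:
  assumes "x \<in> space X"
  shows "cutoff_section l k x \<in> Cc (T x)"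
  using radon_fibre.cutoff_Cc_in_Cc[OF fibre[OF assms]] by (simp add: cutoff_section_eq assms topology)

lemma cutoff_section_measurable: "(\<lambda>x. (x, cutoff_section l k x)) \<in> X \<rightarrow>\<^sub>M Cc_structure X T C0M"
  unfolding Cc_structure_def
proof (rule measurable_restrict_space2)
  show "(\<lambda>x. (x, cutoff_section l k x)) \<in> space X \<rightarrow> Sigma (space X) (\<lambda>x. Cc (T x))"
    using cutoff_section_in_Cc by auto
  \<comment> \<open>Measurability is shown on the total space first; composing with the section
    \<open>s n\<close> then gives the values that \<open>section_C0M\<close> asks for.\<close>
  have "(\<lambda>w. bump (section_dist (fst w)) l (point_dist w)) \<in> borel_measurable GM"
  proof (induction l)
    case Nil
    then show ?case by (simp add: bump_def)
  next
    case (Cons a l)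
    note [measurable] = Cons point_dist_measurable measurable_compose[OF fst_GM good_ball_measurable]
    obtain n m where a: "a = (n, m)" by (cases a)
    have "(\<lambda>w. (if good_ball (section_dist (fst w)) n m then max 0 (1 / real (Suc m) - point_dist w n) else 0)
        + bump (section_dist (fst w)) l (point_dist w)) \<in> borel_measurable GM"
      by measurable
    then show ?case by (simp only: bump_Cons a)
  qed
  then have [measurable]: "(\<lambda>w. complex_of_real (cutoff (section_dist (fst w)) l k (point_dist w))) \<in> borel_measurable GM"
    unfolding cutoff_def by measurable
  show "(\<lambda>x. (x, cutoff_section l k x)) \<in> X \<rightarrow>\<^sub>M C0M"
  proof (rule section_C0M)
    show "cutoff_section l k x \<in> C0 (T x)" if "x \<in> space X" for x
      using cutoff_section_in_Cc[OF that] Cc_subset_C0 by blast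
    fix n
    have "(\<lambda>x. complex_of_real (cutoff (section_dist x) l k (point_dist (x, s n x)))) \<in> borel_measurable X"
      using measurable_compose[OF s_measurable[of n], of "\<lambda>w. complex_of_real (cutoff (section_dist (fst w)) l k (point_dist w))"]
      by simp
    then show "(\<lambda>x. cutoff_section l k x (s n x)) \<in> borel_measurable X"
      by (rule measurable_cong[THEN iffD1, rotated]) (simp add: cutoff_section_def s_in)
  qed
qed

text \<open>The function \<open>F\<close> stays in the parameter and only the class is approximated;
  convergence along step classes holds because \<open>F\<close> is bounded and supported in a set of
  finite measure.\<close>

lemma pairing_measurable:
  "(\<lambda>((x, \<xi>), (y, F)). class_integral (\<mu> x) \<xi> F) \<in> borel_measurable (fibre_prod L (Cc_structure X T C0M))"
proof -
  let ?N = "fibre_prod L (Cc_structure X T C0M)"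
  let ?r = "\<lambda>w :: ('a \<times> ('b \<Rightarrow> complex) set) \<times> ('a \<times> ('b \<Rightarrow> complex)). fst (fst w)"
  have r: "?r \<in> ?N \<rightarrow>\<^sub>M X"
    by (rule measurable_compose[OF measurable_fibre_prod_fst lp.fst_measurable_total_space])
  have v: "(\<lambda>w. (?r w, snd (fst w))) \<in> ?N \<rightarrow>\<^sub>M L"
    using measurable_fibre_prod_fst by simp
  have N: "?r w \<in> space X" "fst (snd w) = ?r w" "snd (fst w) \<in> carrier (Lp p (\<mu> (?r w)))" "snd (snd w) \<in> Cc (T (?r w))"
    if "w \<in> space ?N" for w
    using that by (auto simp: space_fibre_prod lp.space_total_space space_Cc_structure)
  have F: "\<exists>B K. K \<in> sets (\<mu> x) \<and> emeasure (\<mu> x) K < \<infinity> \<and> 0 \<le> B \<and> (\<forall>g\<in>space (\<mu> x). cmod (F g) \<le> B * indicator K g)"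
    "F \<in> borel_measurable (\<mu> x)" if "x \<in> space X" "F \<in> Cc (T x)" for x F
  proof -
    interpret R: radon_fibre "topspace (T x)" "dist_at x" "\<lambda>n. s n x" "\<mu> x" by (rule fibre[OF that(1)])
    show "F \<in> borel_measurable (\<mu> x)"
      using that by (intro R.continuous_measurable) (simp add: topology Cc_def)
    have "F \<in> Cc R.mtopology" using that by (simp add: topology)
    then show "\<exists>B K. K \<in> sets (\<mu> x) \<and> emeasure (\<mu> x) K < \<infinity> \<and> 0 \<le> B \<and> (\<forall>g\<in>space (\<mu> x). cmod (F g) \<le> B * indicator K g)"
      by (rule R.Cc_bound)
  qed
  have "(\<lambda>w. class_integral (\<mu> (?r w)) (snd (fst w)) (snd (snd w))) \<in> borel_measurable ?N"
  proof (rule lp.measurable_if_continuous[OF v, where h = "\<lambda>w \<xi>. class_integral (\<mu> (?r w)) \<xi> (snd (snd w))"])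
    fix n
    let ?R = "restrict_space (?N \<Otimes>\<^sub>M GM) {v. ?r (fst v) = fst (snd v)}"
    have "(\<lambda>v. (snd (fst v), snd v)) \<in> ?R \<rightarrow>\<^sub>M fibre_prod C0M GM"
    proof (rule measurable_fibre_prod)
      have "snd \<in> ?N \<rightarrow>\<^sub>M C0M"
        using measurable_fibre_prod_snd[of L "Cc_structure X T C0M"]
        unfolding Cc_structure_def by (simp add: measurable_restrict_space2_iff)
      then show "(\<lambda>v. snd (fst v)) \<in> ?R \<rightarrow>\<^sub>M C0M"
        by (intro measurable_restrict_space1 measurable_compose[OF measurable_fst])
      show "snd \<in> ?R \<rightarrow>\<^sub>M GM"
        by (intro measurable_restrict_space1 measurable_snd)
      show "fst (snd (fst v)) = fst (snd v)" if "v \<in> space ?R" for v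
        using that N(2)[of "fst v"] by (simp add: space_restrict_space space_pair_measure mem_Times_iff)
    qed
    from measurable_compose[OF this eval_C0M]
    have eval: "(\<lambda>v. snd (snd (fst v)) (snd (snd v))) \<in> borel_measurable ?R" by simp
    have "(\<lambda>w. LINT g|\<mu> (?r w). step (from_nat n) (?r w, g) * snd (snd w) g) \<in> borel_measurable ?N"
    proof (rule integral_param_measurable[OF r, of "\<lambda>v. step (from_nat n) (snd v) * snd (snd (fst v)) (snd (snd v))", simplified])
      show "(\<lambda>v. step (from_nat n) (snd v) * snd (snd (fst v)) (snd (snd v))) \<in> borel_measurable ?R"
        by (intro borel_measurable_times step_restrict_measurable eval)
      fix w assume w: "w \<in> space ?N"
      obtain B K where "K \<in> sets (\<mu> (?r w))" "emeasure (\<mu> (?r w)) K < \<infinity>"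
        "\<forall>g\<in>space (\<mu> (?r w)). cmod (snd (snd w) g) \<le> B * indicator K g"
        using F(1)[OF N(1,4)[OF w]] by blast
      then show "integrable (\<mu> (?r w)) (\<lambda>g. step (from_nat n) (?r w, g) * snd (snd w) g)"
        using lp_pairing_integrable(1)[OF p step_lp_funs[OF N(1)[OF w]] F(2)[OF N(1,4)[OF w]]] by blast
    qed
    then show "(\<lambda>w. class_integral (\<mu> (?r w)) (step_class n (?r w)) (snd (snd w))) \<in> borel_measurable ?N"
      by (rule measurable_cong[THEN iffD1, rotated])
        (simp add: step_class_def class_integral_class[OF step_lp_funs] F(2) N)
  next
    fix w and u :: "nat \<Rightarrow> _"
    assume w: "w \<in> space ?N" and u: "\<And>k. u k \<in> carrier (Lp p (\<mu> (?r w)))"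
      and lim: "(\<lambda>k. norm_dist (Lp p (\<mu> (?r w))) (snd (fst w)) (u k)) \<longlonglongrightarrow> 0"
    obtain B K where K: "K \<in> sets (\<mu> (?r w))" "emeasure (\<mu> (?r w)) K < \<infinity>" "0 \<le> B"
      "\<And>g. g\<in>space (\<mu> (?r w)) \<Longrightarrow> cmod (snd (snd w) g) \<le> B * indicator K g"
      using F(1)[OF N(1,4)[OF w]] by blast
    show "(\<lambda>k. class_integral (\<mu> (?r w)) (u k) (snd (snd w))) \<longlonglongrightarrow> class_integral (\<mu> (?r w)) (snd (fst w)) (snd (snd w))"
      by (rule class_integral_tendsto[OF p N(3)[OF w] u F(2)[OF N(1,4)[OF w]] K lim])
  qed
  then show ?thesis by (simp add: split_def)
qed

lemma Lp_borel_structure_L: "Lp_borel_structure X T \<mu> C0M p L"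
  unfolding Lp_borel_structure_def standard_borel_structure_on_def
  by (simp add: lp.space_total_space lp.standard_borel_total_space lp.fst_measurable_total_space pairing_measurable)

text \<open>One code \<open>?k\<close> is Borel for \<open>L'\<close> and for \<open>L\<close>
  alike, being built from the projection and the pairing composed with Borel sections; standard
  Borel structures that share an injective Borel code coincide.\<close>

lemma Lp_borel_structure_unique:
  assumes L': "Lp_borel_structure X T \<mu> C0M p L'"
  shows "sets L' = sets L"
proof -
  obtain j :: "_ \<Rightarrow> nat \<Rightarrow> real" where j_meas: "j \<in> borel_measurable X" and inj: "inj_on j (space X)"
    by (rule standard_borel_coordinates[OF X])
  \<comment> \<open>Enumerates the cutoffs by pairs of a list of balls and a steepness.\<close>
  define lk :: "nat \<Rightarrow> (nat \<times> nat) list \<times> nat" where "lk = from_nat"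
  define P where "P i w = class_integral (\<mu> (fst w)) (snd w) (cutoff_section (fst (lk i)) (snd (lk i)) (fst w))"
    for i and w :: "'a \<times> ('b \<Rightarrow> complex) set"
  let ?k = "\<lambda>w. interleave (j (fst w)) (interleave (\<lambda>n. Re (P n w)) (\<lambda>n. Im (P n w)))"
  have k: "?k \<in> borel_measurable N" if N: "Lp_borel_structure X T \<mu> C0M p N" for N
  proof -
    have fst: "fst \<in> N \<rightarrow>\<^sub>M X" and
      pairing: "(\<lambda>w. class_integral (\<mu> (fst (fst w))) (snd (fst w)) (snd (snd w))) \<in> borel_measurable (fibre_prod N (Cc_structure X T C0M))"
      using N by (simp_all add: Lp_borel_structure_def split_def)
    have [measurable]: "P i \<in> borel_measurable N" for i
    proof -
      have "(\<lambda>w. (w, (fst w, cutoff_section (fst (lk i)) (snd (lk i)) (fst w)))) \<in> N \<rightarrow>\<^sub>M fibre_prod N (Cc_structure X T C0M)"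
        by (intro measurable_fibre_prod measurable_compose[OF fst cutoff_section_measurable]) auto
      from measurable_compose[OF this pairing] show ?thesis
        unfolding P_def[abs_def] by simp
    qed
    have "(\<lambda>w n. Re (P n w)) \<in> borel_measurable N" "(\<lambda>w n. Im (P n w)) \<in> borel_measurable N"
      by (rule borel_measurable_sequenceI, measurable)+
    then show ?thesis
      by (intro interleave_measurable measurable_compose[OF fst j_meas])
  qed
  have space: "space L' = Sigma (space X) (\<lambda>x. carrier (Lp p (\<mu> x)))" and std: "standard_borel L'"
    using L' by (auto simp: Lp_borel_structure_def standard_borel_structure_on_def)
  have "inj_on ?k (space L')"
  proof (rule inj_onI)
    fix w w' assume w: "w \<in> space L'" "w' \<in> space L'" and eq: "?k w = ?k w'"
    from arg_cong[OF eq, of evens] have fst: "fst w = fst w'"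
      using w inj by (auto simp: space dest: inj_onD)
    have x: "fst w \<in> space X" using w by (auto simp: space)
    interpret R: radon_fibre "topspace (T (fst w))" "dist_at (fst w)" "\<lambda>n. s n (fst w)" "\<mu> (fst w)" by (rule fibre[OF x])
    have P: "P i w = P i w'" for i
      using arg_cong[OF eq, of "\<lambda>y. evens (odds y) i"] arg_cong[OF eq, of "\<lambda>y. odds (odds y) i"]
      by (simp add: complex_eq_iff)
    obtain f where f: "f \<in> lp_funs p (\<mu> (fst w))" "snd w = lp_class p (\<mu> (fst w)) f"
      using w(1) by (auto simp: space elim: lp_carrierE)
    obtain h where h: "h \<in> lp_funs p (\<mu> (fst w))" "snd w' = lp_class p (\<mu> (fst w)) h"
      using w(2) fst by (auto simp: space elim: lp_carrierE)
    have "AE g in \<mu> (fst w). f g - h g = 0"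
    proof (rule R.cutoffs_separate[OF p])
      show "(\<lambda>g. f g - h g) \<in> lp_funs p (\<mu> (fst w))"
        using p f h by (intro lp_funs_minus) auto
      fix l n
      let ?F = "R.cutoff_Cc l n"
      have Cc: "?F \<in> Cc R.mtopology" by (rule R.cutoff_Cc_in_Cc)
      have F: "?F \<in> borel_measurable (\<mu> (fst w))"
        using Cc by (intro R.continuous_measurable) (simp add: Cc_def)
      obtain B K where K: "K \<in> sets (\<mu> (fst w))" "emeasure (\<mu> (fst w)) K < \<infinity>"
        "\<forall>g\<in>space (\<mu> (fst w)). cmod (?F g) \<le> B * indicator K g"
        using R.Cc_bound[OF Cc] by blast
      have "class_integral (\<mu> (fst w)) (snd w) ?F = class_integral (\<mu> (fst w)) (snd w') ?F"
        using P[of "to_nat (l, n)"] x by (simp add: P_def lk_def fst[symmetric] cutoff_section_eq)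
      then have "(LINT g|\<mu> (fst w). f g * ?F g) = (LINT g|\<mu> (fst w). h g * ?F g)"
        using f h F by (simp add: class_integral_class)
      then show "(LINT g|\<mu> (fst w). (f g - h g) * ?F g) = 0"
        using lp_pairing_integrable(1)[OF p f(1) F K(1,2) K(3)[rule_format]]
          lp_pairing_integrable(1)[OF p h(1) F K(1,2) K(3)[rule_format]]
        by (simp add: left_diff_distrib)
    qed
    then have "snd w = snd w'"
      using f h by (simp add: lp_class_eq_iff)
    with fst show "w = w'" by (simp add: prod_eq_iff)
  qed
  then show ?thesis
    by (intro standard_borel_sets_eq[where h = ?k] std lp.standard_borel_total_space k L' Lp_borel_structure_L)
      (auto simp: space lp.space_total_space)
qed

end

end

theorem proposition10p7:
  fixes X :: "'x measure"
    and G :: "'x \<Rightarrow> ('g, 'm) monoid_scheme"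
    and T :: "'x \<Rightarrow> 'g topology"
    and GM :: "('x \<times> 'g) measure"
    and \<mu> :: "'x \<Rightarrow> 'g measure"
    and C0M :: "('x \<times> ('g \<Rightarrow> complex)) measure"
    and p :: real
  assumes "borel_field_of_polish_groups X G T GM"
    and "\<And>x. x \<in> space X \<Longrightarrow> locally_compact_space (T x)"
    and "\<And>x. x \<in> space X \<Longrightarrow> left_haar_measure (G x) (T x) (\<mu> x)"
    and "\<And>F :: 'x \<times> 'g \<Rightarrow> ennreal. F \<in> borel_measurable GM \<Longrightarrow>
           (\<lambda>x. \<integral>\<^sup>+ g. F (x, g) \<partial>\<mu> x) \<in> borel_measurable X"
    and "C0_borel_structure X T GM C0M"
    and "1 \<le> p"
  shows "\<exists>L. Lp_borel_structure X T \<mu> C0M p L \<and>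
             (\<forall>L'. Lp_borel_structure X T \<mu> C0M p L' \<longrightarrow> sets L' = sets L) \<and>
             borel_field_of_separable_banach_spaces X (\<lambda>x. Lp p (\<mu> x)) L \<and>
             (p = 1 \<longrightarrow> (\<lambda>(x, \<xi>). class_integral (\<mu> x) \<xi> (\<lambda>_. 1)) \<in> borel_measurable L)"
proof -
  have field: "borel_field_of_polish_spaces X T GM"
    using assms(1) by (simp add: borel_field_of_polish_groups_def)
  then obtain d where d: "d \<in> borel_measurable (fibre_prod GM GM)"
    "\<And>x. x \<in> space X \<Longrightarrow> Metric_space (topspace (T x)) (\<lambda>u v. d ((x, u), (x, v)))"
    "\<And>x. x \<in> space X \<Longrightarrow> Metric_space.mcomplete (topspace (T x)) (\<lambda>u v. d ((x, u), (x, v)))"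
    "\<And>x. x \<in> space X \<Longrightarrow> Metric_space.mtopology (topspace (T x)) (\<lambda>u v. d ((x, u), (x, v))) = T x"
    unfolding borel_field_of_polish_spaces_def by blast
  obtain s :: "nat \<Rightarrow> 'x \<Rightarrow> 'g" where s: "\<And>n. (\<lambda>x. (x, s n x)) \<in> X \<rightarrow>\<^sub>M GM"
    "\<And>x. x \<in> space X \<Longrightarrow> T x closure_of range (\<lambda>n. s n x) = topspace (T x)"
    using field unfolding borel_field_of_polish_spaces_def dense_sequence_of_borel_sections_def by blast
  interpret radon_lp_field X T GM \<mu> d s p
  proof (intro radon_lp_field.intro radon_field.intro radon_lp_field_axioms.intro)
    show "standard_borel X" "standard_borel GM" "space GM = Sigma (space X) (\<lambda>x. topspace (T x))" "fst \<in> GM \<rightarrow>\<^sub>M X"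
      using field by (simp_all add: borel_field_of_polish_spaces_def standard_borel_structure_on_def)
    show "radon_measure (T x) (\<mu> x)" if "x \<in> space X" for x
      using assms(3)[OF that] by (simp add: left_haar_measure_def)
  qed (use d s assms in auto)
  \<comment> \<open>\<open>L\<close> is built from the chosen \<open>d\<close> and \<open>s\<close>;
    uniqueness shows that its sets do not depend on this choice.\<close>
  show ?thesis
    using Lp_borel_structure_L[OF assms(5)] Lp_borel_structure_unique[OF assms(5)] borel_field_L integral_L1_measurable
    by blast
qed

end
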